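(* For all integers $n \geq 2363$, $$\Upsilon_1(n) \leq \frac{\overline{a}(n+1)\,\overline{a}(n-1)}{\overline{a}(n)^2} \leq \Upsilon_2(n),$$ where, with $v=\pi\sqrt{3n/2}$, $$\Upsilon_1(n)= 1- \frac{9\pi^4}{16 v^3} + \frac{45 \pi^4}{16 v^4} -\frac{309}{v^5} - \frac{535}{v^6} - \frac{405 \pi^8}{2048 v^6} - \frac{729 \pi^{12}}{ v^6},$$ $$\Upsilon_2(n)= 1- \frac{9\pi^4}{16 v^3} + \frac{45 \pi^4}{16 v^4} -\frac{308}{v^5} - \frac{286}{v^6} + \frac{81 \pi^8}{256 v^6} + \frac{729 \pi^{12}}{16 v^6}.$$
   Context: The cubic overpartition function $\overline{a}(n)$ is defined by $\sum_{n\ge 0}\overline{a}(n)q^n=\frac{(-q;q)_\infty(-q^2;q^2)_\infty}{(q;q)_\infty(q^2;q^2)_\infty}$ for $|q|<1$, where $(a;q)_\infty=\prod_{j\ge 0}(1-aq^j)$. *)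

theory Defs
  imports "HOL-Analysis.Analysis" "HOL-Computational_Algebra.Formal_Power_Series"
begin

(* Truncated generating product
   prod_{j=1..N} (1+q^j)(1+q^{2j}) / ((1-q^j)(1-q^{2j}))  as a formal power series.
   Factors with j > n are 1 + O(q^{n+1}), so the n-th coefficient of the
   infinite product equals the n-th coefficient of the product truncated at N = n. *)
definition cubic_overpartition_fps :: "nat \<Rightarrow> rat fps" where
  "cubic_overpartition_fps N =
     (\<Prod>j\<in>{1..N}. (1 + fps_X ^ j) * (1 + fps_X ^ (2*j))
        * inverse (1 - fps_X ^ j) * inverse (1 - fps_X ^ (2*j)))"

definition cubic_overpartition :: "nat \<Rightarrow> real" where
  "cubic_overpartition n = of_rat (fps_nth (cubic_overpartition_fps n) n)"

definition Upsilon1 :: "nat \<Rightarrow> real" where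
  "Upsilon1 n = (let v = pi * sqrt (3 * real n / 2) in
     1 - 9 * pi^4 / (16 * v^3) + 45 * pi^4 / (16 * v^4) - 309 / v^5 - 535 / v^6
       - 405 * pi^8 / (2048 * v^6) - 729 * pi^12 / v^6)"

definition Upsilon2 :: "nat \<Rightarrow> real" where
  "Upsilon2 n = (let v = pi * sqrt (3 * real n / 2) in
     1 - 9 * pi^4 / (16 * v^3) + 45 * pi^4 / (16 * v^4) - 308 / v^5 - 286 / v^6
       + 81 * pi^8 / (256 * v^6) + 729 * pi^12 / (16 * v^6))"

end

theory Submission
  imports Defs "HOL-Complex_Analysis.Complex_Analysis"
begin

text \<open>
  By Gauss's identity the generating function is \<open>1 / (\<theta>(q) \<theta>(q\<^sup>2))\<close> with
  \<open>\<theta>(q) = 1 + 2 (- q + q\<^sup>4 - q\<^sup>9 + \<dots>)\<close>, and the inversion formula for \<open>\<theta>\<close> shows that at \<open>q = exp (- t)\<close>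
  it is \<open>t exp (3 \<pi>\<^sup>2 / (8 t)) / (2 sqrt 2 \<pi>)\<close> up to a factor exponentially close to 1 near the positive real axis.
  Cauchy's integral on the circle of radius \<open>exp (- 3 \<pi>\<^sup>2 / (4 v))\<close> then produces a constant multiple of
  \<open>I\<^sub>2(v) / v\<^sup>2\<close> with a relative error of order \<open>v\<^sup>2 exp (- v / 6)\<close>, because off the real axis the logarithm of
  the generating function loses a fixed proportion of its size. The logarithmic derivative of
  \<open>I\<^sub>2(v) / v\<^sup>2\<close> satisfies a Riccati equation, and explicit super- and subsolutions determine the second
  difference of the logarithm of the main term up to \<open>O(v\<^sup>-\<^sup>6)\<close>, which is all that the theorem needs.
\<close>

section \<open>Bounds for a modified Bessel function\<close>

text \<open>The true coefficient of \<open>v^-5\<close> is \<open>- 405 * pi^4 / 128\<close>, about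
  -308.21, and the theorem encloses it between -309 and -308; hence everything down to order
  \<open>v^-5\<close> must be exact. At order \<open>v^-6\<close> the terms with
  \<open>pi^12\<close> leave room for errors in the millions. All crude estimates are made there:
  the quadratic term in passing from the second difference to its exponential, the displacement of
  the argument by at most 1, and the error of the circle method. The last one decides the threshold:
  from \<open>n = 2363\<close> on, \<open>v\<close> is at least 186 for all three arguments, and
  \<open>4 * v^2 * exp (- v / 6)\<close> is then below \<open>1600000 / v^6\<close>. The Bessel
  function is treated through its differential equation instead of an asymptotic series because the
  second derivative of its logarithm is then a polynomial in the first, and explicit errors reduce
  to signs of polynomials in \<open>1 / v\<close>. The obstacle on the circle is the neighbourhood
  of \<open>q = -1\<close>: there \<open>q^2\<close> is close to its modulus, so the factor at
  \<open>q^2\<close> loses nothing and the whole saving has to come from the factor at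
  \<open>q\<close>.\<close>

definition bessel_clifford :: "nat \<Rightarrow> real \<Rightarrow> real" where
  "bessel_clifford k y = (\<Sum>j. y ^ j / (fact j * fact (j + k)))"

lemma summable_bessel_clifford:
  "summable (\<lambda>j. y ^ j / (fact j * fact (j + k)) :: real)"
proof (rule summable_comparison_test')
  show "summable (\<lambda>j. inverse (fact j) * \<bar>y\<bar> ^ j :: real)"
    using summable_exp_generic[of "\<bar>y\<bar>"] by (simp add: field_simps)
  fix j :: nat
  have "(1::real) \<le> fact (j + k)" by simp
  then have "fact j \<le> fact j * (fact (j + k) :: real)"
    by simp
  then show "norm (y ^ j / (fact j * fact (j + k))) \<le> inverse (fact j) * \<bar>y\<bar> ^ j"
    using mult_left_mono[OF \<open>1 \<le> fact (j + k)\<close>, of "\<bar>y\<bar> ^ j"]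
    by (simp add: abs_mult power_abs divide_simps)
qed

text \<open>Differentiation only shifts the index. This is the reason for working with these entire
  functions, where \<open>I_k(v) = (v/2)^k * bessel_clifford k (v^2/4)\<close>, and not with the
  Bessel functions themselves.\<close>

lemma bessel_clifford_has_derivative:
  "(bessel_clifford k has_real_derivative bessel_clifford (Suc k) y) (at y)"
proof -
  let ?c = "\<lambda>j. 1 / (fact j * fact (j + k)) :: real"
  have "DERIV (\<lambda>x. \<Sum>n. ?c n * x ^ n) y :> (\<Sum>n. diffs ?c n * y ^ n)"
    using summable_bessel_clifford[of _ k]
    by (intro termdiffs_strong_converges_everywhere) simp
  moreover have "diffs ?c n * y ^ n = y ^ n / (fact n * fact (n + Suc k))" for n
    by (simp add: diffs_def divide_simps)
  ultimately show ?thesis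
    by (simp add: bessel_clifford_def[abs_def])
qed

text \<open>The three-term Bessel recurrence. Coefficientwise it is
  \<open>j + k + 1 = (k + 1) + j\<close> over a common denominator, the last series being shifted by
  one.\<close>

lemma bessel_clifford_recurrence:
  "bessel_clifford k y = (k + 1) * bessel_clifford (k + 1) y + y * bessel_clifford (k + 2) y"
proof -
  let ?f = "\<lambda>j. y ^ j / (fact j * fact (j + (k + 1))) :: real"
  let ?g = "\<lambda>j. y ^ j / (fact j * fact (j + (k + 2))) :: real"
  let ?h = "\<lambda>j. if j = 0 then 0 else y * ?g (j - 1)"
  have "(\<lambda>j. y * ?g j) sums (y * bessel_clifford (k + 2) y)"
    unfolding bessel_clifford_def by (intro sums_mult summable_sums summable_bessel_clifford)
  then have 1: "?h sums (y * bessel_clifford (k + 2) y)"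
    using sums_Suc_iff[of ?h "y * bessel_clifford (k + 2) y"] by simp
  have 2: "(\<lambda>j. (k + 1) * ?f j) sums ((k + 1) * bessel_clifford (k + 1) y)"
    unfolding bessel_clifford_def by (intro sums_mult summable_sums summable_bessel_clifford)
  have "(k + 1) * ?f j + ?h j = y ^ j / (fact j * fact (j + k))" for j
  proof (cases j)
    case (Suc i)
    then show ?thesis by (simp add: divide_simps) (simp add: algebra_simps)
  qed simp
  with sums_add[OF 2 1] show ?thesis
    by (simp add: bessel_clifford_def sums_iff)
qed

lemma bessel_clifford_pos: "y \<ge> 0 \<Longrightarrow> bessel_clifford k y \<ge> 1 / fact k"
  unfolding bessel_clifford_def
  using sum_le_suminf[OF summable_bessel_clifford, of "{0}" y k] by simp

text \<open>In terms of the modified Bessel function, \<open>bess v = 4 I\<^sub>2(v) / v\<^sup>2\<close>; \<open>bess_ld\<close> is its logarithmic derivative.\<close>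

definition bess :: "real \<Rightarrow> real" where
  "bess v = bessel_clifford 2 (v^2 / 4)"

definition bess_ld :: "real \<Rightarrow> real" where
  "bess_ld v = v / 2 * bessel_clifford 3 (v^2 / 4) / bessel_clifford 2 (v^2 / 4)"

lemma bess_ge: "bess v \<ge> 1 / 2"
  unfolding bess_def using bessel_clifford_pos[of "v\<^sup>2/4" 2] by (simp add: fact_numeral)

lemma bess_pos: "bess v > 0"
  using bess_ge[of v] by linarith

lemma ln_bess_has_derivative:
  "((\<lambda>v. ln (bess v)) has_real_derivative bess_ld v) (at v)"
proof -
  have "(bess has_real_derivative bessel_clifford (Suc 2) (v^2/4) * (v / 2)) (at v)"
    unfolding bess_def[abs_def]
    by (rule DERIV_chain2[OF bessel_clifford_has_derivative]) (auto intro!: derivative_eq_intros)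
  then have "((\<lambda>v. ln (bess v)) has_real_derivative
      (1 / bess v) * (bessel_clifford (Suc 2) (v^2/4) * (v / 2))) (at v)"
    by (intro DERIV_chain2[OF DERIV_ln_divide] bess_pos) auto
  then show ?thesis
    by (simp add: bess_ld_def bess_def field_simps eval_nat_numeral)
qed

lemma bess_ld_nonneg: "v \<ge> 0 \<Longrightarrow> bess_ld v \<ge> 0"
  unfolding bess_ld_def
  by (intro divide_nonneg_nonneg mult_nonneg_nonneg order_trans[OF _ bessel_clifford_pos]) auto

text \<open>Differentiating the quotient brings in the function of index 4, which the recurrence
  eliminates. Only the quotient of indices 3 and 2 survives, so the equation closes: it is Bessel's
  equation in Riccati form.\<close>

lemma bess_ld_riccati:
  assumes "v \<noteq> 0"
  shows "(bess_ld has_real_derivative 1 - 5 * bess_ld v / v - (bess_ld v)\<^sup>2) (at v)"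
proof -
  let ?B = "\<lambda>k. bessel_clifford k (v^2/4)"
  have D: "((\<lambda>v. bessel_clifford k (v^2/4)) has_real_derivative ?B (Suc k) * (v / 2)) (at v)" for k
    by (rule DERIV_chain2[OF bessel_clifford_has_derivative]) (auto intro!: derivative_eq_intros)
  have p: "?B 2 > 0" using bess_pos[of v] by (simp add: bess_def)
  have "((\<lambda>v. v / 2) has_real_derivative 1 / 2) (at v)"
    by (auto intro!: derivative_eq_intros)
  from DERIV_divide[OF DERIV_mult[OF this D[of 3]] D[of 2]]
  have der: "(bess_ld has_real_derivative
     ((1/2 * ?B 3 + ?B 4 * (v/2) * (v / 2)) * ?B 2 - (v/2 * ?B 3) * (?B 3 * (v/2))) / (?B 2 * ?B 2)) (at v)"
    using p unfolding bess_ld_def[abs_def] by simp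
  have r: "?B 2 = 3 * ?B 3 + v^2 / 4 * ?B 4"
    using bessel_clifford_recurrence[of 2 "v\<^sup>2/4"] by simp
  have eq: "((1/2 * b3 + b4 * (v/2) * (v / 2)) * b2 - (v/2 * b3) * (b3 * (v/2))) / (b2 * b2)
      = 1 - 5 * (v / 2 * b3 / b2) / v - (v / 2 * b3 / b2)\<^sup>2"
    if b: "b2 > 0" "b2 = 3 * b3 + v^2 / 4 * b4" for b2 b3 b4 :: real
  proof -
    have 4: "v\<^sup>2 * b4 = 4 * b2 - 12 * b3" using b(2) by simp
    have "1/2 * b3 + b4 * (v/2) * (v / 2) = b2 - 5 / 2 * b3"
      using 4 by (simp add: field_simps power2_eq_square)
    then show ?thesis using b(1) assms
      by (simp add: divide_simps power2_eq_square)
  qed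
  show ?thesis
    using der unfolding eq[OF p r] bess_ld_def[symmetric] .
qed

text \<open>Comparison of coefficients, by \<open>fact (j + 3) = (j + 3) * fact (j + 2)\<close>. It
  supplies the initial value at 2 for the upper bound of \<open>bess_ld\<close>.\<close>

lemma bess_ld_le:
  assumes "v \<ge> 0"
  shows "bess_ld v \<le> v / 6"
proof -
  have "bessel_clifford 3 y \<le> bessel_clifford 2 y / 3" if "y \<ge> 0" for y
  proof -
    have "bessel_clifford 3 y \<le> (\<Sum>j. y ^ j / (fact j * fact (j + 2)) / 3)"
      unfolding bessel_clifford_def
    proof (intro suminf_le summable_bessel_clifford summable_divide)
      fix j :: nat
      have "fact (j + 3) = (real j + 3) * fact (j + 2)"
        by (simp add: eval_nat_numeral algebra_simps)
      then have "3 * (fact j * fact (j + 2)) \<le> (fact j * fact (j + 3) :: real)"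
        by (simp add: algebra_simps)
      then show "y ^ j / (fact j * fact (j + 3)) \<le> y ^ j / (fact j * fact (j + 2)) / 3"
        using that by (simp add: divide_left_mono)
    qed
    also have "\<dots> = bessel_clifford 2 y / 3"
      unfolding bessel_clifford_def by (rule suminf_divide[OF summable_bessel_clifford])
    finally show ?thesis .
  qed
  from mult_left_mono[OF this[of "v\<^sup>2/4"], of "v / 2"] assms
  have "v / 2 * bessel_clifford 3 (v^2 / 4) \<le> v / 6 * bess v"
    by (simp add: bess_def)
  then show ?thesis
    using bess_pos[of v] by (simp add: bess_ld_def bess_def divide_simps)
qed

section \<open>Comparison with super- and subsolutions of the Riccati equation\<close>

text \<open>\<open>exp (Q x)\<close> is an integrating factor: the derivative of
  \<open>exp (Q x) * D x\<close> is this factor times the left-hand side of the assumed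
  inequality.\<close>

lemma linear_differential_inequality:
  fixes D Q :: "real \<Rightarrow> real"
  assumes "a \<le> b" "D a \<ge> 0"
    and D: "\<And>x. a \<le> x \<Longrightarrow> x \<le> b \<Longrightarrow> (D has_real_derivative D' x) (at x)"
    and Q: "\<And>x. a \<le> x \<Longrightarrow> x \<le> b \<Longrightarrow> (Q has_real_derivative q x) (at x)"
    and ineq: "\<And>x. a \<le> x \<Longrightarrow> x \<le> b \<Longrightarrow> D' x + q x * D x \<ge> 0"
  shows "D b \<ge> 0"
proof -
  have "exp (Q a) * D a \<le> exp (Q b) * D b"
  proof (rule DERIV_nonneg_imp_nondecreasing[OF \<open>a \<le> b\<close>])
    fix x assume x: "a \<le> x" "x \<le> b"
    have "((\<lambda>x. exp (Q x) * D x) has_real_derivative exp (Q x) * (D' x + q x * D x)) (at x)"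
      by (rule derivative_eq_intros D[OF x] Q[OF x] refl | simp add: algebra_simps)+
    then show "\<exists>y. ((\<lambda>x. exp (Q x) * D x) has_real_derivative y) (at x) \<and> 0 \<le> y"
      using ineq[OF x] by auto
  qed
  moreover have "0 \<le> exp (Q a) * D a" using assms(2) by simp
  ultimately have "0 \<le> exp (Q b) * D b" by linarith
  then show ?thesis by (simp add: zero_le_mult_iff)
qed

text \<open>The truncation at order \<open>v\<^sup>-\<^sup>3\<close> of the formal solution of the Riccati equation of
  \<open>bess_ld\<close>, perturbed to a super- or subsolution.\<close>

definition ld_approx :: "real \<Rightarrow> real \<Rightarrow> real" where
  "ld_approx k v = 1 - 5 / (2 * v) + 15 / (8 * v^2) + 15 / (8 * v^3) + k / v^4"

definition ld_approx_deriv :: "real \<Rightarrow> real \<Rightarrow> real" where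
  "ld_approx_deriv k v = 5 / (2 * v^2) - 15 / (4 * v^3) - 45 / (8 * v^4) - 4 * k / v^5"

lemma ld_approx_has_derivative:
  assumes "v > 0"
  shows "(ld_approx k has_real_derivative ld_approx_deriv k v) (at v)"
  unfolding ld_approx_def[abs_def] ld_approx_deriv_def
  by (rule derivative_eq_intros refl | use assms in \<open>simp; fail\<close>)+
    (use assms in \<open>simp add: field_simps eval_nat_numeral\<close>)

text \<open>The defect of \<open>ld_approx k\<close> in the Riccati equation. The coefficients 5/2,
  15/8, 15/8 are those for which all orders below \<open>w^4\<close> cancel. The next exact
  coefficient would be 135/128, the zero of \<open>2 * k - 135/64\<close>; a larger \<open>k\<close>
  gives a positive leading defect, a smaller one a negative.\<close>

lemma ld_approx_residue:
  fixes v :: real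
  defines "w \<equiv> 1 / v"
  shows "ld_approx_deriv k v - (1 - 5 * ld_approx k v / v - (ld_approx k v)\<^sup>2) =
    w^4 * ((2 * k - 135/64) + (225/32 - 4 * k) * w + (225/64 + 15/4 * k) * w^2 + 15/4 * k * w^3 + k^2 * w^4)"
proof -
  have X: "ld_approx k v = 1 - 5/2 * w + 15/8 * w^2 + 15/8 * w^3 + k * w^4"
    by (simp add: ld_approx_def w_def power_divide)
  have D: "ld_approx_deriv k v = 5/2 * w^2 - 15/4 * w^3 - 45/8 * w^4 - 4 * k * w^5"
    by (simp add: ld_approx_deriv_def w_def power_divide)
  have "5 * ld_approx k v / v = 5 * ld_approx k v * w"
    by (simp add: w_def)
  then show ?thesis
    unfolding X D by algebra
qed

text \<open>If \<open>l\<close> solves the Riccati equation, then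
  \<open>(X - l)' = defect - (5/v + X + l) * (X - l)\<close>. The bracket has an explicit primitive
  because \<open>l\<close> is itself the derivative of \<open>ln (bess v)\<close>.\<close>

lemma integrating_factor:
  assumes "v > 0"
  shows "((\<lambda>v. ln (bess v) + 5/2 * ln v + v - 15 / (8 * v) - 15 / (16 * v^2) - k / (3 * v^3))
    has_real_derivative 5 / v + ld_approx k v + bess_ld v) (at v)"
  unfolding ld_approx_def
  by (rule ln_bess_has_derivative derivative_eq_intros refl | use assms in \<open>simp; fail\<close>)+
    (use assms in \<open>simp add: divide_simps eval_nat_numeral algebra_simps\<close>)


lemma bess_ld_upper:
  assumes "v \<ge> 2"
  shows "bess_ld v \<le> ld_approx 20 v"
proof -
  have "ld_approx 20 v - bess_ld v \<ge> 0"
  proof (rule linear_differential_inequality[OF assms, where D = "\<lambda>v. ld_approx 20 v - bess_ld v"])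
    show "0 \<le> ld_approx 20 2 - bess_ld 2"
      using bess_ld_le[of 2] by (simp add: ld_approx_def)
    fix x :: real assume x: "2 \<le> x" "x \<le> v"
    show "((\<lambda>v. ld_approx 20 v - bess_ld v) has_real_derivative
        ld_approx_deriv 20 x - (1 - 5 * bess_ld x / x - (bess_ld x)\<^sup>2)) (at x)"
      using x by (intro DERIV_diff ld_approx_has_derivative bess_ld_riccati) auto
    show "((\<lambda>v. ln (bess v) + 5/2 * ln v + v - 15 / (8 * v) - 15 / (16 * v^2) - 20 / (3 * v^3))
        has_real_derivative 5 / x + ld_approx 20 x + bess_ld x) (at x)"
      using x by (intro integrating_factor) auto
    define w where "w = 1 / x"
    have w: "0 \<le> w" using x by (simp add: w_def)
    \<comment> \<open>The tangent of \<open>w^2\<close> at 2/3: it shares out the negative linear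
      term of the defect between the constant and the quadratic term.\<close>
    have "0 \<le> (w - 2/3)^2" by simp
    then have "w \<le> 3/4 * w^2 + 1/3" by (simp add: power2_eq_square algebra_simps)
    then have "0 \<le> 2425/64 - 2335/32 * w + 5025/64 * w^2"
      using zero_le_power2[of w] by linarith
    then have "0 \<le> 2425/64 - 2335/32 * w + 5025/64 * w^2 + 75 * w^3 + 400 * w^4"
      by (rule add_nonneg_nonneg[OF add_nonneg_nonneg]) (use w in auto)
    then have "0 \<le> w^4 * (2425/64 - 2335/32 * w + 5025/64 * w^2 + 75 * w^3 + 400 * w^4)"
      using w by (intro mult_nonneg_nonneg) auto
    then have "0 \<le> ld_approx_deriv 20 x - (1 - 5 * ld_approx 20 x / x - (ld_approx 20 x)\<^sup>2)"
      using ld_approx_residue[of 20 x, folded w_def] by (simp add: algebra_simps)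
    then show "0 \<le> ld_approx_deriv 20 x - (1 - 5 * bess_ld x / x - (bess_ld x)\<^sup>2)
        + (5 / x + ld_approx 20 x + bess_ld x) * (ld_approx 20 x - bess_ld x)"
      by (simp add: algebra_simps power2_eq_square diff_divide_distrib)
  qed
  then show ?thesis by simp
qed

text \<open>Mirror image of the upper bound. At 5/2 the subsolution is already negative, so the sign
  of \<open>bess_ld\<close> serves as initial value; \<open>w \<le> 2/5\<close> keeps the terms of
  the wrong sign, \<open>400 * w^4\<close> and the linear one, under control.\<close>

lemma bess_ld_lower:
  assumes "v \<ge> 5 / 2"
  shows "bess_ld v \<ge> ld_approx (-20) v"
proof -
  have "bess_ld v - ld_approx (-20) v \<ge> 0"
  proof (rule linear_differential_inequality[OF assms, where D = "\<lambda>v. bess_ld v - ld_approx (-20) v"])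
    show "0 \<le> bess_ld (5/2) - ld_approx (-20) (5/2)"
      using bess_ld_nonneg[of "5/2"] by (simp add: ld_approx_def power_divide)
    fix x :: real assume x: "5/2 \<le> x" "x \<le> v"
    show "((\<lambda>v. bess_ld v - ld_approx (-20) v) has_real_derivative
        (1 - 5 * bess_ld x / x - (bess_ld x)\<^sup>2) - ld_approx_deriv (-20) x) (at x)"
      using x by (intro DERIV_diff ld_approx_has_derivative bess_ld_riccati) auto
    show "((\<lambda>v. ln (bess v) + 5/2 * ln v + v - 15 / (8 * v) - 15 / (16 * v^2) - (-20) / (3 * v^3))
        has_real_derivative 5 / x + ld_approx (-20) x + bess_ld x) (at x)"
      using x by (intro integrating_factor) auto
    define w where "w = 1 / x"
    have w: "0 \<le> w" "w \<le> 2/5" using x by (simp_all add: w_def divide_simps)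
    have 4: "w^4 \<le> 2/5 * w^3"
      using mult_right_mono[OF w(2), of "w^3"] w(1) by (simp add: eval_nat_numeral)
    have 3: "w^3 \<le> 2/5 * w^2"
      using mult_right_mono[OF w(2), of "w^2"] w(1) by (simp add: eval_nat_numeral)
    have le: "400 * w^4 + 2785/32 * w \<le> 75 * w^3 + 2695/64 + 4575/64 * w^2"
      using 3 4 w zero_le_power2[of w] by linarith
    then have "w^4 * (400 * w^4 + 2785/32 * w - (75 * w^3 + 2695/64 + 4575/64 * w^2)) \<le> 0"
      using w by (intro mult_nonneg_nonpos) auto
    then have "0 \<ge> ld_approx_deriv (-20) x - (1 - 5 * ld_approx (-20) x / x - (ld_approx (-20) x)\<^sup>2)"
      using ld_approx_residue[of "-20" x, folded w_def] by (simp add: algebra_simps)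
    then show "0 \<le> (1 - 5 * bess_ld x / x - (bess_ld x)\<^sup>2) - ld_approx_deriv (-20) x
        + (5 / x + ld_approx (-20) x + bess_ld x) * (bess_ld x - ld_approx (-20) x)"
      by (simp add: algebra_simps power2_eq_square diff_divide_distrib)
  qed
  then show ?thesis by simp
qed

text \<open>The lower bound on \<open>bess_ld\<close> makes
  \<open>ln (bess v) + 5/2 * ln v - v\<close> increasing from 3 on, where
  \<open>15 * x^2 + 15 * x - 160\<close> is positive. The factor 1/3 is
  \<open>1/2 * 15 / (45/2)\<close>, from rounded values at 3.\<close>

lemma bess_lower:
  assumes "v \<ge> 3"
  shows "bess v \<ge> 1/3 * exp v * v powr (-5/2)"
proof -
  let ?f = "\<lambda>v. ln (bess v) + 5/2 * ln v - v"
  have "?f 3 \<le> ?f v"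
  proof (rule DERIV_nonneg_imp_nondecreasing[OF assms])
    fix x assume x: "3 \<le> x" "x \<le> v"
    have D: "(?f has_real_derivative bess_ld x + 5/2 * (1/x) - 1) (at x)"
      by (rule ln_bess_has_derivative derivative_eq_intros refl | use x in \<open>simp; fail\<close>)+
    have "3 * 3 \<le> x * x" using x by (intro mult_mono) auto
    then have "0 \<le> 15 * x^2 + 15 * x - 160"
      using x by (simp add: power2_eq_square)
    then have "0 \<le> (15 * x^2 + 15 * x - 160) / (8 * x^4)" by simp
    also have "\<dots> = 15 / (8 * x^2) + 15 / (8 * x^3) - 20 / x^4"
      using x by (simp add: divide_simps) (simp add: algebra_simps eval_nat_numeral)
    also have "\<dots> \<le> bess_ld x + 5/2 * (1/x) - 1"
      using bess_ld_lower[of x] x by (simp add: ld_approx_def)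
    finally show "\<exists>y. (?f has_real_derivative y) (at x) \<and> 0 \<le> y" using D by blast
  qed
  then have "exp (?f 3) \<le> exp (?f v)" by simp
  then have 1: "bess 3 * 3 powr (5/2) / exp 3 \<le> bess v * v powr (5/2) / exp v"
    using assms bess_pos by (simp add: exp_diff exp_add powr_def mult.commute)
  have "15 \<le> (3::real) powr (5/2)"
  proof -
    have "(15::real)^2 \<le> 3 ^ 5" by simp
    also have "(3::real) ^ 5 = (3 powr (5/2))^2"
      by (simp add: powr_powr flip: powr_numeral)
    finally show ?thesis by (rule power2_le_imp_le) simp
  qed
  moreover have "exp (3::real) \<le> 45/2"
  proof -
    have "exp (3::real) = exp 1 ^ 3" by (simp flip: exp_of_nat_mult)
    also have "\<dots> \<le> (272/100) ^ 3" using e_less_272 by (intro power_mono) auto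
    finally show ?thesis by (simp add: eval_nat_numeral)
  qed
  moreover have "1/2 * 15 \<le> bess 3 * 3 powr (5/2)"
    using bess_ge[of 3] calculation(1) by (intro mult_mono) auto
  ultimately have "1/3 \<le> bess 3 * 3 powr (5/2) / exp 3"
    by (simp add: divide_simps)
  from order_trans[OF this 1] have "1/3 \<le> bess v * v powr (5/2) / exp v" by simp
  then show ?thesis
    using assms by (simp add: powr_minus divide_simps)
qed

section \<open>Second differences of the main term\<close>

definition cubv :: "real \<Rightarrow> real" where
  "cubv x = pi * sqrt (3 * x / 2)"

lemma cubv_pos: "x > 0 \<Longrightarrow> cubv x > 0"
  by (simp add: cubv_def)

lemma cubv_square: "x \<ge> 0 \<Longrightarrow> (cubv x)\<^sup>2 = 3 * pi^2 / 2 * x"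
  by (simp add: cubv_def power_mult_distrib)

lemma cubv_has_derivative:
  assumes "x > 0"
  shows "(cubv has_real_derivative 3 * pi^2 / (4 * cubv x)) (at x)"
proof -
  have "(cubv has_real_derivative pi * (inverse (sqrt (3 * x / 2)) / 2 * (3 / 2))) (at x)"
    unfolding cubv_def[abs_def]
    by (rule derivative_eq_intros refl | use assms in \<open>simp; fail\<close>)+
  then show ?thesis
    using assms by (simp add: cubv_def field_simps power2_eq_square)
qed

definition log_main' :: "real \<Rightarrow> real" where
  "log_main' x = bess_ld (cubv x) * (3 * pi^2 / (4 * cubv x))"

text \<open>The 6 is 5 from the Riccati equation plus 1 from differentiating
  \<open>3 * pi^2 / (4 * cubv x)\<close>. No derivative of \<open>bess_ld\<close> is left, so bounds
  on \<open>bess_ld\<close> alone suffice.\<close>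

definition log_main'' :: "real \<Rightarrow> real" where
  "log_main'' x = 9 * pi^4 / 16 * (1 / cubv x)^2
      * (1 - 6 * bess_ld (cubv x) * (1 / cubv x) - (bess_ld (cubv x))\<^sup>2)"

lemma log_main_has_derivative:
  assumes "x > 0"
  shows "((\<lambda>x. ln (bess (cubv x))) has_real_derivative log_main' x) (at x)"
  unfolding log_main'_def
  by (rule DERIV_chain2[OF ln_bess_has_derivative cubv_has_derivative[OF assms]])

lemma log_main'_has_derivative:
  assumes "x > 0"
  shows "(log_main' has_real_derivative log_main'' x) (at x)"
proof -
  let ?v = "cubv x" and ?l = "bess_ld (cubv x)"
  have v: "?v > 0" using assms by (rule cubv_pos)
  have 1: "((\<lambda>x. bess_ld (cubv x)) has_real_derivative
      (1 - 5 * ?l / ?v - ?l\<^sup>2) * (3 * pi^2 / (4 * ?v))) (at x)"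
    using v by (intro DERIV_chain2[OF bess_ld_riccati cubv_has_derivative[OF assms]]) auto
  have 2: "((\<lambda>x. 3 * pi^2 / (4 * cubv x)) has_real_derivative
     - (3 * pi^2 * (4 * (3 * pi^2 / (4 * ?v)))) / (4 * ?v * (4 * ?v))) (at x)"
    by (rule cubv_has_derivative derivative_eq_intros refl | use v assms in \<open>simp; fail\<close>)+
  show ?thesis
    unfolding log_main'_def[abs_def] log_main''_def
    by (rule DERIV_cong[OF DERIV_mult[OF 1 2]])
       (use v in \<open>simp add: field_simps eval_nat_numeral\<close>)
qed

text \<open>Taylor's formula of order 2 for the even function of \<open>s\<close> that adds the
  values at \<open>x + s\<close> and \<open>x - s\<close>; its linear term vanishes. Keeping both
  points in the result lets their first-order deviations cancel later.\<close>

lemma log_main_second_difference: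
  assumes "x > 1"
  obtains s where "0 < s" "s < 1"
    "ln (bess (cubv (x + 1))) + ln (bess (cubv (x - 1))) - 2 * ln (bess (cubv x))
       = (log_main'' (x + s) + log_main'' (x - s)) / 2"
proof -
  define d :: "nat \<Rightarrow> real \<Rightarrow> real" where
    "d m s = (if m = 0 then ln (bess (cubv (x + s))) + ln (bess (cubv (x - s)))
      else if m = 1 then log_main' (x + s) - log_main' (x - s)
      else log_main'' (x + s) + log_main'' (x - s))" for m s
  have D: "\<forall>m t. m < 2 \<and> 0 \<le> t \<and> t \<le> 1 \<longrightarrow> (d m has_real_derivative d (Suc m) t) (at t)"
  proof (intro allI impI; elim conjE)
    fix m :: nat and t :: real
    assume t: "m < 2" "0 \<le> t" "t \<le> 1"
    have p: "((\<lambda>s. x + s) has_real_derivative 1) (at t)"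
      and q: "((\<lambda>s. x - s) has_real_derivative - 1) (at t)"
      by (auto intro!: derivative_eq_intros)
    note 0 = DERIV_chain2[OF log_main_has_derivative p] DERIV_chain2[OF log_main_has_derivative q]
    note 1 = DERIV_chain2[OF log_main'_has_derivative p] DERIV_chain2[OF log_main'_has_derivative q]
    show "(d m has_real_derivative d (Suc m) t) (at t)"
    proof (cases "m = 0")
      case True
      then show ?thesis
        unfolding d_def[abs_def] using DERIV_add[OF 0] assms t by simp
    next
      case False
      then have "m = 1" using t by simp
      then show ?thesis
        unfolding d_def[abs_def] using DERIV_diff[OF 1] assms t by simp
    qed
  qed
  obtain s where s: "0 < s" "s < 1" "d 0 1 = (\<Sum>m<2. d m 0 / fact m * 1 ^ m) + d 2 s / fact 2 * 1 ^ 2"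
    using Maclaurin[of 1 2 d "d 0", OF _ _ _ D] by auto
  have "d 0 1 - 2 * ln (bess (cubv x)) = d 2 s / 2"
    using s(3) by (simp add: d_def eval_nat_numeral)
  with s(1,2) show ?thesis
    by (intro that[of s]) (auto simp: d_def)
qed

text \<open>\<open>w^2\<close> times the truncated expansion of \<open>1 - 6 * P * w - P^2\<close>
  at the formal solution \<open>P\<close>. Multiplied by \<open>9 * pi^4 / 16\<close> it carries the
  exact coefficients of \<open>v^-3\<close>, \<open>v^-4\<close> and \<open>v^-5\<close>.\<close>

definition main_poly :: "real \<Rightarrow> real" where
  "main_poly w = 5 * w^4 - w^3 - 45/8 * w^5"

text \<open>The remainder starts with \<open>- (2 * k + 345/64) * w^4\<close>, about -45.4 or 34.6
  times \<open>w^4\<close>; 60 also covers the higher terms for \<open>w \<le> 1/10\<close>. The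
  sign of \<open>P\<close> is recorded for the monotonicity argument that follows.\<close>

lemma log_main''_approx_aux:
  fixes w k :: real
  assumes w: "0 \<le> w" "w \<le> 1/10" and k: "\<bar>k\<bar> = 20"
    and P: "P = 1 - 5/2 * w + 15/8 * w^2 + 15/8 * w^3 + k * w^4"
  shows "\<bar>(1 - 6 * P * w - P\<^sup>2) - (- w + 5 * w^2 - 45/8 * w^3)\<bar> \<le> 60 * w^4" and "P \<ge> 0"
proof -
  have wk: "0 \<le> w^2" "w^2 \<le> 1/100" "0 \<le> w^3" "w^3 \<le> 1/1000" "0 \<le> w^4" "w^4 \<le> 1/10000"
    using w power_mono[OF w(2,1), of 2] power_mono[OF w(2,1), of 3] power_mono[OF w(2,1), of 4]
    by (simp_all add: power_divide)
  have "(1 - 6 * P * w - P\<^sup>2) - (- w + 5 * w^2 - 45/8 * w^3)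
      = - (w^4 * ((2*k + 345/64) + (k + 225/32) * w + (15/4 * k + 225/64) * w^2 + 15/4 * k * w^3 + k^2 * w^4))"
    unfolding P by algebra
  moreover have lin: "\<bar>(2*k + 345/64) + (k + 225/32) * w + (15/4 * k + 225/64) * w^2 + 15/4 * k * w^3 + k^2 * w^4\<bar> \<le> 60"
  proof -
    have "\<bar>2905/64 + 865/32 * w + 5025/64 * w^2 + 75 * w^3 + 400 * w^4\<bar> \<le> 60"
      "\<bar>-2215/64 - 415/32 * w - 4575/64 * w^2 - 75 * w^3 + 400 * w^4\<bar> \<le> 60"
      unfolding abs_le_iff using wk w by linarith+
    moreover have "k = 20 \<or> k = -20" using k by linarith
    ultimately show ?thesis by (elim disjE) (simp_all add: algebra_simps)
  qed
  then have "w^4 * \<bar>(2*k + 345/64) + (k + 225/32) * w + (15/4 * k + 225/64) * w^2 + 15/4 * k * w^3 + k^2 * w^4\<bar> \<le> w^4 * 60"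
    using wk by (intro mult_left_mono) auto
  ultimately show "\<bar>(1 - 6 * P * w - P\<^sup>2) - (- w + 5 * w^2 - 45/8 * w^3)\<bar> \<le> 60 * w^4"
    using wk by (simp add: abs_mult mult.commute)
  have "0 \<le> 1 - 5/2 * w + 15/8 * w^2 + 15/8 * w^3 - 20 * w^4"
    using wk w by linarith
  moreover have "- (20 * w^4) \<le> k * w^4"
    using mult_right_mono[of "-20" k "w^4"] k wk by simp
  ultimately show "P \<ge> 0" unfolding P by linarith
qed

lemma log_main''_approx:
  assumes "cubv x \<ge> 10"
  shows "\<bar>log_main'' x - 9 * pi^4 / 16 * main_poly (1 / cubv x)\<bar> \<le> 9 * pi^4 / 16 * (60 * (1 / cubv x)^6)"
proof -
  define v l where "v = cubv x" and "l = bess_ld (cubv x)"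
  define w where "w = 1 / v"
  have v: "v \<ge> 10" using assms by (simp add: v_def)
  have w: "0 \<le> w" "w \<le> 1/10" using v by (simp_all add: w_def)
  define Q where "Q = (\<lambda>P. 1 - 6 * P * w - P\<^sup>2)"
  \<comment> \<open>\<open>Q\<close> is decreasing on the nonnegative half-line, so the enclosure of
    \<open>l\<close> transfers to \<open>Q l\<close>; both ends have the same expansion up to
    \<open>60 * w^4\<close>.\<close>
  have Q: "Q b \<le> Q a" if "0 \<le> a" "a \<le> b" for a b
    unfolding Q_def using that w by (intro diff_mono mult_right_mono power_mono) auto
  have P: "ld_approx k v = 1 - 5/2 * w + 15/8 * w^2 + 15/8 * w^3 + k * w^4" for k
    by (simp add: ld_approx_def w_def power_divide)
  have up: "\<bar>Q (ld_approx 20 v) - (- w + 5 * w^2 - 45/8 * w^3)\<bar> \<le> 60 * w^4"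
    unfolding Q_def by (rule log_main''_approx_aux(1)[OF w _ P]) simp
  have lo: "\<bar>Q (ld_approx (-20) v) - (- w + 5 * w^2 - 45/8 * w^3)\<bar> \<le> 60 * w^4"
    unfolding Q_def by (rule log_main''_approx_aux(1)[OF w _ P]) simp
  have nonneg: "0 \<le> ld_approx (-20) v"
    by (rule log_main''_approx_aux(2)[OF w _ P]) simp
  have l: "ld_approx (-20) v \<le> l" "l \<le> ld_approx 20 v"
    using bess_ld_upper[of v] bess_ld_lower[of v] v by (simp_all add: v_def l_def)
  have "Q l \<le> Q (ld_approx (-20) v)" "Q (ld_approx 20 v) \<le> Q l"
    using l nonneg by (auto intro!: Q)
  then have "\<bar>Q l - (- w + 5 * w^2 - 45/8 * w^3)\<bar> \<le> 60 * w^4"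
    using up lo by linarith
  then have "9 * pi^4 / 16 * w^2 * \<bar>Q l - (- w + 5 * w^2 - 45/8 * w^3)\<bar> \<le> 9 * pi^4 / 16 * w^2 * (60 * w^4)"
    by (intro mult_left_mono) auto
  also have "9 * pi^4 / 16 * w^2 * \<bar>Q l - (- w + 5 * w^2 - 45/8 * w^3)\<bar>
     = \<bar>9 * pi^4 / 16 * w^2 * (Q l - (- w + 5 * w^2 - 45/8 * w^3))\<bar>"
    by (simp add: abs_mult)
  also have "9 * pi^4 / 16 * w^2 * (Q l - (- w + 5 * w^2 - 45/8 * w^3))
     = 9 * pi^4 / 16 * w^2 * Q l - 9 * pi^4 / 16 * main_poly w"
    by (simp add: main_poly_def algebra_simps eval_nat_numeral)
  also have "9 * pi^4 / 16 * w^2 * Q l = log_main'' x"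
    by (simp add: log_main''_def Q_def w_def v_def l_def)
  finally show ?thesis
    by (simp add: w_def v_def flip: power_add)
qed

section \<open>Replacing the two displaced points by the centre\<close>

text \<open>Squaring turns both into polynomial inequalities. The true quadratic coefficient is 3/8,
  so \<open>s^2\<close> is generous; what matters is the exact linear term, which must cancel
  between \<open>s\<close> and \<open>- s\<close>.\<close>

lemma inverse_sqrt_bounds:
  fixes s :: real
  assumes "\<bar>s\<bar> \<le> 1/100"
  shows "1 - s / 2 \<le> 1 / sqrt (1 + s)" "1 / sqrt (1 + s) \<le> 1 - s / 2 + s^2"
proof -
  have s: "-1/100 \<le> s" "s \<le> 1/100" using assms by auto
  have pos: "sqrt (1 + s) > 0" "1 - s/2 \<ge> 0" "1 - s/2 + s^2 \<ge> 0" using s by (auto intro: add_nonneg_nonneg)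
  have "(1 - s/2)^2 * (1 + s) = 1 - s\<^sup>2 * (3/4 - s / 4)"
    by (simp add: power2_eq_square algebra_simps)
  also have "\<dots> \<le> 1" using s by simp
  finally have "(1 - s/2)^2 * (sqrt (1 + s))\<^sup>2 \<le> 1\<^sup>2" using s by simp
  then have "(1 - s/2) * sqrt (1 + s) \<le> 1"
    unfolding power_mult_distrib[symmetric] by (rule power2_le_imp_le) simp
  then show "1 - s / 2 \<le> 1 / sqrt (1 + s)"
    using pos by (simp add: field_simps)
  have "(1 - s/2 + s^2)^2 * (1 + s) = 1 + s^2 * (5/4 + 5/4 * s + s^3)"
    by (simp add: eval_nat_numeral algebra_simps)
  moreover have "0 \<le> 5/4 + 5/4 * s + s^3"
  proof -
    have "\<bar>s\<bar>^3 \<le> 1^3" using s by (intro power_mono) auto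
    then have "-1 \<le> s^3" by (simp add: power_abs[symmetric] abs_le_iff)
    then show ?thesis using s by simp
  qed
  ultimately have "1\<^sup>2 \<le> (1 - s/2 + s^2)^2 * (sqrt (1 + s))\<^sup>2" using s by simp
  then have "1 \<le> (1 - s/2 + s^2) * sqrt (1 + s)"
    unfolding power_mult_distrib[symmetric] using pos by (intro power2_le_imp_le[of 1]) simp_all
  then show "1 / sqrt (1 + s) \<le> 1 - s / 2 + s^2"
    using pos by (simp add: field_simps)
qed

lemma symmetric_powers:
  fixes u d :: real
  shows "(u - d)^3 + (u + d)^3 = 2 * u^3 + 6 * u * d^2"
    and "(u - d)^4 + (u + d)^4 = 2 * u^4 + 12 * u^2 * d^2 + 2 * (d^2)^2"
    and "(u - d)^5 + (u + d)^5 = 2 * u^5 + 20 * u^3 * d^2 + 10 * u * (d^2)^2"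
    and "(u - d)^6 + (u + d)^6 = 2 * u^6 + 30 * u^4 * d^2 + 30 * u^2 * (d^2)^2 + 2 * (d^2)^3"
  by (simp_all add: eval_nat_numeral algebra_simps)

text \<open>The first-order terms in \<open>s\<close> cancel in symmetric means; this makes the error of replacing
  \<open>x \<plusminus> s\<close> by \<open>x\<close> negligible.\<close>

lemma symmetric_power_mean:
  fixes s a b :: real
  assumes s: "\<bar>s\<bar> \<le> 1/100"
    and a: "1 - s / 2 \<le> a" "a \<le> 1 - s / 2 + s^2"
    and b: "1 + s / 2 \<le> b" "b \<le> 1 + s / 2 + s^2"
    and k: "k \<in> {3, 4, 5, 6}"
  shows "2 \<le> a ^ k + b ^ k" "a ^ k + b ^ k \<le> 2 + 120 * s^2"
proof -
  define r where "r = s^2"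
  have r: "0 \<le> r" "r \<le> 1/10000"
    using power_mono[OF s, of 2] by (simp_all add: r_def power_divide)
  have pos: "0 \<le> 1 - s/2" "0 \<le> 1 + s/2" using s by auto
  then have ab: "0 \<le> a" "0 \<le> b" using a b by auto
  have "(1 - s/2)^k + (1 + s/2)^k \<le> a^k + b^k"
    using a b pos by (intro add_mono power_mono) auto
  moreover have "(s/2)^2 = r / 4" by (simp add: r_def power_divide)
  note sp = symmetric_powers[of _ "s/2", unfolded this]
  have "2 \<le> (1 - s/2)^k + (1 + s/2)^k"
    using k r(1) by (elim insertE emptyE) (simp_all add: sp power_divide add_nonneg_nonneg)
  ultimately show "2 \<le> a ^ k + b ^ k" by linarith
  \<comment> \<open>The upper bounds are \<open>(1 + r) - s/2\<close> and
    \<open>(1 + r) + s/2\<close>, so their power sum is even in \<open>s\<close>, hence a polynomial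
    in \<open>r\<close>. Its linear coefficient is at most 39/2, far below 120.\<close>
  have le: "a^k + b^k \<le> ((1 + r) - s/2)^k + ((1 + r) + s/2)^k"
    using a b ab unfolding r_def by (intro add_mono power_mono) (auto simp: algebra_simps)
  have up: "\<forall>k\<in>{3,4,5,6}. ((1 + r) - s/2)^k + ((1 + r) + s/2)^k \<le> 2 + 120 * r"
  proof -
    have 2: "r^2 \<le> r * (1/10)" unfolding power2_eq_square using r by (intro mult_left_mono) auto
    have "r^j \<le> r * (1/10)" if "j \<ge> 2" for j :: nat
      using that r by (intro order_trans[OF power_decreasing 2]) auto
    from this[of 2] this[of 3] this[of 4] this[of 5] this[of 6]
    have p: "r^2 \<le> r * (1/10)" "r^3 \<le> r * (1/10)" "r^4 \<le> r * (1/10)" "r^5 \<le> r * (1/10)" "r^6 \<le> r * (1/10)"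
      by simp_all
    have "2 * (1+r)^3 + 6 * (1+r) * (r/4) = 2 + (15/2) * r + (15/2) * r^2 + 2 * r^3"
      "2 * (1+r)^4 + 12 * (1+r)^2 * (r/4) + 2 * (r/4)^2 = 2 + 11 * r + (145/8) * r^2 + 11 * r^3 + 2 * r^4"
      "2 * (1+r)^5 + 20 * (1+r)^3 * (r/4) + 10 * (1+r) * (r/4)^2 =
          2 + 15 * r + (285/8) * r^2 + (285/8) * r^3 + 15 * r^4 + 2 * r^5"
      "2 * (1+r)^6 + 30 * (1+r)^4 * (r/4) + 30 * (1+r)^2 * (r/4)^2 + 2 * (r/4)^3
       = 2 + (39/2) * r + (495/8) * r^2 + (2841/32) * r^3 + (495/8) * r^4 + (39/2) * r^5 + 2 * r^6"
      by (simp_all add: eval_nat_numeral field_simps)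
    then show ?thesis
      using p r by (auto simp only: ball_simps sp)
  qed
  show "a ^ k + b ^ k \<le> 2 + 120 * s^2"
    using order_trans[OF le bspec[OF up k]] by (simp add: r_def)
qed

text \<open>2362 is the smallest value of \<open>n - 1\<close>, so the bound holds at all three
  arguments of the ratio and at every point between them.\<close>

lemma cubv_ge:
  assumes "y \<ge> 2362"
  shows "cubv y \<ge> 186"
proof -
  have "(314/100)^2 \<le> pi^2" using pi_approx by (intro power_mono) auto
  then have "3 * (314/100)^2 / 2 * 2362 \<le> 3 * pi^2 / 2 * y"
    using assms by (intro mult_mono) auto
  then have "186^2 \<le> (cubv y)^2" using assms by (simp add: cubv_square power_divide)
  then show ?thesis by (rule power2_le_imp_le) (use cubv_pos[of y] assms in simp)
qed

text \<open>The means of \<open>a ^ k\<close> and \<open>b ^ k\<close> differ from 1 by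
  \<open>O(s^2)\<close>, and \<open>s\<close> is of order \<open>w^2\<close>. The displacement
  therefore costs a factor \<open>1 + O(w^4)\<close>, so \<open>O(w^7)\<close> in the leading term
  \<open>w^3\<close>. The constant 300 is 180 for this displacement and 120 for the remainders at
  the two points.\<close>

lemma log_main_second_difference_approx:
  assumes "x \<ge> 2363"
  shows "\<bar>ln (bess (cubv (x + 1))) + ln (bess (cubv (x - 1))) - 2 * ln (bess (cubv x))
      - 9 * pi^4 / 16 * main_poly (1 / cubv x)\<bar> \<le> 9 * pi^4 / 16 * (300 * (1 / cubv x)^6)"
proof -
  obtain t where t: "0 < t" "t < 1" and eq:
    "ln (bess (cubv (x + 1))) + ln (bess (cubv (x - 1))) - 2 * ln (bess (cubv x))
       = (log_main'' (x + t) + log_main'' (x - t)) / 2"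
    using log_main_second_difference[of x] assms by auto
  define K s w where "K = 9 * pi^4 / 16" and "s = t / x" and "w = 1 / cubv x"
  define a b where "a = 1 / sqrt (1 + s)" and "b = 1 / sqrt (1 + (- s))"
  have K: "K \<ge> 0" by (simp add: K_def)
  note big = cubv_ge
  have x: "x > 0" using assms by simp
  have w: "0 < w" "w \<le> 1/186" using big[of x] assms by (simp_all add: w_def)
  have wa: "1 / cubv (x + t) = w * a" and wb: "1 / cubv (x - t) = w * b"
  proof -
    have "1 / cubv (x + u) = w * (1 / sqrt (1 + u / x))" for u
    proof -
      have "x + u = x * (1 + u / x)" using x by (simp add: field_simps)
      then have "cubv (x + u) = cubv x * sqrt (1 + u / x)"
        by (simp add: cubv_def real_sqrt_mult[symmetric] mult_ac)
      then show ?thesis by (simp add: w_def)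
    qed
    from this[of t] this[of "-t"] show "1 / cubv (x + t) = w * a" "1 / cubv (x - t) = w * b"
      by (simp_all add: a_def b_def s_def)
  qed
  have s: "\<bar>s\<bar> \<le> 1/100" using t assms by (simp add: s_def divide_simps)
  have s2: "s^2 \<le> 225 * w^4"
  proof -
    \<comment> \<open>\<open>1 / x\<close> equals \<open>3 * pi^2 / 2 * w^2\<close>, and
      \<open>3 * pi^2 / 2\<close> is below 15, whose square is 225.\<close>
    have "s \<le> 1 / x" using t x by (simp add: s_def divide_right_mono)
    also have "1 / x = 3 * pi^2 / 2 * w^2"
      using cubv_square[of x] cubv_pos[of x] x by (simp add: w_def power_divide field_simps)
    also have "\<dots> \<le> 15 * w^2"
    proof -
      have "pi^2 \<le> (315/100)^2" using pi_approx by (intro power_mono) auto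
      then show ?thesis by (intro mult_right_mono) (auto simp: power_divide)
    qed
    finally have "s^2 \<le> (15 * w^2)^2" using t x by (intro power_mono) (auto simp: s_def)
    then show ?thesis by (simp add: power_mult_distrib)
  qed
  note bd = inverse_sqrt_bounds[OF s, folded a_def] inverse_sqrt_bounds[of "-s", folded b_def]
  have mean: "2 \<le> a ^ k + b ^ k" "a ^ k + b ^ k \<le> 2 + 27000 * w^4" if "k \<in> {3,4,5,6}" for k
    using symmetric_power_mean[OF s, of a b k] bd s that s2 by auto
  define m where "m k = (a ^ k + b ^ k) / 2 - 1" for k
  have m: "0 \<le> m k" "m k \<le> 13500 * w^4" if "k \<in> {3,4,5,6}" for k
    using mean[OF that] by (simp_all add: m_def field_simps)
  have w4: "w^4 \<le> 1/13500" "w^3 \<le> 1/13500 * 100"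
    using w power_mono[of w "1/186" 4] power_mono[of w "1/186" 3] by (simp_all add: power_divide)
  have e1: "\<bar>log_main'' (x + t) - K * main_poly (w * a)\<bar> \<le> K * (60 * (w * a)^6)"
    using log_main''_approx[of "x + t"] big[of "x + t"] t assms by (simp add: K_def wa)
  have e2: "\<bar>log_main'' (x - t) - K * main_poly (w * b)\<bar> \<le> K * (60 * (w * b)^6)"
    using log_main''_approx[of "x - t"] big[of "x - t"] t assms by (simp add: K_def wb)
  have "(60 * (w * a)^6 + 60 * (w * b)^6) / 2 = 60 * w^6 * (m 6 + 1)"
    by (simp add: m_def power_mult_distrib algebra_simps)
  also have "\<dots> \<le> 60 * w^6 * 2" using m[of 6] w4 w by (intro mult_left_mono) auto
  finally have E: "(60 * (w * a)^6 + 60 * (w * b)^6) / 2 \<le> 120 * w^6" by simp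
  have "(main_poly (w * a) + main_poly (w * b)) / 2 - main_poly w
      = 5 * (w^4 * m 4) - w^3 * m 3 - 45/8 * (w^5 * m 5)"
    by (simp add: main_poly_def m_def power_mult_distrib field_simps)
  moreover have "0 \<le> w^3 * m 3" "w^3 * m 3 \<le> 100 * w^6" "0 \<le> w^4 * m 4" "w^4 * m 4 \<le> w^6"
     "0 \<le> w^5 * m 5" "w^5 * m 5 \<le> w^6"
  proof -
    have i: "0 \<le> w^k * m k" "w^k * m k \<le> 13500 * w^(k+4)" if "k \<in> {3,4,5,6}" for k
      using m[OF that] w mult_left_mono[OF m(2)[OF that], of "w^k"] by (auto simp: power_add mult_ac)
    have w7: "13500 * w^7 \<le> 100 * w^6"
      using mult_right_mono[of w "1/186" "w^6"] w by (simp add: eval_nat_numeral)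
    have w8: "13500 * w^8 \<le> w^6"
      using mult_mono[of "w^2" "1/186^2" "w^6" "w^6"] w power_mono[of w "1/186" 2]
      by (simp add: power_divide eval_nat_numeral)
    have w9: "w^9 \<le> w^8" using w by (intro power_decreasing) auto
    show "0 \<le> w^3 * m 3" "w^3 * m 3 \<le> 100 * w^6" "0 \<le> w^4 * m 4" "w^4 * m 4 \<le> w^6"
     "0 \<le> w^5 * m 5" "w^5 * m 5 \<le> w^6"
      using i[of 3] i[of 4] i[of 5] w7 w8 w9 by simp_all
  qed
  moreover have "0 \<le> w^6" using w by simp
  ultimately have "\<bar>(main_poly (w * a) + main_poly (w * b)) / 2 - main_poly w\<bar> \<le> 180 * w^6"
    by linarith
  then have "K * \<bar>(main_poly (w * a) + main_poly (w * b)) / 2 - main_poly w\<bar> \<le> K * (180 * w^6)"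
    using K by (rule mult_left_mono)
  then have F: "\<bar>(K * main_poly (w * a) + K * main_poly (w * b)) / 2 - K * main_poly w\<bar> \<le> K * (180 * w^6)"
  proof -
    have "(K * main_poly (w * a) + K * main_poly (w * b)) / 2 - K * main_poly w
      = K * ((main_poly (w * a) + main_poly (w * b)) / 2 - main_poly w)"
      by (simp add: field_simps)
    with \<open>K * \<bar>_\<bar> \<le> _\<close> K show ?thesis by (simp add: abs_mult)
  qed
  have "K * ((60 * (w * a)^6 + 60 * (w * b)^6) / 2) \<le> K * (120 * w^6)"
    using E K by (rule mult_left_mono)
  then have "(K * (60 * (w * a)^6) + K * (60 * (w * b)^6)) / 2 \<le> K * (120 * w^6)"
    by (simp add: algebra_simps)
  moreover have "\<bar>(X + Y) / 2 - c\<bar> \<le> f + g"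
    if "\<bar>X - p\<bar> \<le> e1" "\<bar>Y - q\<bar> \<le> e2" "\<bar>(p + q) / 2 - c\<bar> \<le> f" "(e1 + e2) / 2 \<le> g"
    for X Y p q c e1 e2 f g :: real
  proof (rule abs_leI)
    have "X - p \<le> e1" "p - X \<le> e1" "Y - q \<le> e2" "q - Y \<le> e2"
      "(p + q) / 2 - c \<le> f" "c - (p + q) / 2 \<le> f"
      using that(1-3) by (simp_all only: abs_le_iff minus_diff_eq)
    then show "(X + Y) / 2 - c \<le> f + g" "- ((X + Y) / 2 - c) \<le> f + g"
      using that(4) by (simp_all add: field_simps)
  qed
  ultimately have "\<bar>(log_main'' (x + t) + log_main'' (x - t)) / 2 - K * main_poly w\<bar> \<le> K * (180 * w^6) + K * (120 * w^6)"
    using e1 e2 F by blast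
  then show ?thesis
    unfolding eq K_def[symmetric] w_def[symmetric] by (simp add: algebra_simps)
qed

section \<open>Gauss's product for theta\<close>

definition qpoch :: "'a::real_normed_field \<Rightarrow> nat \<Rightarrow> 'a" where
  "qpoch q n = (\<Prod>i<n. 1 - q ^ Suc i)"

lemma qpoch_0 [simp]: "qpoch q 0 = 1"
  by (simp add: qpoch_def)

lemma qpoch_Suc [simp]: "qpoch q (Suc n) = qpoch q n * (1 - q ^ Suc n)"
  by (simp add: qpoch_def)

lemma power_neq_1:
  fixes q :: "'a::real_normed_field"
  assumes "norm q < 1"
  shows "1 - q ^ Suc i \<noteq> 0" "1 + q ^ Suc i \<noteq> 0"
proof -
  have "norm q ^ Suc i \<le> norm q" using assms by (simp add: mult_left_le power_le_one)
  then have *: "norm (q ^ Suc i) \<noteq> 1" using assms by (simp only: norm_power)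
  show "1 - q ^ Suc i \<noteq> 0" using * by (metis eq_iff_diff_eq_0 norm_one)
  show "1 + q ^ Suc i \<noteq> 0" using * by (metis add_eq_0_iff norm_minus_cancel norm_one)
qed

lemma qpoch_nonzero: "norm q < 1 \<Longrightarrow> qpoch q n \<noteq> 0"
  by (induction n) (use power_neq_1[of q] in auto)

text \<open>Gaussian binomial coefficients through the q-Pascal rule, free of divisions by
  \<open>1 - q ^ i\<close>. The truncated difference \<open>m - k\<close> is harmless, since the
  coefficient it multiplies vanishes for \<open>k > m\<close>.\<close>

fun gbinom :: "'a::real_normed_field \<Rightarrow> nat \<Rightarrow> nat \<Rightarrow> 'a" where
  "gbinom q m 0 = 1"
| "gbinom q 0 (Suc k) = 0"
| "gbinom q (Suc m) (Suc k) = gbinom q m (Suc k) + q ^ (m - k) * gbinom q m k"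

lemma gbinom_eq_0: "k > m \<Longrightarrow> gbinom q m k = 0"
  by (induction q m k rule: gbinom.induct) auto

lemma gbinom_qpoch: "k \<le> m \<Longrightarrow> gbinom q m k * (qpoch q k * qpoch q (m - k)) = qpoch q m"
proof (induction m arbitrary: k)
  case (Suc m)
  show ?case
  proof (cases k)
    case (Suc j)
    show ?thesis
    proof (cases "j = m")
      case True
      then show ?thesis
        using Suc.IH[of m] Suc by (simp add: gbinom_eq_0 flip: mult.assoc)
    next
      case False
      then have j: "Suc j \<le> m" using Suc Suc.prems by simp
      then obtain d where d: "m = j + Suc d" using less_imp_Suc_add[of j m] by auto
      have 1: "gbinom q m (Suc j) * (qpoch q (Suc j) * qpoch q d) = qpoch q m"
        using Suc.IH[OF j] by (simp add: d)
      have 2: "gbinom q m j * (qpoch q j * qpoch q (Suc d)) = qpoch q m"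
        using Suc.IH[of j] j by (simp add: d)
      have "gbinom q (Suc m) k * (qpoch q k * qpoch q (Suc m - k))
        = gbinom q m (Suc j) * (qpoch q (Suc j) * qpoch q d) * (1 - q ^ Suc d)
         + q ^ Suc d * (gbinom q m j * (qpoch q j * qpoch q (Suc d))) * (1 - q ^ Suc j)"
        by (simp add: Suc d algebra_simps)
      also have "\<dots> = qpoch q m * (1 - q ^ Suc d + q ^ Suc d * (1 - q ^ Suc j))"
        unfolding 1 2 by (simp add: algebra_simps)
      also have "1 - q ^ Suc d + q ^ Suc d * (1 - q ^ Suc j) = 1 - q ^ Suc m"
        by (simp add: d power_add algebra_simps)
      finally show ?thesis by simp
    qed
  qed simp
qed simp

text \<open>Induction by the q-Pascal rule. The homogeneous form with \<open>x\<close> in place of 1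
  allows \<open>x = q ^ (2 * N - 1)\<close> below, where otherwise negative powers of
  \<open>q\<close> would occur.\<close>

theorem q_binomial:
  fixes x z q :: "'a::real_normed_field"
  shows "(\<Prod>j<m. x + z * q ^ j) = (\<Sum>k\<le>m. q ^ (k choose 2) * gbinom q m k * x ^ (m - k) * z ^ k)"
proof (induction m)
  case (Suc m)
  let ?t = "\<lambda>m k. q ^ (k choose 2) * gbinom q m k * x ^ (m - k) * z ^ k"
  have "(\<Prod>j<Suc m. x + z * q ^ j) = (\<Sum>k\<le>m. ?t m k * x) + (\<Sum>k\<le>m. ?t m k * (z * q ^ m))"
    by (simp add: Suc.IH algebra_simps flip: sum_distrib_left)
  also have "(\<Sum>k\<le>m. ?t m k * x) = (\<Sum>k\<le>Suc m. q ^ (k choose 2) * gbinom q m k * x ^ (Suc m - k) * z ^ k)"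
    by (simp add: gbinom_eq_0 Suc_diff_le mult_ac)
  also have "\<dots> = x ^ Suc m + (\<Sum>k\<le>m. q ^ (Suc k choose 2) * gbinom q m (Suc k) * x ^ (m - k) * z ^ Suc k)"
    by (subst sum.atMost_Suc_shift) (simp add: numeral_2_eq_2)
  also have "(\<Sum>k\<le>m. ?t m k * (z * q ^ m))
     = (\<Sum>k\<le>m. q ^ (Suc k choose 2) * (q ^ (m - k) * gbinom q m k) * x ^ (m - k) * z ^ Suc k)"
  proof (intro sum.cong refl)
    fix k assume "k \<in> {..m}"
    then have "q ^ m = q ^ k * q ^ (m - k)" by (simp flip: power_add)
    then show "?t m k * (z * q ^ m) = q ^ (Suc k choose 2) * (q ^ (m - k) * gbinom q m k) * x ^ (m - k) * z ^ Suc k"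
      by (simp add: numeral_2_eq_2 power_add mult_ac)
  qed
  also have "x ^ Suc m + (\<Sum>k\<le>m. q ^ (Suc k choose 2) * gbinom q m (Suc k) * x ^ (m - k) * z ^ Suc k)
     + (\<Sum>k\<le>m. q ^ (Suc k choose 2) * (q ^ (m - k) * gbinom q m k) * x ^ (m - k) * z ^ Suc k)
     = x ^ Suc m + (\<Sum>k\<le>m. ?t (Suc m) (Suc k))"
    by (simp add: sum.distrib[symmetric] algebra_simps)
  also have "\<dots> = (\<Sum>k\<le>Suc m. ?t (Suc m) k)"
    by (subst sum.atMost_Suc_shift) (simp add: numeral_2_eq_2)
  finally show ?case .
qed (simp add: numeral_2_eq_2)

text \<open>A finite form of Jacobi's triple product. The q-binomial theorem in base
  \<open>q^2\<close> is applied to the product of \<open>q ^ (2 * N - 1) - q ^ (2 * j)\<close> over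
  \<open>j < 2 * N\<close>: each half of the factors is the odd product up to signs and powers of
  \<open>q\<close>, and on the sum side the exponents complete to \<open>(k - N)^2\<close>.\<close>

lemma odd_product_square:
  fixes q :: "'a::real_normed_field"
  assumes "q \<noteq> 0"
  shows "(\<Prod>i<N. 1 - q ^ (2 * i + 1))\<^sup>2
    = (\<Sum>k\<le>2 * N. (-1) ^ (k + N) * q ^ ((if k \<le> N then N - k else k - N)^2) * gbinom (q^2) (2 * N) k)"
proof -
  \<comment> \<open>The power of \<open>q\<close> to be cancelled from both sides:
    \<open>N^2 - N\<close> from the lower half of the factors and \<open>(2 * N - 1) * N\<close>
    from the upper half.\<close>
  define E where "E = 3 * N^2 - 2 * N"
  have NN: "2 * N \<le> 3 * N^2" by (cases N) (simp_all add: power2_eq_square)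
  let ?d = "\<lambda>k. if k \<le> N then N - k else k - N"
  let ?P = "\<Prod>j<2 * N. q ^ (2 * N - 1) + (- 1) * (q^2) ^ j"
  let ?O = "\<Prod>i<N. 1 - q ^ (2 * i + 1)"
  have "?P
     = (\<Prod>j<N. q ^ (2 * N - 1) + (- 1) * (q^2) ^ j) * (\<Prod>j=N..<2*N. q ^ (2 * N - 1) + (- 1) * (q^2) ^ j)"
    by (simp add: lessThan_atLeast0 prod.atLeastLessThan_concat)
  also have "(\<Prod>j<N. q ^ (2 * N - 1) + (- 1) * (q^2) ^ j) = (\<Prod>j<N. (-1) * (q ^ (2 * j) * (1 - q ^ (2 * (N - Suc j) + 1))))"
  proof (intro prod.cong refl)
    fix j assume "j \<in> {..<N}"
    then have "2 * N - 1 = 2 * j + (2 * (N - Suc j) + 1)" by auto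
    then have "q ^ (2 * N - 1) = q ^ (2 * j) * q ^ (2 * (N - Suc j) + 1)" by (metis power_add)
    then show "q ^ (2 * N - 1) + (- 1) * (q^2) ^ j = (-1) * (q ^ (2 * j) * (1 - q ^ (2 * (N - Suc j) + 1)))"
      unfolding power_mult[symmetric] by (simp add: algebra_simps)
  qed
  also have "\<dots> = (-1) ^ N * (q ^ (\<Sum>j<N. 2 * j) * (\<Prod>j<N. 1 - q ^ (2 * (N - Suc j) + 1)))"
    by (simp only: prod.distrib prod_constant power_sum card_lessThan)
  also have "(\<Prod>j<N. 1 - q ^ (2 * (N - Suc j) + 1)) = ?O"
    by (rule prod.nat_diff_reindex)
  also have "(\<Sum>j<N. 2 * j) = N^2 - N"
    by (induction N) (auto simp: power2_eq_square algebra_simps)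
  also have "(\<Prod>j=N..<2*N. q ^ (2 * N - 1) + (- 1) * (q^2) ^ j) = (\<Prod>i<N. q ^ (2 * N - 1) + (- 1) * (q^2) ^ (i + N))"
    using prod.shift_bounds_nat_ivl[of "\<lambda>j. q ^ (2 * N - 1) + (- 1) * (q^2) ^ j" 0 N N]
    by (simp add: lessThan_atLeast0 mult_2)
  also have "\<dots> = (\<Prod>i<N. q ^ (2 * N - 1) * (1 - q ^ (2 * i + 1)))"
  proof (intro prod.cong refl)
    fix i assume "i \<in> {..<N}"
    then have "2 * (i + N) = (2 * N - 1) + (2 * i + 1)" by auto
    then have "q ^ (2 * (i + N)) = q ^ (2 * N - 1) * q ^ (2 * i + 1)" by (metis power_add)
    then show "q ^ (2 * N - 1) + (- 1) * (q^2) ^ (i + N) = q ^ (2 * N - 1) * (1 - q ^ (2 * i + 1))"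
      unfolding power_mult[symmetric] by (simp add: algebra_simps)
  qed
  also have "\<dots> = q ^ ((2 * N - 1) * N) * ?O"
    by (simp add: prod.distrib power_mult)
  also have "(-1) ^ N * (q ^ (N^2 - N) * ?O) * (q ^ ((2 * N - 1) * N) * ?O)
     = (-1) ^ N * (q ^ ((N^2 - N) + (2 * N - 1) * N) * ?O\<^sup>2)"
  proof -
    have "a * (x * p) * (y * p) = a * ((x * y) * p^2)" for a x y p :: 'a
      by (simp add: power2_eq_square mult_ac)
    then show ?thesis unfolding power_add[of q "N\<^sup>2 - N"] .
  qed
  also have "(N^2 - N) + (2 * N - 1) * N = E"
    by (cases N) (simp_all add: E_def power2_eq_square algebra_simps)
  finally have L: "?P = (-1) ^ N * (q ^ E * ?O\<^sup>2)" .
  have "?P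
     = (\<Sum>k\<le>2*N. (q^2) ^ (k choose 2) * gbinom (q^2) (2*N) k * (q ^ (2 * N - 1)) ^ (2 * N - k) * (-1) ^ k)"
    by (rule q_binomial)
  also have "\<dots> = (\<Sum>k\<le>2*N. q ^ E * ((-1) ^ k * q ^ (?d k^2) * gbinom (q^2) (2 * N) k))"
  proof (intro sum.cong refl)
    fix k assume "k \<in> {..2*N}"
    then have k: "k \<le> 2 * N" by simp
    have "2 * (k choose 2) = k * (k - 1)" by (cases k) (simp_all add: choose_two)
    \<comment> \<open>Completing the square, carried out in \<open>int\<close> because of the
      truncated subtractions.\<close>
    moreover have "k * (k - 1) + (2 * N - 1) * (2 * N - k) = E + ?d k^2"
    proof -
      have "int (k * (k - 1)) = int k * (int k - 1)" by (cases k) (auto simp: algebra_simps)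
      moreover have "int ((2 * N - 1) * (2 * N - k)) = (2 * int N - 1) * (2 * int N - int k)"
        using k by (cases N) (auto simp: of_nat_diff, simp add: algebra_simps)
      moreover have "int E = 3 * (int N)^2 - 2 * int N" using NN by (simp add: E_def of_nat_diff)
      moreover have "int (?d k^2) = (int N - int k)^2"
        by (auto simp: of_nat_diff power2_commute)
      ultimately have "int (k * (k - 1) + (2 * N - 1) * (2 * N - k)) = int (E + ?d k^2)"
        unfolding of_nat_add by (simp only:) (simp add: power2_eq_square algebra_simps)
      then show ?thesis by (simp only: of_nat_eq_iff)
    qed
    ultimately have *: "(q^2) ^ (k choose 2) * (q ^ (2 * N - 1)) ^ (2 * N - k) = q ^ E * q ^ (?d k^2)"
      unfolding power_mult[symmetric] power_add[symmetric] by (simp only:)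
    have mac: "a * g * b * m = (a * b) * (m * g)" "(e * c) * (m * g) = e * (m * c * g)" for a b c e g m :: 'a
      by (simp_all only: mult_ac)
    show "(q^2) ^ (k choose 2) * gbinom (q^2) (2*N) k * (q ^ (2 * N - 1)) ^ (2 * N - k) * (-1) ^ k
      = q ^ E * ((-1) ^ k * q ^ (?d k^2) * gbinom (q^2) (2 * N) k)"
      by (subst mac(1)) (simp only: * mac(2))
  qed
  also have "\<dots> = q ^ E * (\<Sum>k\<le>2*N. (-1) ^ k * q ^ (?d k^2) * gbinom (q^2) (2 * N) k)"
    by (rule sum_distrib_left[symmetric])
  finally have R: "(-1) ^ N * ?O\<^sup>2 = (\<Sum>k\<le>2*N. (-1) ^ k * q ^ (?d k^2) * gbinom (q^2) (2 * N) k)"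
    unfolding L using assms by (simp add: mult.left_commute[of "(-1)^N"])
  have "?O\<^sup>2 = (-1) ^ N * ((-1) ^ N * ?O\<^sup>2)"
    by (simp flip: mult.assoc power_add)
  also have "\<dots> = (\<Sum>k\<le>2 * N. (-1) ^ (k + N) * q ^ (?d k^2) * gbinom (q^2) (2 * N) k)"
    unfolding R sum_distrib_left by (intro sum.cong refl) (simp add: power_add mult_ac)
  finally show ?thesis .
qed

section \<open>The product side and its limit\<close>

text \<open>The reciprocal of the overpartition generating function, cut off after \<open>N\<close>
  factors; its limit is theta.\<close>

definition overp :: "'a::real_normed_field \<Rightarrow> nat \<Rightarrow> 'a" where
  "overp q N = (\<Prod>i<N. (1 - q ^ Suc i) / (1 + q ^ Suc i))"

text \<open>With \<open>2 * N\<close> factors the numerator splits exactly into \<open>N\<close> odd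
  factors and \<open>qpoch (q^2) N\<close>, and \<open>(1 + q^i) * (1 - q^i) = 1 - q^(2*i)\<close>
  clears the denominators. Hence the restriction to even indices, here and in the limit.\<close>

lemma overp_even:
  fixes q :: "'a::real_normed_field"
  assumes "norm q < 1"
  shows "overp q (2 * N) = (\<Prod>i<N. 1 - q ^ (2 * i + 1))\<^sup>2 * (qpoch (q^2) N)\<^sup>2 / qpoch (q^2) (2 * N)"
proof -
  have 1: "(\<Prod>i<2 * N. 1 - q ^ Suc i) = (\<Prod>i<N. 1 - q ^ (2 * i + 1)) * qpoch (q^2) N"
    by (induction N) (simp_all add: power_mult[symmetric] algebra_simps power_add[symmetric])
  have 2: "(\<Prod>i<n. 1 + q ^ Suc i) * (\<Prod>i<n. 1 - q ^ Suc i) = qpoch (q^2) n" for n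
  proof -
    have "(q^2) ^ m = q ^ m * q ^ m" for m
      by (simp add: power2_eq_square power_mult_distrib)
    then have "1 - (q^2) ^ Suc i = (1 + q ^ Suc i) * (1 - q ^ Suc i)" for i
      by (simp only:) (simp add: algebra_simps)
    then show ?thesis by (simp only: qpoch_def prod.distrib)
  qed
  have nz: "(\<Prod>i<n. 1 - q ^ Suc i) \<noteq> 0" "(\<Prod>i<n. 1 + q ^ Suc i) \<noteq> 0" for n
    using power_neq_1[OF assms] by auto
  have o: "overp q n = (\<Prod>i<n. 1 - q ^ Suc i)^2 / qpoch (q^2) n" for n
    unfolding 2[symmetric] overp_def prod_dividef using nz
    by (simp add: power2_eq_square divide_simps)
  show ?thesis by (simp only: o 1 power_mult_distrib)
qed

text \<open>The terms \<open>N - j\<close> and \<open>N + j\<close> of the finite triple product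
  coincide by the symmetry of the Gaussian binomial. After division each power
  \<open>q ^ j^2\<close> carries a weight that tends to 1.\<close>

lemma overp_even_eq_sum:
  fixes q :: "'a::real_normed_field"
  assumes q: "norm q < 1" "q \<noteq> 0"
  shows "overp q (2 * N) = 1 + 2 * (\<Sum>j<N. (-1) ^ Suc j * q ^ (Suc j)^2 *
      ((qpoch (q^2) N)\<^sup>2 / (qpoch (q^2) (N + Suc j) * qpoch (q^2) (N - Suc j))))"
proof -
  have q2: "norm (q^2) < 1" using q by (simp add: norm_power power_less_one_iff)
  note nz = qpoch_nonzero[OF q2]
  let ?h = "\<lambda>j. qpoch (q^2) (2 * N) / (qpoch (q^2) (N + j) * qpoch (q^2) (N - j))"
  have g: "gbinom (q^2) (2 * N) (N + j) = ?h j" "gbinom (q^2) (2 * N) (N - j) = ?h j" if "j \<le> N" for j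
  proof -
    have "2 * N - (N + j) = N - j" "2 * N - (N - j) = N + j" using that by auto
    then show "gbinom (q^2) (2 * N) (N + j) = ?h j" "gbinom (q^2) (2 * N) (N - j) = ?h j"
      using gbinom_qpoch[of "N + j" "2 * N" "q\<^sup>2"] gbinom_qpoch[of "N - j" "2 * N" "q\<^sup>2"] nz that
      by (simp_all add: field_simps)
  qed
  let ?t = "\<lambda>k. (-1) ^ (k + N) * q ^ ((if k \<le> N then N - k else k - N)^2) * gbinom (q^2) (2 * N) k"
  let ?u = "\<lambda>j. (-1) ^ j * q ^ j\<^sup>2 * ?h j"
  have "(\<Sum>k\<le>2*N. ?t k) = (\<Sum>k<N. ?t k) + (\<Sum>k=N..<2*N+1. ?t k)"
  proof -
    have "{..2*N} = {..<N} \<union> {N..<2*N+1}" by auto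
    then show ?thesis by (simp only:) (rule sum.union_disjoint, auto)
  qed
  also have "(\<Sum>k<N. ?t k) = (\<Sum>j<N. ?t (N - Suc j))"
    by (rule sum.nat_diff_reindex[symmetric])
  also have "\<dots> = (\<Sum>j<N. ?u (Suc j))"
  proof (intro sum.cong refl)
    fix j assume j: "j \<in> {..<N}"
    have "even (N - Suc j + N) = even (Suc j)" using j by auto
    then have "(-1) ^ (N - Suc j + N) = (-1 :: 'a) ^ Suc j" by (simp only: minus_one_power_iff)
    then show "?t (N - Suc j) = ?u (Suc j)" using j g(2)[of "Suc j"] by simp
  qed
  also have "(\<Sum>k=N..<2*N+1. ?t k) = (\<Sum>j<Suc N. ?t (N + j))"
    by (rule sum.reindex_bij_witness[of _ "\<lambda>j. N + j" "\<lambda>k. k - N"]) auto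
  also have "\<dots> = (\<Sum>j<Suc N. ?u j)"
  proof (intro sum.cong refl)
    fix j assume j: "j \<in> {..<Suc N}"
    have "(-1) ^ (N + j + N) = (-1 :: 'a) ^ j" by (simp add: minus_one_power_iff)
    then show "?t (N + j) = ?u j" using j g(1)[of j] by (cases "j = 0") simp_all
  qed
  also have "\<dots> = ?u 0 + (\<Sum>j<N. ?u (Suc j))"
    by (rule sum.lessThan_Suc_shift)
  finally have S: "(\<Prod>i<N. 1 - q ^ (2 * i + 1))\<^sup>2 = ?u 0 + 2 * (\<Sum>j<N. ?u (Suc j))"
    using odd_product_square[OF q(2), of N] by simp
  show ?thesis
    unfolding overp_even[OF q(1)] S
    using nz by (simp add: power2_eq_square field_simps sum_distrib_left sum_divide_distrib)
qed

text \<open>Jacobi's \<open>theta_4\<close> in the nome \<open>q\<close>: the sum of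
  \<open>(-1)^n * q^(n^2)\<close> over all integers, folded at 0.\<close>

definition theta4 :: "'a \<Rightarrow> 'a::{real_normed_field,banach}" where
  "theta4 q = 1 + 2 * (\<Sum>j. (-1) ^ Suc j * q ^ (Suc j)^2)"

lemma summable_power_square:
  assumes "norm (q :: 'a::real_normed_field) < 1"
  shows "summable (\<lambda>j. norm q ^ (Suc j)^2)"
proof (rule summable_comparison_test')
  show "summable (\<lambda>j. norm q ^ j)" using assms by (simp add: summable_geometric)
  fix j :: nat
  have "j \<le> (Suc j)^2" by (simp add: power2_eq_square)
  then show "norm (norm q ^ (Suc j)^2) \<le> norm q ^ j"
    using assms by (simp add: power_decreasing)
qed

lemma summable_theta4:
  assumes "norm (q :: 'a::{real_normed_field,banach}) < 1"
  shows "summable (\<lambda>j. (-1) ^ Suc j * q ^ (Suc j)^2)"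
  by (rule summable_norm_cancel)
     (use summable_power_square[OF assms] in \<open>simp add: norm_mult norm_power\<close>)

lemma theta4_of_real:
  assumes "\<bar>r\<bar> < 1"
  shows "theta4 (of_real r :: 'a::{real_normed_field,banach}) = of_real (theta4 r)"
proof -
  have "(\<Sum>j. of_real ((-1) ^ Suc j * r ^ (Suc j)^2) :: 'a) = of_real (\<Sum>j. (-1) ^ Suc j * r ^ (Suc j)^2)"
    using summable_theta4[of r] assms by (intro suminf_of_real[symmetric]) auto
  then show ?thesis by (simp add: theta4_def)
qed

lemma qpoch_tendsto:
  fixes q :: "'a::{real_normed_field,banach}"
  assumes "norm q < 1"
  obtains L where "qpoch q \<longlonglongrightarrow> L" "L \<noteq> 0"
proof -
  have "summable (\<lambda>i. norm q ^ Suc i)"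
    using assms by (simp add: summable_geometric summable_mult)
  then have "abs_convergent_prod (\<lambda>i. 1 - q ^ Suc i)"
    by (intro summable_imp_abs_convergent_prod) (simp add: norm_mult norm_power)
  then have c: "convergent_prod (\<lambda>i. 1 - q ^ Suc i)"
    by (rule abs_convergent_prod_imp_convergent_prod)
  have "(\<lambda>n. \<Prod>i\<le>n. 1 - q ^ Suc i) \<longlonglongrightarrow> prodinf (\<lambda>i. 1 - q ^ Suc i)"
    by (rule convergent_prod_LIMSEQ[OF c])
  then have "(\<lambda>n. qpoch q (Suc n)) \<longlonglongrightarrow> prodinf (\<lambda>i. 1 - q ^ Suc i)"
    unfolding qpoch_def lessThan_Suc_atMost .
  then have "qpoch q \<longlonglongrightarrow> prodinf (\<lambda>i. 1 - q ^ Suc i)"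
    by (rule LIMSEQ_imp_Suc)
  moreover have "prodinf (\<lambda>i. 1 - q ^ Suc i) \<noteq> 0"
    using power_neq_1(1)[OF assms] by (intro prodinf_nonzero c)
  ultimately show ?thesis by (rule that)
qed

text \<open>Tannery's theorem. The q-Pochhammer products converge to some \<open>L\<close> other
  than 0, so the weights tend to \<open>L^2 / L^2 = 1\<close> and stay below
  \<open>B^2 * C^2\<close> uniformly in \<open>j\<close>.\<close>

theorem overp_even_tendsto_theta4:
  fixes q :: "'a::{real_normed_field,banach}"
  assumes q: "norm q < 1" "q \<noteq> 0"
  shows "(\<lambda>N. overp q (2 * N)) \<longlonglongrightarrow> theta4 q"
proof -
  have q2: "norm (q^2) < 1" using q by (simp add: norm_power power_less_one_iff)
  note nz = qpoch_nonzero[OF q2]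
  obtain L where L: "qpoch (q^2) \<longlonglongrightarrow> L" "L \<noteq> 0" by (rule qpoch_tendsto[OF q2])
  have inv: "(\<lambda>n. inverse (qpoch (q^2) n)) \<longlonglongrightarrow> inverse L"
    by (rule tendsto_inverse[OF L])
  obtain B where B: "B > 0" "\<And>n. norm (qpoch (q^2) n) \<le> B"
    using convergent_imp_Bseq[OF convergentI[OF L(1)]] by (auto elim!: BseqE)
  obtain C where C: "C > 0" "\<And>n. norm (inverse (qpoch (q^2) n)) \<le> C"
    using convergent_imp_Bseq[OF convergentI[OF inv]] by (auto elim!: BseqE)
  define \<rho> where "\<rho> N j = (qpoch (q^2) N)\<^sup>2 * (inverse (qpoch (q^2) (N + Suc j)) * inverse (qpoch (q^2) (N - Suc j)))" for N j
  define a where "a j N = (if j < N then (-1) ^ Suc j * q ^ (Suc j)^2 * \<rho> N j else 0)" for j N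
  have "(\<lambda>N. \<rho> N j) \<longlonglongrightarrow> L\<^sup>2 * (inverse L * inverse L)" for j
  proof -
    have i1: "(\<lambda>N. inverse (qpoch (q^2) (N + Suc j))) \<longlonglongrightarrow> inverse L"
      using inv by (rule LIMSEQ_ignore_initial_segment)
    have i2: "(\<lambda>N. inverse (qpoch (q^2) (N - Suc j))) \<longlonglongrightarrow> inverse L"
      using filterlim_compose[OF inv filterlim_minus_const_nat_at_top[of "Suc j"]] by simp
    show ?thesis unfolding \<rho>_def by (intro tendsto_mult tendsto_power L(1) i1 i2)
  qed
  moreover have "L\<^sup>2 * (inverse L * inverse L) = 1" using L(2) by (simp add: power2_eq_square field_simps)
  ultimately have \<rho>: "(\<lambda>N. \<rho> N j) \<longlonglongrightarrow> 1" for j by simp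
  have "(\<lambda>N. a j N) \<longlonglongrightarrow> (-1) ^ Suc j * q ^ (Suc j)^2 * 1" for j
  proof -
    have "(\<lambda>N. (-1) ^ Suc j * q ^ (Suc j)^2 * \<rho> N j) \<longlonglongrightarrow> (-1) ^ Suc j * q ^ (Suc j)^2 * 1"
      by (intro tendsto_intros \<rho>)
    moreover have "eventually (\<lambda>N. (-1) ^ Suc j * q ^ (Suc j)^2 * \<rho> N j = a j N) sequentially"
      using eventually_gt_at_top[of j] by eventually_elim (simp add: a_def)
    ultimately show ?thesis by (rule Lim_transform_eventually)
  qed
  then have lim: "(\<lambda>N. a j N) \<longlonglongrightarrow> (-1) ^ Suc j * q ^ (Suc j)^2" for j by simp
  have bd: "norm (a j N) \<le> norm q ^ (Suc j)^2 * (B^2 * (C * C))" for j N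
  proof -
    have "norm (\<rho> N j) \<le> B^2 * (C * C)"
      unfolding \<rho>_def norm_mult norm_power using B(1) C(1)
      by (intro mult_mono power_mono mult_nonneg_nonneg norm_ge_zero B(2) C(2)) simp_all
    then have 1: "norm q ^ (Suc j)^2 * norm (\<rho> N j) \<le> norm q ^ (Suc j)^2 * (B^2 * (C * C))"
      by (rule mult_left_mono) simp
    have "norm (a j N) \<le> norm q ^ (Suc j)^2 * norm (\<rho> N j)"
      by (simp add: a_def norm_mult norm_power)
    with 1 show ?thesis by (rule order_trans[rotated])
  qed
  have "(\<lambda>N. \<Sum>j. a j N) \<longlonglongrightarrow> (\<Sum>j. (-1) ^ Suc j * q ^ (Suc j)^2)"
  proof (rule tannerys_theorem[THEN conjunct2, THEN conjunct2])
    show "eventually (\<lambda>(j,N). norm (a j N) \<le> norm q ^ (Suc j)^2 * (B^2 * (C * C))) (at_top \<times>\<^sub>F sequentially)"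
      using bd by (intro always_eventually) auto
    show "summable (\<lambda>j. norm q ^ (Suc j)^2 * (B^2 * (C * C)))"
      by (intro summable_mult2 summable_power_square q)
  qed (use lim in auto)
  then have "(\<lambda>N. 1 + 2 * (\<Sum>j. a j N)) \<longlonglongrightarrow> theta4 q"
    unfolding theta4_def by (intro tendsto_intros)
  moreover have "1 + 2 * (\<Sum>j. a j N) = overp q (2 * N)" for N
  proof -
    have "(\<Sum>j. a j N) = (\<Sum>j<N. a j N)"
      by (rule suminf_finite) (auto simp: a_def)
    also have "\<dots> = (\<Sum>j<N. (-1) ^ Suc j * q ^ (Suc j)^2 *
      ((qpoch (q^2) N)\<^sup>2 / (qpoch (q^2) (N + Suc j) * qpoch (q^2) (N - Suc j))))"
      by (intro sum.cong refl) (auto simp: a_def \<rho>_def divide_inverse)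
    finally show ?thesis using overp_even_eq_sum[OF q, of N] by simp
  qed
  ultimately show ?thesis by simp
qed

text \<open>Only the linear term of \<open>ln ((1 + z) / (1 - z)) = 2 (z + z\<^sup>3 / 3 + \<dots>)\<close> is used to gain on
  the trivial bound.\<close>

lemma norm_quotient_le:
  assumes z: "norm (z :: complex) < 1"
  shows "norm ((1 + z) / (1 - z)) \<le> (1 + norm z) / (1 - norm z) * exp (2 * (Re z - norm z))"
proof -
  define r where "r = norm z"
  have r: "0 \<le> r" "r < 1" using z by (auto simp: r_def)
  define c :: "nat \<Rightarrow> real" where "c n = (if odd n then 2 / real n else 0)" for n
  have S: "(\<lambda>n. of_real (c n) * w ^ n) sums (Ln (1 + w) - Ln (1 - w))" if "norm w < 1" for w
  proof -
    have "(\<lambda>n. (-1) ^ Suc n / of_nat n * w ^ n - (-1) ^ Suc n / of_nat n * (- w) ^ n) sums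
        (Ln (1 + w) - Ln (1 + (- w)))"
      using that by (intro sums_diff Ln_series) auto
    moreover have "(-1) ^ Suc n / of_nat n * w ^ n - (-1) ^ Suc n / of_nat n * (- w) ^ n
        = of_real (c n) * w ^ n" for n
      by (cases "even n") (auto simp: c_def)
    ultimately show ?thesis by simp
  qed
  have E: "norm ((1 + w) / (1 - w)) = exp (Re (Ln (1 + w) - Ln (1 - w)))" if "norm w < 1" for w :: complex
  proof -
    have "1 + w \<noteq> 0" "1 - w \<noteq> 0" using that power_neq_1[of w 0] by auto
    then have "exp (Ln (1 + w) - Ln (1 - w)) = (1 + w) / (1 - w)" by (simp add: exp_diff)
    then show ?thesis by (metis norm_exp_eq_Re)
  qed
  have "Re (Ln (1 + z) - Ln (1 - z)) \<le> Re (Ln (1 + of_real r) - Ln (1 - of_real r)) + 2 * (Re z - r)"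
  proof (rule sums_le)
    show "(\<lambda>n. c n * Re (z ^ n)) sums Re (Ln (1 + z) - Ln (1 - z))"
      using sums_Re[OF S[OF z]] by simp
    have "(\<lambda>n. c n * r ^ n) sums Re (Ln (1 + of_real r) - Ln (1 - of_real r))"
      using sums_Re[OF S[of "of_real r"]] r by (simp flip: of_real_power)
    then show "(\<lambda>n. c n * r ^ n + (if n = 1 then 2 * (Re z - r) else 0)) sums
        (Re (Ln (1 + of_real r) - Ln (1 - of_real r)) + 2 * (Re z - r))"
      using sums_single[of 1 "\<lambda>_. 2 * (Re z - r)"] by (intro sums_add) auto
    fix n
    have "Re (z ^ n) \<le> r ^ n" using complex_Re_le_cmod[of "z ^ n"] by (simp add: norm_power r_def)
    then have "c n * Re (z ^ n) \<le> c n * r ^ n" by (intro mult_left_mono) (auto simp: c_def)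
    then show "c n * Re (z ^ n) \<le> c n * r ^ n + (if n = 1 then 2 * (Re z - r) else 0)"
      by (auto simp: c_def)
  qed
  then have "exp (Re (Ln (1 + z) - Ln (1 - z))) \<le>
      exp (Re (Ln (1 + of_real r) - Ln (1 - of_real r))) * exp (2 * (Re z - r))"
    by (simp flip: exp_add)
  moreover have "norm ((1 + of_real r) / (1 - of_real r) :: complex) = (1 + r) / (1 - r)"
  proof -
    have "(1 + of_real r) / (1 - of_real r) = (of_real ((1 + r) / (1 - r)) :: complex)" by simp
    then show ?thesis using r by (simp only: norm_of_real) simp
  qed
  ultimately show ?thesis
    using E[OF z] E[of "of_real r"] r by (simp add: r_def)
qed

section \<open>Comparison of the product with its value on the positive real axis\<close>

lemma norm_power_Suc_less_1:
  assumes "norm (q :: 'a::real_normed_field) < 1"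
  shows "norm (q ^ Suc i) < 1"
proof -
  have "norm q ^ Suc i \<le> norm q" using assms by (simp add: mult_left_le power_le_one)
  then show ?thesis using assms by (simp only: norm_power)
qed

lemma overp_nonzero:
  assumes "norm q < 1"
  shows "overp q N \<noteq> 0"
proof -
  have "(1 - q ^ Suc i) / (1 + q ^ Suc i) \<noteq> 0" for i
    using power_neq_1[OF assms, of i] by (simp only: divide_eq_0_iff simp_thms)
  then show ?thesis unfolding overp_def by (subst prod_zero_iff) blast+
qed

lemma overp_pos:
  assumes "0 \<le> r" "r < 1"
  shows "overp (r::real) N > 0"
  unfolding overp_def
proof (intro prod_pos divide_pos_pos)
  fix i
  have "0 \<le> r ^ Suc i" "r ^ Suc i < 1" using assms norm_power_Suc_less_1[of r i] by auto
  then show "0 < 1 - r ^ Suc i" "0 < 1 + r ^ Suc i" by auto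
qed

lemma overp_norm_inverse_le:
  assumes q: "norm (q :: complex) < 1"
  shows "norm (inverse (overp q N)) \<le> inverse (overp (norm q) N) * exp (2 * (\<Sum>i<N. Re (q ^ Suc i) - norm q ^ Suc i))"
proof -
  have "norm (inverse (overp q N)) = (\<Prod>i<N. norm ((1 + q ^ Suc i) / (1 - q ^ Suc i)))"
    unfolding overp_def by (simp add: prod_norm[symmetric] norm_inverse flip: prod_inversef del: power_Suc)
  also have "\<dots> \<le> (\<Prod>i<N. (1 + norm (q ^ Suc i)) / (1 - norm (q ^ Suc i)) * exp (2 * (Re (q ^ Suc i) - norm (q ^ Suc i))))"
    by (intro prod_mono conjI norm_quotient_le norm_power_Suc_less_1 q) auto
  also have "\<dots> = inverse (overp (norm q) N) * exp (2 * (\<Sum>i<N. Re (q ^ Suc i) - norm q ^ Suc i))"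
    unfolding overp_def prod.distrib norm_power
    by (simp add: exp_sum[symmetric] sum_distrib_left prod_inversef[symmetric] del: power_Suc)
  finally show ?thesis .
qed

lemma overp_norm_inverse_le':
  assumes q: "norm (q :: complex) < 1"
  shows "norm (inverse (overp q N)) \<le> inverse (overp (norm q) N)"
proof -
  have "(\<Sum>i<N. Re (q ^ Suc i) - norm q ^ Suc i) \<le> 0"
    using complex_Re_le_cmod[of "q ^ Suc _"] by (intro sum_nonpos) (simp add: norm_power del: power_Suc)
  then have "inverse (overp (norm q) N) * exp (2 * (\<Sum>i<N. Re (q ^ Suc i) - norm q ^ Suc i)) \<le> inverse (overp (norm q) N) * 1"
    using overp_pos[of "norm q" N] q by (intro mult_left_mono) auto
  with overp_norm_inverse_le[OF q, of N] show ?thesis by simp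
qed

lemma overp_decseq:
  assumes "0 \<le> r" "r < (1::real)"
  shows "overp r (Suc N) \<le> overp r N"
proof -
  have "0 \<le> r ^ Suc N" "r ^ Suc N < 1" using assms norm_power_Suc_less_1[of r N] by auto
  then have "(1 - r ^ Suc N) / (1 + r ^ Suc N) \<le> 1" by (simp add: divide_simps del: power_Suc)
  from mult_left_mono[OF this, of "overp r N"] show ?thesis
    using overp_pos[OF assms, of N] by (simp add: overp_def del: power_Suc)
qed

text \<open>On the positive axis the truncated products decrease to theta. Combined with the
  comparison of norms, this yields a majorant independent of \<open>N\<close> for the integrand of
  Cauchy's formula.\<close>

lemma theta4_le_overp:
  assumes "0 < r" "r < (1::real)"
  shows "theta4 r \<le> overp r N"
proof -
  have "decseq (overp r)" using overp_decseq[of r] assms by (intro decseq_SucI) auto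
  then have "overp r (2 * M) \<le> overp r N" if "N \<le> M" for M using that by (auto dest: decseqD[of _ N "2 * M"])
  then show ?thesis
    using assms by (intro tendsto_upperbound[OF overp_even_tendsto_theta4[of r]])
      (auto intro: eventually_at_top_linorderI[of N])
qed

lemma norm_theta4_ge:
  assumes "norm (q::complex) < 1" "q \<noteq> 0"
  shows "norm (theta4 q) \<ge> theta4 (norm q)"
proof (rule tendsto_le[OF sequentially_bot])
  show "(\<lambda>N. norm (overp q (2 * N))) \<longlonglongrightarrow> norm (theta4 q)"
    by (intro tendsto_norm overp_even_tendsto_theta4 assms)
  show "(\<lambda>N. overp (norm q) (2 * N)) \<longlonglongrightarrow> theta4 (norm q)"
    using assms by (intro overp_even_tendsto_theta4) auto
  have "overp (norm q) n \<le> norm (overp q n)" for n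
    using overp_norm_inverse_le'[OF assms(1), of n] overp_nonzero[of q n] assms(1)
    by (auto simp: norm_inverse intro: inverse_le_imp_le)
  then show "eventually (\<lambda>N. overp (norm q) (2 * N) \<le> norm (overp q (2 * N))) sequentially"
    by simp
qed

text \<open>Limit of the truncated estimates, in which the geometric sums become
  \<open>q / (1 - q)\<close>. The exponential is the entire saving away from the real axis: it is
  effective once \<open>norm (1 - q)\<close> clearly exceeds \<open>1 - norm q\<close>.\<close>

lemma norm_inverse_theta4_le:
  assumes q: "norm (q::complex) < 1" "q \<noteq> 0" and pos: "theta4 (norm q) > 0"
  shows "norm (inverse (theta4 q)) \<le> inverse (theta4 (norm q)) * exp (2 * (Re (q / (1 - q)) - norm q / (1 - norm q)))"
proof (rule tendsto_le[OF sequentially_bot])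
  have nz: "theta4 q \<noteq> 0" using norm_theta4_ge[OF q] pos by auto
  show "(\<lambda>N. norm (inverse (overp q (2 * N)))) \<longlonglongrightarrow> norm (inverse (theta4 q))"
    by (intro tendsto_norm tendsto_inverse overp_even_tendsto_theta4 q nz)
  have geo: "(\<lambda>N. \<Sum>i<N. w ^ Suc i) \<longlonglongrightarrow> w / (1 - w)" if "norm w < 1" for w :: "'b::{real_normed_field,banach}"
    using sums_mult[OF geometric_sums[OF that], of w] by (simp add: sums_def)
  have "(\<lambda>N. Re (\<Sum>i<N. q ^ Suc i) - (\<Sum>i<N. norm q ^ Suc i)) \<longlonglongrightarrow> Re (q / (1 - q)) - norm q / (1 - norm q)"
    using q by (intro tendsto_intros geo) auto
  then have "(\<lambda>N. \<Sum>i<N. Re (q ^ Suc i) - norm q ^ Suc i) \<longlonglongrightarrow> Re (q / (1 - q)) - norm q / (1 - norm q)"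
    by (simp add: sum_subtractf)
  from filterlim_compose[OF this, of "\<lambda>N. 2 * N" sequentially]
  have "(\<lambda>N. \<Sum>i<2*N. Re (q ^ Suc i) - norm q ^ Suc i) \<longlonglongrightarrow> Re (q / (1 - q)) - norm q / (1 - norm q)"
    by (simp add: mult_nat_left_at_top)
  then show "(\<lambda>N. inverse (overp (norm q) (2 * N)) * exp (2 * (\<Sum>i<2*N. Re (q ^ Suc i) - norm q ^ Suc i)))
     \<longlonglongrightarrow> inverse (theta4 (norm q)) * exp (2 * (Re (q / (1 - q)) - norm q / (1 - norm q)))"
    using q pos by (intro tendsto_intros overp_even_tendsto_theta4) auto
  show "eventually (\<lambda>N. norm (inverse (overp q (2 * N))) \<le>
      inverse (overp (norm q) (2 * N)) * exp (2 * (\<Sum>i<2*N. Re (q ^ Suc i) - norm q ^ Suc i))) sequentially"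
    by (intro always_eventually allI overp_norm_inverse_le q)
qed

section \<open>The inversion formula for theta\<close>

text \<open>A geometric sum whose ratio is an \<open>N\<close>-th root of unity. Sampling at odd
  multiples produces the sign \<open>(-1) powi (s div int N)\<close>, which later becomes the
  alternating sign of \<open>theta4\<close>.\<close>

lemma sum_cis_odd:
  fixes s :: int and N :: nat
  assumes N: "N > 0"
  shows "(\<Sum>j<N. cis (pi * of_int s * (2 * real j + 1) / real N))
    = (if int N dvd s then of_nat N * (-1) powi (s div int N) else 0)"
proof -
  define z where "z = cis (2 * pi * of_int s / N)"
  have eq: "cis (pi * of_int s * (2 * real j + 1) / real N) = cis (pi * of_int s / N) * z ^ j" for j
    unfolding z_def Complex.DeMoivre cis_mult using N by (intro arg_cong[of _ _ cis]) (simp add: field_simps)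
  have S: "(\<Sum>j<N. cis (pi * of_int s * (2 * real j + 1) / real N)) = cis (pi * of_int s / N) * (\<Sum>j<N. z ^ j)"
    unfolding eq by (rule sum_distrib_left[symmetric])
  show ?thesis
  proof (cases "int N dvd s")
    case True
    then obtain k where k: "s = int N * k" by auto
    have a: "pi * of_int s / N = of_int k * pi" using N by (simp add: k)
    have "z = cis (2 * pi * of_int k)" unfolding z_def using N by (intro arg_cong[of _ _ cis]) (simp add: k)
    then have z: "z = 1" using cis_multiple_2pi[of "of_int k"] by (simp add: mult.assoc)
    have "cis (of_int k * pi) = (-1) powi k"
      using cis_power_int[of pi k] by simp
    then show ?thesis unfolding S a using True z N by (simp add: k)
  next
    case False
    have zN: "z ^ N = 1" unfolding z_def Complex.DeMoivre using N by (simp add: cis_multiple_2pi)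
    have "z \<noteq> 1"
    proof
      assume "z = 1"
      then have "cos (2 * pi * of_int s / N) = 1" by (simp add: z_def complex_eq_iff)
      then obtain n :: int where "2 * pi * of_int s / N = n * 2 * pi" by (auto simp: cos_one_2pi_int)
      then have "real_of_int s = real_of_int (n * int N)" using N by (simp add: field_simps)
      then have "s = n * int N" by (simp only: of_int_eq_iff)
      then show False using False by simp
    qed
    then have "(\<Sum>j<N. z ^ j) = 0" using zN by (simp add: geometric_sum)
    then show ?thesis unfolding S using False by simp
  qed
qed

lemma sum_reflect_symmetric:
  fixes f :: "int \<Rightarrow> 'a::comm_ring_1"
  assumes "\<And>s. f (- s) = f s"
  shows "(\<Sum>r\<le>2 * m. f (int r - int m)) = f 0 + 2 * (\<Sum>s=1..m. f (int s))"
proof -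
  have "(\<Sum>r\<le>2 * m. f (int r - int m)) = (\<Sum>r<m. f (int r - int m)) + (\<Sum>r=m..2*m. f (int r - int m))"
  proof -
    have "{..2*m} = {..<m} \<union> {m..2*m}" by auto
    then show ?thesis by (simp only:) (rule sum.union_disjoint, auto)
  qed
  also have "(\<Sum>r<m. f (int r - int m)) = (\<Sum>s=1..m. f (int s))"
  proof (rule sum.reindex_bij_witness[of _ "\<lambda>s. m - s" "\<lambda>r. m - r"])
    fix r assume "r \<in> {..<m}"
    then show "f (int (m - r)) = f (int r - int m)"
      using assms[of "int r - int m"] by (simp add: of_nat_diff)
  qed auto
  also have "(\<Sum>r=m..2*m. f (int r - int m)) = (\<Sum>s=0..m. f (int s))"
    by (rule sum.reindex_bij_witness[of _ "\<lambda>s. m + s" "\<lambda>r. r - m"]) (auto simp: of_nat_diff)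
  also have "\<dots> = f 0 + (\<Sum>s=1..m. f (int s))"
    by (simp add: sum.atLeast_Suc_atMost)
  finally show ?thesis by simp
qed

text \<open>Polya's derivation of the inversion formula: the discrete form, obtained by applying a
  roots-of-unity filter to the central binomial expansion.\<close>

lemma cos_power_sum:
  assumes h: "h > 0"
  shows "(\<Sum>j<h. cos (pi * (2 * real j + 1) / (4 * real h)) ^ (2 * m)) =
    real h * (real (2 * m choose m) / 4 ^ m) *
      (1 + 2 * (\<Sum>k=1..m. (-1) ^ k * (real (2 * m choose (m + 2 * h * k)) / real (2 * m choose m))))"
proof -
  \<comment> \<open>The filter uses \<open>2 * h\<close> nodes; the reflection of \<open>y\<close>
    into \<open>pi - y\<close> pairs them, leaving the \<open>h\<close> nodes below
    \<open>pi / 2\<close> and a factor 2.\<close>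
  define N where "N = 2 * h"
  define x where "x j = pi * (2 * real j + 1) / (2 * real N)" for j
  have N: "N > 0" using h by (simp add: N_def)
  have expand: "complex_of_real ((2 * cos y) ^ (2 * m)) = (\<Sum>r\<le>2*m. of_nat (2 * m choose r) * cis (2 * of_int (int r - int m) * y))" for y
  proof -
    have "complex_of_real (2 * cos y) = cis y + cis (- y)"
      by (simp add: complex_eq_iff)
    then have "complex_of_real ((2 * cos y) ^ (2 * m)) = (cis y + cis (- y)) ^ (2 * m)"
      by (simp only: of_real_power)
    also have "\<dots> = (\<Sum>r\<le>2*m. of_nat (2 * m choose r) * cis y ^ r * cis (- y) ^ (2 * m - r))"
      by (rule binomial_ring)
    also have "\<dots> = (\<Sum>r\<le>2*m. of_nat (2 * m choose r) * cis (2 * of_int (int r - int m) * y))"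
    proof (intro sum.cong refl)
      fix r assume "r \<in> {..2*m}"
      then have "real r * y + real (2 * m - r) * (- y) = 2 * of_int (int r - int m) * y"
        by (simp add: of_nat_diff algebra_simps)
      then show "of_nat (2 * m choose r) * cis y ^ r * cis (- y) ^ (2 * m - r) = of_nat (2 * m choose r) * cis (2 * of_int (int r - int m) * y)"
        by (simp only: Complex.DeMoivre cis_mult mult.assoc)
    qed
    finally show ?thesis .
  qed
  define b :: "int \<Rightarrow> complex" where "b s = of_nat (2 * m choose nat (int m + s))" for s
  define g :: "int \<Rightarrow> complex" where
    "g s = (if \<bar>s\<bar> \<le> int m then b s else 0) * (if int N dvd s then of_nat N * (-1) powi (s div int N) else 0)" for s
  have "complex_of_real (\<Sum>j<N. (2 * cos (x j)) ^ (2 * m))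
    = (\<Sum>j<N. \<Sum>r\<le>2*m. of_nat (2 * m choose r) * cis (2 * of_int (int r - int m) * x j))"
    unfolding of_real_sum expand ..
  also have "\<dots> = (\<Sum>r\<le>2*m. of_nat (2 * m choose r) * (\<Sum>j<N. cis (2 * of_int (int r - int m) * x j)))"
    by (subst sum.swap) (simp add: sum_distrib_left)
  also have "\<dots> = (\<Sum>r\<le>2*m. g (int r - int m))"
  proof (intro sum.cong refl)
    fix r assume r: "r \<in> {..2*m}"
    have "(\<Sum>j<N. cis (2 * of_int (int r - int m) * x j)) = (\<Sum>j<N. cis (pi * of_int (int r - int m) * (2 * real j + 1) / real N))"
      using N by (intro sum.cong refl arg_cong[of _ _ cis]) (simp add: x_def field_simps)
    then show "of_nat (2 * m choose r) * (\<Sum>j<N. cis (2 * of_int (int r - int m) * x j)) = g (int r - int m)"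
      using r sum_cis_odd[OF N, of "int r - int m"] by (auto simp: g_def b_def)
  qed
  also have "\<dots> = g 0 + 2 * (\<Sum>s=1..m. g (int s))"
  proof (rule sum_reflect_symmetric)
    fix s :: int
    have "b (- s) = b s" if "\<bar>s\<bar> \<le> int m"
    proof -
      have "nat (int m + s) \<le> 2 * m" "2 * m - nat (int m + s) = nat (int m + - s)" using that by auto
      then show ?thesis using binomial_symmetric[of "nat (int m + s)" "2 * m"] by (simp add: b_def)
    qed
    moreover have "(-1) powi ((- s) div int N) = ((-1) powi (s div int N) :: complex)" if d: "int N dvd s"
    proof -
      obtain k where k: "s = int N * k" using d by auto
      have "- s div int N = - k" "s div int N = k"
        using N nonzero_mult_div_cancel_left[of "int N" "- k"] by (simp_all add: k)
      then show ?thesis by (simp add: power_int_minus flip: power_int_inverse)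
    qed
    ultimately show "g (- s) = g s" by (simp add: g_def)
  qed
  also have "(\<Sum>s=1..m. g (int s)) = (\<Sum>k=1..m. of_nat N * ((-1) ^ k * of_nat (2 * m choose (m + N * k))))"
  proof -
    have "(\<Sum>s=1..m. g (int s)) = (\<Sum>s\<in>{s\<in>{1..m}. N dvd s}. g (int s))"
      by (rule sum.mono_neutral_right) (auto simp: g_def)
    also have "\<dots> = (\<Sum>k\<in>{k\<in>{1..m}. N * k \<le> m}. of_nat N * ((-1) ^ k * of_nat (2 * m choose (m + N * k))))"
    proof (rule sum.reindex_bij_witness[of _ "\<lambda>k. N * k" "\<lambda>s. s div N"])
      fix s assume s: "s \<in> {s\<in>{1..m}. N dvd s}"
      then obtain k where k: "s = N * k" by auto
      then show "N * (s div N) = s" using N by simp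
      have "k \<le> N * k" "k \<noteq> 0" using N s k by (auto intro: Nat.gr0I)
      moreover have "N * k \<le> m" using s k by auto
      ultimately have "0 < k" "k \<le> m" by linarith+
      then show "s div N \<in> {k\<in>{1..m}. N * k \<le> m}" using s N unfolding k by auto
      show "of_nat N * ((-1) ^ (s div N) * of_nat (2 * m choose (m + N * (s div N)))) = g (int s)"
      proof -
        have "int (N * k) div int N = int k" using N by simp
        then show ?thesis using s N by (simp add: g_def b_def k nat_add_distrib flip: of_nat_mult of_nat_add)
      qed
    next
      fix k assume k: "k \<in> {k\<in>{1..m}. N * k \<le> m}"
      then show "N * k div N = k" "N * k \<in> {s\<in>{1..m}. N dvd s}" using N by auto
    qed
    also have "\<dots> = (\<Sum>k=1..m. of_nat N * ((-1) ^ k * of_nat (2 * m choose (m + N * k))))"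
      by (rule sum.mono_neutral_left) (auto simp: binomial_eq_0)
    finally show ?thesis .
  qed
  also have "g 0 = of_nat N * of_nat (2 * m choose m)" by (simp add: g_def b_def)
  finally have "complex_of_real (\<Sum>j<N. (2 * cos (x j)) ^ (2 * m)) =
     complex_of_real (real N * real (2 * m choose m) + 2 * (\<Sum>k=1..m. real N * ((-1) ^ k * real (2 * m choose (m + N * k)))))"
    by simp
  then have "(\<Sum>j<N. (2 * cos (x j)) ^ (2 * m)) =
     real N * real (2 * m choose m) + 2 * (\<Sum>k=1..m. real N * ((-1) ^ k * real (2 * m choose (m + N * k))))"
    by (simp only: of_real_eq_iff)
  also have "\<dots> = real N * real (2 * m choose m) *
     (1 + 2 * (\<Sum>k=1..m. (-1) ^ k * (real (2 * m choose (m + N * k)) / real (2 * m choose m))))"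
    by (simp add: sum_distrib_left algebra_simps)
  also have "(\<Sum>j<N. (2 * cos (x j)) ^ (2 * m)) = 4 ^ m * (\<Sum>j<N. cos (x j) ^ (2 * m))"
    by (simp add: power_mult_distrib power_mult sum_distrib_left)
  also have "(\<Sum>j<N. cos (x j) ^ (2 * m)) = 2 * (\<Sum>j<h. cos (x j) ^ (2 * m))"
  proof -
    have "(\<Sum>j<N. cos (x j) ^ (2 * m)) = (\<Sum>j<h. cos (x j) ^ (2 * m)) + (\<Sum>j=h..<N. cos (x j) ^ (2 * m))"
      unfolding lessThan_atLeast0 by (rule sum.atLeastLessThan_concat[symmetric]) (simp_all add: N_def)
    also have "(\<Sum>j=h..<N. cos (x j) ^ (2 * m)) = (\<Sum>j<h. cos (x j) ^ (2 * m))"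
    proof (rule sum.reindex_bij_witness[of _ "\<lambda>j. N - Suc j" "\<lambda>j. N - Suc j"])
      fix j assume j: "j \<in> {h..<N}"
      then have "x (N - Suc j) = pi - x j"
        using h by (simp add: x_def N_def of_nat_diff field_simps)
      then show "cos (x (N - Suc j)) ^ (2 * m) = cos (x j) ^ (2 * m)"
        by (simp add: power_mult)
    qed (auto simp: N_def)
    finally show ?thesis by simp
  qed
  finally have "4 ^ m * (2 * (\<Sum>j<h. cos (x j) ^ (2 * m))) =
     2 * (real h * real (2 * m choose m) *
     (1 + 2 * (\<Sum>k=1..m. (-1) ^ k * (real (2 * m choose (m + N * k)) / real (2 * m choose m)))))"
    by (simp add: N_def)
  then show ?thesis
    by (simp add: x_def N_def field_simps)
qed

section \<open>Gaussian limits of binomial coefficients and of powers of the cosine\<close>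

lemma central_binomial_pochhammer:
  "real (2 * n choose n) = 4 ^ n * pochhammer (1/2) n / fact n"
proof -
  have "(fact (2 * n) :: real) = 4 ^ n * pochhammer (1/2) n * fact n"
    by (simp add: fact_double power_mult)
  then show ?thesis
    by (simp add: binomial_fact mult_2)
qed

text \<open>Wallis' asymptotics, read off from the product for \<open>rGamma (1/2)\<close>. The
  factor \<open>n / (n + 1/2)\<close> removes the surplus last factor of the Pochhammer symbol and
  changes \<open>1 / sqrt n\<close> into \<open>sqrt n\<close>.\<close>

lemma central_binomial_limit:
  "(\<lambda>n. real (2 * n choose n) / 4 ^ n * sqrt (real n)) \<longlonglongrightarrow> 1 / sqrt pi"
proof -
  have "rGamma_series (1/2 :: real) \<longlonglongrightarrow> rGamma (1/2)" by (rule rGamma_series_LIMSEQ)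
  also have "rGamma (1/2 :: real) = 1 / sqrt pi"
    by (simp only: rGamma_inverse_Gamma Gamma_one_half_real inverse_eq_divide)
  finally have 1: "rGamma_series (1/2 :: real) \<longlonglongrightarrow> 1 / sqrt pi" .
  have "(\<lambda>n. real n / (real n + 1/2)) \<longlonglongrightarrow> 1" by real_asymp
  from tendsto_mult[OF 1 this]
  have "(\<lambda>n. rGamma_series (1/2) n * (real n / (real n + 1/2))) \<longlonglongrightarrow> 1 / sqrt pi" by simp
  moreover have "eventually (\<lambda>n. rGamma_series (1/2) n * (real n / (real n + 1/2)) = real (2 * n choose n) / 4 ^ n * sqrt (real n)) sequentially"
    using eventually_gt_at_top[of 0]
  proof eventually_elim
    case (elim n)
    have "exp (1/2 * ln (real n)) = sqrt n"
      using elim by (simp add: powr_half_sqrt[symmetric] powr_def)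
    then have "rGamma_series (1/2) n = pochhammer (1/2) n * (real n + 1/2) / (fact n * sqrt n)"
      by (simp add: rGamma_series_def pochhammer_Suc add.commute)
    moreover have "sqrt n * sqrt n = real n" by simp
    moreover have "real (2 * n choose n) / 4 ^ n = pochhammer (1/2) n / fact n"
      by (simp add: central_binomial_pochhammer)
    moreover have "a * (b + 1/2) / (f * s) * (b / (b + 1/2)) = a / f * s"
      if "s * s = b" "b > 0" "f > 0" for a b f s :: real
    proof -
      have "s \<noteq> 0" using that by auto
      have "a * (b + 1/2) / (f * s) * (b / (b + 1/2)) = a * b / (f * s)"
      proof -
        have "a * d / (f * s) * (b / d) = a * b / (f * s)" if "d \<noteq> 0" for d :: real
          using that by simp
        then show ?thesis using that(2) by simp
      qed
      also have "\<dots> = a / f * s" unfolding that(1)[symmetric] using \<open>s \<noteq> 0\<close> that by (simp add: field_simps)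
      finally show ?thesis .
    qed
    ultimately show ?case using elim by (simp only:) simp
  qed
  ultimately show ?thesis by (rule Lim_transform_eventually)
qed

lemma binomial_ratio_eq_prod:
  assumes "s \<le> m"
  shows "real (2 * m choose (m + s)) / real (2 * m choose m) = (\<Prod>i<s. 1 - real s / real (m + 1 + i))"
proof -
  have F: "(fact (m + s) :: real) = fact m * (\<Prod>i<s. real (m + 1 + i))" for s
    by (induction s) (simp_all add: algebra_simps)
  have "(fact m :: real) = fact (m - s) * (\<Prod>i<s. real (m - s + 1 + i))"
  proof -
    have "(fact (m' + s) :: real) = fact m' * (\<Prod>i<s. real (m' + 1 + i))" for m'
      by (induction s) (simp_all add: algebra_simps)
    from this[of "m - s"] show ?thesis using assms by simp
  qed
  moreover have "real (2 * m choose (m + s)) = fact (2 * m) / (fact (m + s) * fact (m - s))"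
    using assms by (simp add: binomial_fact mult_2)
  moreover have "real (2 * m choose m) = fact (2 * m) / (fact m * fact m)"
    by (simp add: binomial_fact mult_2)
  ultimately have "real (2 * m choose (m + s)) / real (2 * m choose m) = (\<Prod>i<s. real (m - s + 1 + i)) / (\<Prod>i<s. real (m + 1 + i))"
  proof -
    have "a / (p * A * f) / (a / (p * p)) = B / A"
      if "p = f * B" "a > 0" "f > 0" "p > 0" "A > 0" for a p A f B :: real
      using that(2-) unfolding that(1) by (simp add: field_simps)
    note * = this
    show ?thesis
      unfolding \<open>real (2 * m choose (m + s)) = _\<close> \<open>real (2 * m choose m) = _\<close> F[of s]
      by (rule *) (use \<open>fact m = _\<close> in \<open>auto intro!: prod_pos mult_pos_pos\<close>)
  qed
  also have "\<dots> = (\<Prod>i<s. real (m - s + 1 + i) / real (m + 1 + i))"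
    by (rule prod_dividef[symmetric])
  also have "\<dots> = (\<Prod>i<s. 1 - real s / real (m + 1 + i))"
    using assms by (intro prod.cong refl) (simp add: of_nat_diff field_simps)
  finally show ?thesis .
qed

text \<open>The factors lie between \<open>1 - s / (m + 1)\<close> and
  \<open>1 - s / (m + s)\<close>. The inequality \<open>1 + x \<le> exp x\<close> bounds the larger
  one from above and, in reciprocal form, the smaller one from below. For \<open>s\<close> of order
  \<open>sqrt m\<close> both exponents have the same limit.\<close>

lemma binomial_ratio_bounds:
  assumes "s \<le> m"
  shows "real (2 * m choose (m + s)) / real (2 * m choose m) \<le> exp (- ((real s)^2 / (real m + real s)))"
    and "exp (- ((real s)^2 / (real m + 1 - real s))) \<le> real (2 * m choose (m + s)) / real (2 * m choose m)"
proof -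
  let ?f = "\<lambda>i. 1 - real s / real (m + 1 + i)"
  have nn: "0 \<le> ?f i" for i using assms by (simp add: field_simps)
  have "(\<Prod>i<s. ?f i) \<le> (\<Prod>i<s. exp (- (real s / (real m + real s))))"
  proof (intro prod_mono conjI nn)
    fix i assume "i \<in> {..<s}"
    then have "real s / (real m + real s) \<le> real s / real (m + 1 + i)"
      by (intro divide_left_mono mult_pos_pos) auto
    then have "?f i \<le> 1 + - (real s / (real m + real s))" by simp
    also have "\<dots> \<le> exp (- (real s / (real m + real s)))" by (rule exp_ge_add_one_self)
    finally show "?f i \<le> exp (- (real s / (real m + real s)))" .
  qed
  also have "\<dots> = exp (- ((real s)^2 / (real m + real s)))"
    by (simp add: power2_eq_square flip: exp_of_nat_mult)
  finally show "real (2 * m choose (m + s)) / real (2 * m choose m) \<le> exp (- ((real s)^2 / (real m + real s)))"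
    unfolding binomial_ratio_eq_prod[OF assms] .
  have "exp (- ((real s)^2 / (real m + 1 - real s))) = (\<Prod>i<s. exp (- (real s / (real m + 1 - real s))))"
    by (simp add: power2_eq_square flip: exp_of_nat_mult)
  also have "\<dots> \<le> (\<Prod>i<s. ?f i)"
  proof (intro prod_mono conjI)
    fix i
    have d: "real m + 1 - real s > 0" using assms by simp
    have "1 + real s / (real m + 1 - real s) \<le> exp (real s / (real m + 1 - real s))"
      by (rule exp_ge_add_one_self)
    moreover have "1 + real s / (real m + 1 - real s) = inverse (1 - real s / (real m + 1))"
      using d by (simp add: field_simps)
    ultimately have "inverse (exp (real s / (real m + 1 - real s))) \<le> inverse (inverse (1 - real s / (real m + 1)))"
      using d by (intro le_imp_inverse_le) (auto simp: field_simps)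
    then have "exp (- (real s / (real m + 1 - real s))) \<le> 1 - real s / (real m + 1)"
      by (simp add: exp_minus)
    also have "\<dots> \<le> ?f i" by (intro diff_mono divide_left_mono) auto
    finally show "exp (- (real s / (real m + 1 - real s))) \<le> ?f i" .
  qed auto
  finally show "exp (- ((real s)^2 / (real m + 1 - real s))) \<le> real (2 * m choose (m + s)) / real (2 * m choose m)"
    unfolding binomial_ratio_eq_prod[OF assms] .
qed

lemma mult_cos_le_sin:
  assumes "0 \<le> y" "y \<le> pi"
  shows "y * cos y \<le> sin y"
proof -
  have "sin 0 - 0 * cos 0 \<le> sin y - y * cos y"
  proof (rule DERIV_nonneg_imp_nondecreasing[OF assms(1)])
    fix t assume t: "0 \<le> t" "t \<le> y"
    have "((\<lambda>t. sin t - t * cos t) has_real_derivative t * sin t) (at t)"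
      by (auto intro!: derivative_eq_intros)
    moreover have "0 \<le> t * sin t" using t assms by (intro mult_nonneg_nonneg sin_ge_zero) auto
    ultimately show "\<exists>z. ((\<lambda>t. sin t - t * cos t) has_real_derivative z) (at t) \<and> 0 \<le> z" by blast
  qed
  then show ?thesis by simp
qed

lemma one_minus_cos_le: "1 - cos x \<le> (x :: real)^2 / 2"
proof -
  have "1 - cos x = 2 * (sin (x / 2))\<^sup>2" using cos_double_sin[of "x/2"] by simp
  also have "(sin (x / 2))\<^sup>2 \<le> (x / 2)^2" using abs_sin_x_le_abs_x[of "x/2"] by (simp only: abs_le_square_iff)
  finally show ?thesis by (simp add: power_divide)
qed

lemma cos_le_exp:
  assumes "0 \<le> x" "x \<le> pi / 2"
  shows "cos x \<le> exp (- (x^2 / 2))"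
proof -
  have "exp (x^2 / 2) * cos x \<le> exp (0\<^sup>2 / 2) * cos 0"
  proof (rule DERIV_nonpos_imp_nonincreasing[OF assms(1)])
    fix t assume t: "0 \<le> t" "t \<le> x"
    have "((\<lambda>t. exp (t^2 / 2) * cos t) has_real_derivative exp (t^2 / 2) * (t * cos t - sin t)) (at t)"
      by (auto intro!: derivative_eq_intros simp: algebra_simps)
    moreover have "exp (t^2 / 2) * (t * cos t - sin t) \<le> 0"
      using mult_cos_le_sin[of t] t assms by (intro mult_nonneg_nonpos) auto
    ultimately show "\<exists>z. ((\<lambda>t. exp (t^2 / 2) * cos t) has_real_derivative z) (at t) \<and> z \<le> 0" by blast
  qed
  then show ?thesis by (simp add: exp_minus field_simps)
qed

text \<open>\<open>1 + x^2 / (2 - x^2)\<close> is the reciprocal of \<open>1 - x^2 / 2\<close>, so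
  \<open>1 + y \<le> exp y\<close> converts the quadratic lower bound of the cosine into an
  exponential one, matching \<open>cos_le_exp\<close> to leading order.\<close>

lemma cos_ge_exp:
  assumes "\<bar>x :: real\<bar> \<le> 1"
  shows "exp (- (x^2 / (2 - x\<^sup>2))) \<le> cos x"
proof -
  have x2: "x\<^sup>2 \<le> 1" using power_le_one[of "\<bar>x\<bar>" 2] assms by simp
  have "1 + x^2 / (2 - x\<^sup>2) \<le> exp (x^2 / (2 - x\<^sup>2))" by (rule exp_ge_add_one_self)
  moreover have "1 + x^2 / (2 - x\<^sup>2) = inverse (1 - x\<^sup>2 / 2)"
    using x2 by (simp add: field_simps)
  ultimately have "inverse (exp (x^2 / (2 - x\<^sup>2))) \<le> inverse (inverse (1 - x\<^sup>2 / 2))"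
    using x2 by (intro le_imp_inverse_le) auto
  then have "exp (- (x^2 / (2 - x\<^sup>2))) \<le> 1 - x\<^sup>2 / 2" by (simp add: exp_minus)
  also have "\<dots> \<le> cos x" using one_minus_cos_le[of x] by simp
  finally show ?thesis .
qed

text \<open>Limit of the finite identity with exponent \<open>m\<close> close to
  \<open>4 * h^2 / t\<close>. On this scale the binomial ratio at \<open>2 * h * k\<close> tends to
  \<open>exp (- t * k^2)\<close>, a term of theta, while the cosine powers tend to the Gaussians of
  the dual sum; Tannery's theorem applies to both sums.\<close>

theorem theta4_inversion_real:
  assumes t: "t > (0::real)"
  shows "theta4 (exp (- t)) = 2 * sqrt (pi / t) * (\<Sum>j. exp (- (pi^2 * (2 * real j + 1)^2 / (4 * t))))"
proof -
  let ?g = "\<lambda>j. exp (- (pi^2 * (2 * real j + 1)\<^sup>2 / (4 * t)))"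
  define M where "M h = nat \<lfloor>4 * (real h)^2 / t\<rfloor>" for h
  have M_le: "real (M h) \<le> 4 * (real h)^2 / t" for h
    using t unfolding M_def by (simp add: of_nat_nat)
  have M_ge: "real (M h) \<ge> 4 * (real h)^2 / t - 1" for h
    unfolding M_def by linarith
  have M_lim: "(\<lambda>h. real (M h) / (real h)^2) \<longlonglongrightarrow> 4 / t"
  proof (rule tendsto_sandwich)
    show "eventually (\<lambda>h. 4 / t - 1 / (real h)^2 \<le> real (M h) / (real h)^2) sequentially"
      using eventually_gt_at_top[of 0]
    proof eventually_elim
      case (elim h)
      then have "(4 * (real h)^2 / t - 1) / (real h)^2 \<le> real (M h) / (real h)^2"
        using M_ge[of h] by (intro divide_right_mono) auto
      then show ?case using elim by (simp add: diff_divide_distrib)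
    qed
    show "eventually (\<lambda>h. real (M h) / (real h)^2 \<le> 4 / t) sequentially"
      using eventually_gt_at_top[of 0]
    proof eventually_elim
      case (elim h)
      then have "real (M h) / (real h)^2 \<le> (4 * (real h)^2 / t) / (real h)^2"
        using M_le[of h] by (intro divide_right_mono) auto
      then show ?case using elim by simp
    qed
    show "(\<lambda>h. 4 / t - 1 / (real h)^2) \<longlonglongrightarrow> 4 / t" by real_asymp
  qed auto
  have M_top: "filterlim M at_top sequentially"
  proof -
    have "filterlim (\<lambda>h. 4 * (real h)^2 / t - 1) at_top sequentially" using t by real_asymp
    then have "filterlim (\<lambda>h. real (M h)) at_top sequentially"
      by (rule filterlim_at_top_mono) (use M_ge in auto)
    then show ?thesis by (simp add: filterlim_real_sequentially filterlim_sequentially_iff_filterlim_real)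
  qed

  define c where "c h k = real (2 * M h choose (M h + 2 * h * Suc k)) / real (2 * M h choose M h)" for h k
  \<comment> \<open>For a nonzero term \<open>M + s \<le> 2 * M\<close>; this halves the exponent,
    hence the rate \<open>t / 2\<close>.\<close>
  have c_le: "\<bar>c h k\<bar> \<le> exp (- (t / 2)) ^ k" if h: "h > 0" for h k
  proof (cases "2 * h * Suc k \<le> M h")
    case True
    define s where "s = 2 * h * Suc k"
    have s: "0 < real s" "real s \<le> real (M h)" using True h unfolding s_def of_nat_le_iff of_nat_0_less_iff by auto
    have M: "real (M h) * t \<le> 4 * (real h)^2" using M_le[of h] t by (simp add: field_simps)
    have "real k \<le> (real (Suc k))\<^sup>2" by (simp add: power2_eq_square algebra_simps)
    then have "t / 2 * real k \<le> t / 2 * (real (Suc k))\<^sup>2" using t by (intro mult_left_mono) auto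
    also have "\<dots> \<le> (real s)^2 / (2 * real (M h))"
    proof -
      have "real (M h) * t * (real (Suc k))\<^sup>2 \<le> 4 * (real h)^2 * (real (Suc k))\<^sup>2"
        using M by (intro mult_right_mono) auto
      also have "\<dots> = (real s)^2" unfolding s_def of_nat_mult power_mult_distrib by simp
      finally show ?thesis using s by (simp add: divide_simps mult_ac)
    qed
    also have "\<dots> \<le> (real s)^2 / (real (M h) + real s)"
      using s by (intro divide_left_mono) auto
    finally have "exp (- ((real s)^2 / (real (M h) + real s))) \<le> exp (real k * (- (t / 2)))" by (simp add: mult_ac)
    moreover have "c h k \<le> exp (- ((real s)^2 / (real (M h) + real s)))"
      unfolding c_def using binomial_ratio_bounds(1)[OF True] by (simp only: s_def)
    ultimately show ?thesis
      unfolding exp_of_nat_mult by (simp add: c_def)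
  next
    case False
    then have "2 * M h choose (M h + 2 * h * Suc k) = 0" by (intro binomial_eq_0) linarith
    then have "c h k = 0" unfolding c_def by (simp only: of_nat_0 div_0)
    then show ?thesis by simp
  qed
  have c_lim: "(\<lambda>h. c h k) \<longlonglongrightarrow> exp (- (t * (real (Suc k))\<^sup>2))" for k
  proof -
    define \<kappa> where "\<kappa> = real (Suc k)"
    define u where "u h = real (M h) / (real h)^2" for h
    have u: "u \<longlonglongrightarrow> 4 / t" unfolding u_def[abs_def] by (rule M_lim)
    have "filterlim (\<lambda>h. 4 * (real h)^2 / t - 1 - 2 * real h * \<kappa>) at_top sequentially"
      using t by real_asymp
    then have "eventually (\<lambda>h. 4 * (real h)^2 / t - 1 - 2 * real h * \<kappa> \<ge> 0) sequentially"
      unfolding filterlim_at_top by blast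
    then have ev: "eventually (\<lambda>h. h > 0 \<and> 2 * h * Suc k \<le> M h) sequentially"
      using eventually_gt_at_top[of 0]
    proof eventually_elim
      case (elim h)
      then have "2 * real h * \<kappa> \<le> real (M h)" using M_ge[of h] by linarith
      then have "real (2 * h * Suc k) \<le> real (M h)" by (simp add: \<kappa>_def algebra_simps)
      then show ?case using elim by (simp only: of_nat_le_iff)
    qed
    have k0: "(\<lambda>h. 2 * \<kappa> / real h) \<longlonglongrightarrow> 0" "(\<lambda>h. 1 / (real h)^2 - 2 * \<kappa> / real h) \<longlonglongrightarrow> 0"
      by real_asymp+
    have lim: "(\<lambda>h. exp (- (4 * \<kappa>^2 / (u h + w h)))) \<longlonglongrightarrow> exp (- (t * \<kappa>^2))" if "w \<longlonglongrightarrow> 0" for w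
    proof -
      have "(\<lambda>h. exp (- (4 * \<kappa>^2 / (u h + w h)))) \<longlonglongrightarrow> exp (- (4 * \<kappa>^2 / (4 / t + 0)))"
        using t by (intro tendsto_intros u that) auto
      then show ?thesis using t by (simp add: field_simps)
    qed
    show ?thesis unfolding \<kappa>_def[symmetric]
    proof (rule tendsto_sandwich[OF _ _ lim[OF k0(2)] lim[OF k0(1)]])
      have e: "(real (2 * h * Suc k))\<^sup>2 / (real (M h) + y) = 4 * \<kappa>^2 / (u h + y / (real h)^2)" if "h > 0" for h y
      proof -
        have "u h + y / (real h)^2 = (real (M h) + y) / (real h)^2" by (simp add: u_def add_divide_distrib)
        moreover have "(real (2 * h * Suc k))\<^sup>2 = 4 * \<kappa>^2 * (real h)^2"
          unfolding \<kappa>_def of_nat_mult power_mult_distrib by simp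
        ultimately show ?thesis by simp
      qed
      have y: "real (2 * h * Suc k) / (real h)^2 = 2 * \<kappa> / real h" if "h > 0" for h
        using that by (simp add: \<kappa>_def power2_eq_square field_simps)
      show "eventually (\<lambda>h. exp (- (4 * \<kappa>^2 / (u h + (1 / (real h)^2 - 2 * \<kappa> / real h)))) \<le> c h k) sequentially"
        using ev
      proof eventually_elim
        case (elim h)
        then show ?case
          using binomial_ratio_bounds(2)[of "2 * h * Suc k" "M h"] e[of h "1 - real (2 * h * Suc k)"] y[of h]
          by (simp only: c_def add_diff_eq[symmetric] diff_divide_distrib simp_thms)
      qed
      show "eventually (\<lambda>h. c h k \<le> exp (- (4 * \<kappa>^2 / (u h + 2 * \<kappa> / real h)))) sequentially"
        using ev
      proof eventually_elim
        case (elim h)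
        then show ?case
          using binomial_ratio_bounds(1)[of "2 * h * Suc k" "M h"] e[of h "real (2 * h * Suc k)"] y[of h]
          by (simp only: c_def simp_thms)
      qed
    qed
  qed
  have S_lim: "(\<lambda>h. 1 + 2 * (\<Sum>k. (-1) ^ Suc k * c h k)) \<longlonglongrightarrow> theta4 (exp (- t))"
  proof -
    have "(\<lambda>h. \<Sum>k. (-1) ^ Suc k * c h k) \<longlonglongrightarrow> (\<Sum>k. (-1) ^ Suc k * exp (- (t * (real (Suc k))\<^sup>2)))"
    proof (rule tannerys_theorem[THEN conjunct2, THEN conjunct2])
      show "(\<lambda>h. (-1) ^ Suc k * c h k) \<longlonglongrightarrow> (-1) ^ Suc k * exp (- (t * (real (Suc k))\<^sup>2))" for k
        by (intro tendsto_mult tendsto_const c_lim)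
      show "eventually (\<lambda>(k, h). norm ((-1) ^ Suc k * c h k) \<le> exp (- (t / 2)) ^ k) (at_top \<times>\<^sub>F sequentially)"
        unfolding eventually_prod_filter
        by (rule exI[of _ "\<lambda>_. True"], rule exI[of _ "\<lambda>h. h > 0"])
           (use c_le in \<open>auto simp: abs_mult eventually_gt_at_top\<close>)
      show "summable (\<lambda>k. exp (- (t / 2)) ^ k)" using t by (simp add: summable_geometric)
    qed auto
    moreover have "exp (- (t * (real (Suc k))\<^sup>2)) = exp (- t) ^ (Suc k)^2" for k
      by (simp flip: exp_of_nat_mult add: mult.commute)
    ultimately show ?thesis unfolding theta4_def by (intro tendsto_intros) simp
  qed

  define x where "x h j = pi * (2 * real j + 1) / (4 * real h)" for h j
  define d where "d h j = (if j < h then cos (x h j) ^ (2 * M h) else 0)" for h j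
  have x_range: "0 \<le> x h j" "x h j \<le> pi / 2" if "j < h" for h j
  proof -
    show "0 \<le> x h j" by (simp add: x_def)
    have "2 * real j + 1 \<le> 2 * real h" using that by linarith
    then have "pi * (2 * real j + 1) \<le> pi * (2 * real h)" by (intro mult_left_mono) auto
    then show "x h j \<le> pi / 2" using that by (simp add: x_def field_simps)
  qed
  have d_le_exp: "d h j \<le> exp (- (real (M h) * (x h j)^2))" if "j < h" for h j
  proof -
    have "cos (x h j) ^ (2 * M h) \<le> exp (- ((x h j)^2 / 2)) ^ (2 * M h)"
      using x_range[OF that] by (intro power_mono cos_le_exp cos_ge_zero) auto
    also have "\<dots> = exp (- (real (M h) * (x h j)^2))"
      by (simp flip: exp_of_nat_mult)
    finally show ?thesis using that by (simp add: d_def)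
  qed
  have Mx: "real (M h) * (x h j)^2 = pi^2 * (2 * real j + 1)^2 / 16 * (real (M h) / (real h)^2)" for h j
    by (simp add: x_def power_divide power_mult_distrib)
  \<comment> \<open>Valid as soon as \<open>M h\<close> exceeds half of its asymptotic size, which
    holds eventually; this is enough for domination.\<close>
  have d_le: "\<bar>d h j\<bar> \<le> exp (- (pi^2 / (8 * t))) ^ j" if h: "h > 0" "2 * (real h)^2 / t \<le> real (M h)" for h j
  proof (cases "j < h")
    case True
    have "2 / t \<le> real (M h) / (real h)^2" using h t by (simp add: field_simps)
    then have "pi\<^sup>2 * (2 * real j + 1)^2 / 16 * (2 / t) \<le> real (M h) * (x h j)^2"
      unfolding Mx by (intro mult_left_mono) auto
    moreover have "real j * (pi^2 / (8 * t)) \<le> (2 * real j + 1)^2 * (pi^2 / (8 * t))"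
      using t by (intro mult_right_mono) (auto simp: power2_eq_square algebra_simps)
    ultimately have "exp (- (real (M h) * (x h j)^2)) \<le> exp (real j * (- (pi^2 / (8 * t))))"
      by (simp add: mult_ac)
    with d_le_exp[OF True] have "d h j \<le> exp (- (pi^2 / (8 * t))) ^ j"
      unfolding exp_of_nat_mult by linarith
    moreover have "d h j \<ge> 0" by (simp add: d_def power_mult)
    ultimately show ?thesis by simp
  next
    case False
    then show ?thesis by (simp add: d_def)
  qed
  have d_lim: "(\<lambda>h. d h j) \<longlonglongrightarrow> ?g j" for j
  proof -
    have Mx_lim: "(\<lambda>h. real (M h) * (x h j)^2) \<longlonglongrightarrow> pi\<^sup>2 * (2 * real j + 1)^2 / (4 * t)"
    proof -
      have "(\<lambda>h. real (M h) * (x h j)^2) \<longlonglongrightarrow> pi\<^sup>2 * (2 * real j + 1)^2 / 16 * (4 / t)"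
        unfolding Mx by (intro tendsto_mult tendsto_const M_lim)
      then show ?thesis by simp
    qed
    have x0: "(\<lambda>h. x h j) \<longlonglongrightarrow> 0" unfolding x_def by real_asymp
    then have "eventually (\<lambda>h. \<bar>x h j\<bar> < 1) sequentially"
      by (auto simp: tendsto_iff dist_real_def)
    then have ev: "eventually (\<lambda>h. \<bar>x h j\<bar> \<le> 1 \<and> j < h) sequentially"
      using eventually_gt_at_top[of j] by eventually_elim auto
    show ?thesis
    proof (rule tendsto_sandwich)
      show "eventually (\<lambda>h. exp (- (2 * (real (M h) * (x h j)^2) / (2 - (x h j)\<^sup>2))) \<le> d h j) sequentially"
        using ev
      proof eventually_elim
        case (elim h)
        have "exp (- ((x h j)^2 / (2 - (x h j)\<^sup>2))) ^ (2 * M h) \<le> cos (x h j) ^ (2 * M h)"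
          using elim by (intro power_mono cos_ge_exp) auto
        then show ?case using elim by (simp add: d_def mult.assoc flip: exp_of_nat_mult)
      qed
      show "eventually (\<lambda>h. d h j \<le> exp (- (real (M h) * (x h j)^2))) sequentially"
        using ev by eventually_elim (use d_le_exp in auto)
      have "(\<lambda>h. exp (- (2 * (real (M h) * (x h j)^2) / (2 - (x h j)\<^sup>2)))) \<longlonglongrightarrow>
          exp (- (2 * (pi^2 * (2 * real j + 1)^2 / (4 * t)) / (2 - 0\<^sup>2)))"
        by (intro tendsto_intros Mx_lim x0) auto
      then show "(\<lambda>h. exp (- (2 * (real (M h) * (x h j)^2) / (2 - (x h j)\<^sup>2)))) \<longlonglongrightarrow>
          ?g j" by simp
      show "(\<lambda>h. exp (- (real (M h) * (x h j)^2))) \<longlonglongrightarrow> ?g j"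
        by (intro tendsto_exp tendsto_minus Mx_lim)
    qed
  qed
  have D_lim: "(\<lambda>h. \<Sum>j. d h j) \<longlonglongrightarrow> (\<Sum>j. ?g j)"
  proof (rule tannerys_theorem[THEN conjunct2, THEN conjunct2])
    have "filterlim (\<lambda>h. 4 * (real h)^2 / t - 1 - 2 * (real h)^2 / t) at_top sequentially"
      using t by real_asymp
    then have "eventually (\<lambda>h. 4 * (real h)^2 / t - 1 - 2 * (real h)^2 / t \<ge> 0) sequentially"
      unfolding filterlim_at_top by blast
    then have "eventually (\<lambda>h. h > 0 \<and> 2 * (real h)^2 / t \<le> real (M h)) sequentially"
      using eventually_gt_at_top[of 0]
    proof eventually_elim
      case (elim h)
      then show ?case using M_ge[of h] by linarith
    qed
    then show "eventually (\<lambda>(j, h). norm (d h j) \<le> exp (- (pi^2 / (8 * t))) ^ j) (at_top \<times>\<^sub>F sequentially)"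
      unfolding eventually_prod_filter
      by (intro exI[of _ "\<lambda>_. True"] exI[of _ "\<lambda>h. h > 0 \<and> 2 * (real h)^2 / t \<le> real (M h)"])
         (use d_le in auto)
    show "summable (\<lambda>j. exp (- (pi^2 / (8 * t))) ^ j)" using t by (simp add: summable_geometric)
  qed (use d_lim in auto)

  \<comment> \<open>The factor in front of the theta sum. It tends to
    \<open>sqrt (t / pi) / 2\<close>, the reciprocal of the factor in the result.\<close>
  define W where "W h = real h * (real (2 * M h choose M h) / 4 ^ M h)" for h
  have W_lim: "W \<longlonglongrightarrow> 1 / sqrt pi * (1 / sqrt (4 / t))"
  proof -
    have "(\<lambda>h. real (2 * M h choose M h) / 4 ^ M h * sqrt (real (M h)) * (1 / sqrt (real (M h) / (real h)^2)))
      \<longlonglongrightarrow> 1 / sqrt pi * (1 / sqrt (4 / t))"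
      using t by (intro tendsto_mult filterlim_compose[OF central_binomial_limit M_top] tendsto_divide tendsto_const tendsto_real_sqrt M_lim) auto
    moreover have "eventually (\<lambda>h. M h > 0) sequentially"
      by (rule eventually_compose_filterlim[OF eventually_gt_at_top M_top])
    then have "eventually (\<lambda>h. real (2 * M h choose M h) / 4 ^ M h * sqrt (real (M h)) * (1 / sqrt (real (M h) / (real h)^2)) = W h) sequentially"
      by eventually_elim (simp add: W_def real_sqrt_divide)
    ultimately show ?thesis by (rule Lim_transform_eventually)
  qed
  have "eventually (\<lambda>h. W h * (1 + 2 * (\<Sum>k. (-1) ^ Suc k * c h k)) = (\<Sum>j. d h j)) sequentially"
    using eventually_gt_at_top[of 0]
  proof eventually_elim
    case (elim h)
    have "(\<Sum>j. d h j) = (\<Sum>j<h. cos (x h j) ^ (2 * M h))"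
      by (subst suminf_finite[of "{..<h}"]) (auto simp: d_def)
    also have "\<dots> = W h * (1 + 2 * (\<Sum>k=1..M h. (-1) ^ k * (real (2 * M h choose (M h + 2 * h * k)) / real (2 * M h choose M h))))"
      unfolding x_def W_def by (rule cos_power_sum[OF elim])
    also have "(\<Sum>k=1..M h. (-1) ^ k * (real (2 * M h choose (M h + 2 * h * k)) / real (2 * M h choose M h)))
      = (\<Sum>k<M h. (-1) ^ Suc k * c h k)"
      unfolding c_def by (rule sum.reindex_bij_witness[of _ Suc "\<lambda>k. k - 1"]) auto
    also have "\<dots> = (\<Sum>k. (-1) ^ Suc k * c h k)"
    proof (rule suminf_finite[symmetric])
      fix k assume "k \<notin> {..<M h}"
      then have "M h < Suc k" by simp
      also have "1 * Suc k \<le> 2 * h * Suc k" using elim by (intro mult_le_mono1) simp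
      then have "Suc k \<le> 2 * h * Suc k" by (simp only: mult_1)
      finally have "2 * M h choose (M h + 2 * h * Suc k) = 0" by (intro binomial_eq_0) linarith
      then show "(-1) ^ Suc k * c h k = 0" by (simp add: c_def)
    qed simp
    finally show ?case by simp
  qed
  from Lim_transform_eventually[OF tendsto_mult[OF W_lim S_lim] this]
  have "1 / sqrt pi * (1 / sqrt (4 / t)) * theta4 (exp (- t)) = (\<Sum>j. ?g j)"
    using D_lim by (rule LIMSEQ_unique)
  then show ?thesis using t by (simp add: real_sqrt_divide field_simps)
qed

section \<open>The dual series and analytic continuation of the inversion formula\<close>

text \<open>Jacobi's \<open>theta_2\<close> without its leading factor, by
  \<open>(2 * k + 1)^2 = 1 + 8 * (k * (k + 1) div 2)\<close>. With integer exponents it is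
  holomorphic in the disc and close to 1 near 0.\<close>

definition tri :: "'a \<Rightarrow> 'a::{real_normed_field,banach}" where
  "tri x = (\<Sum>k. x ^ (k * (k + 1) div 2))"

lemma le_triangle: "k \<le> k * (k + 1) div (2 :: nat)"
proof -
  have "2 * k \<le> k * (k + 1)" by (cases k) auto
  then have "2 * k div 2 \<le> k * (k + 1) div 2" by (rule div_le_mono)
  then show ?thesis by simp
qed

lemma norm_power_triangle_le:
  assumes "norm (x :: 'a::real_normed_field) \<le> 1"
  shows "norm (x ^ (k * (k + 1) div 2)) \<le> norm x ^ k"
  unfolding norm_power using assms by (intro power_decreasing le_triangle) auto

lemma summable_tri:
  assumes "norm (x :: 'a::{real_normed_field,banach}) < 1"
  shows "summable (\<lambda>k. x ^ (k * (k + 1) div 2))"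
  by (rule summable_comparison_test'[OF summable_geometric[of "norm x"] norm_power_triangle_le])
    (use assms in auto)

lemma tri_of_real:
  assumes "\<bar>r\<bar> < 1"
  shows "tri (of_real r :: 'a::{real_normed_field,banach}) = of_real (tri r)"
  unfolding tri_def of_real_power[symmetric]
  using summable_tri[of r] assms by (intro suminf_of_real[symmetric]) auto

lemma tri_ge_1:
  assumes "0 \<le> r" "r < (1::real)"
  shows "tri r \<ge> 1"
  unfolding tri_def using assms sum_le_suminf[OF summable_tri[of r], of "{0}"] by simp

lemma tri_minus_1_le:
  assumes "norm (x :: 'a::{real_normed_field,banach}) \<le> 1 / 2"
  shows "norm (tri x - 1) \<le> 2 * norm x"
proof -
  let ?f = "\<lambda>k. x ^ (k * (k + 1) div 2)"
  have s: "summable ?f" using assms by (intro summable_tri) auto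
  have "tri x - 1 = (\<Sum>k. ?f (Suc k))"
    using suminf_split_head[OF s] by (simp add: tri_def)
  also have "norm \<dots> \<le> (\<Sum>k. norm x * norm x ^ k)"
  proof (rule norm_suminf_le)
    show "summable (\<lambda>k. norm x * norm x ^ k)"
      using assms by (intro summable_mult summable_geometric) auto
    show "norm (?f (Suc k)) \<le> norm x * norm x ^ k" for k
      using norm_power_triangle_le[of x "Suc k"] assms by simp
  qed
  also have "\<dots> = norm x * (1 / (1 - norm x))"
    using assms by (subst suminf_mult) (auto simp: summable_geometric suminf_geometric)
  also have "\<dots> \<le> norm x * 2"
    using assms by (intro mult_left_mono) (auto simp: divide_simps)
  finally show ?thesis by simp
qed

lemma holomorphic_lacunary_series:
  fixes a :: "nat \<Rightarrow> complex" and e :: "nat \<Rightarrow> nat"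
  assumes a: "\<And>k. norm (a k) \<le> 1" and e: "\<And>k. k \<le> e k"
  shows "(\<lambda>z. \<Sum>k. a k * z ^ e k) holomorphic_on ball 0 1"
proof (rule holomorphic_uniform_sequence)
  show "open (ball (0::complex) 1)" by simp
  show "(\<lambda>z. \<Sum>k<n. a k * z ^ e k) holomorphic_on ball 0 1" for n
    by (intro holomorphic_intros)
  fix z :: complex assume z: "z \<in> ball 0 1"
  define d where "d = (1 - norm z) / 2"
  have d: "d > 0" "norm z + d < 1" using z by (auto simp: d_def field_simps)
  have sub: "norm w \<le> norm z + d" if "w \<in> cball z d" for w
    using norm_triangle_ineq2[of w z] that by (simp add: dist_norm norm_minus_commute)
  have "uniform_limit (cball z d) (\<lambda>n z. \<Sum>k<n. a k * z ^ e k) (\<lambda>z. \<Sum>k. a k * z ^ e k) sequentially"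
  proof (rule Weierstrass_m_test)
    show "summable (\<lambda>k. (norm z + d) ^ k)" using d by (intro summable_geometric) (auto intro: add_nonneg_pos)
    fix k w assume w: "w \<in> cball z d"
    have "norm (a k * w ^ e k) \<le> 1 * norm w ^ e k"
      unfolding norm_mult norm_power by (intro mult_right_mono a) auto
    also have "\<dots> \<le> (norm z + d) ^ e k" using sub[OF w] by (auto intro: power_mono)
    also have "\<dots> \<le> (norm z + d) ^ k" using e[of k] d by (intro power_decreasing) auto
    finally show "norm (a k * w ^ e k) \<le> (norm z + d) ^ k" .
  qed
  moreover have "cball z d \<subseteq> ball 0 1" using sub d by (fastforce simp: dist_norm)
  ultimately show "\<exists>d>0. cball z d \<subseteq> ball 0 1 \<and>
      uniform_limit (cball z d) (\<lambda>n z. \<Sum>k<n. a k * z ^ e k) (\<lambda>z. \<Sum>k. a k * z ^ e k) sequentially"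
    using d by blast
qed

lemma holomorphic_tri: "(tri :: complex \<Rightarrow> complex) holomorphic_on ball 0 1"
proof -
  have "(\<lambda>z :: complex. \<Sum>k. 1 * z ^ (k * (k + 1) div 2)) holomorphic_on ball 0 1"
    by (intro holomorphic_lacunary_series le_triangle) simp
  then show ?thesis by (simp only: tri_def[abs_def] mult_1)
qed

lemma holomorphic_theta4: "(theta4 :: complex \<Rightarrow> complex) holomorphic_on ball 0 1"
proof -
  have "k \<le> (Suc k)^2" for k by (simp add: power2_eq_square)
  then have "(\<lambda>q :: complex. \<Sum>j. (-1) ^ Suc j * q ^ (Suc j)^2) holomorphic_on ball 0 1"
    by (intro holomorphic_lacunary_series) (simp_all add: norm_power)
  then show ?thesis unfolding theta4_def[abs_def] by (intro holomorphic_intros)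
qed

lemma holomorphic_on_compose_unit_disc:
  assumes "F holomorphic_on ball 0 1" "f holomorphic_on A" "\<And>z. z \<in> A \<Longrightarrow> norm (f z) < 1"
  shows "(\<lambda>z. F (f z)) holomorphic_on A"
  using holomorphic_on_compose_gen[OF assms(2,1)] assms(3) by (auto simp: o_def image_subset_iff)

lemma theta4_inversion_real':
  assumes t: "t > (0::real)"
  shows "theta4 (exp (- t)) = 2 * sqrt (pi / t) * exp (- (pi^2 / (4 * t))) * tri (exp (- (2 * pi^2 / t)))"
proof -
  let ?x = "exp (- (2 * pi^2 / t))"
  have "exp (- (pi^2 * (2 * real j + 1)^2 / (4 * t))) = exp (- (pi^2 / (4 * t))) * ?x ^ (j * (j + 1) div 2)" for j
  proof -
    have "real (j * (j + 1) div 2) = real (j * (j + 1)) / real 2" by (rule real_of_nat_div) simp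
    then have "- (pi^2 * (2 * real j + 1)^2 / (4 * t)) = - (pi^2 / (4 * t)) + real (j * (j + 1) div 2) * (- (2 * pi^2 / t))"
      using t by (simp only:) (simp add: field_simps power2_eq_square)
    then show ?thesis by (simp only: exp_add exp_of_nat_mult)
  qed
  moreover have "summable (\<lambda>j. ?x ^ (j * (j + 1) div 2))" using t by (intro summable_tri) simp
  ultimately show ?thesis
    using theta4_inversion_real[OF t] by (simp add: tri_def suminf_mult mult.assoc)
qed

lemma theta4_exp_pos: "t > 0 \<Longrightarrow> theta4 (exp (- t) :: real) > 0"
  using tri_ge_1[of "exp (- (2 * pi^2 / t))"] by (simp add: theta4_inversion_real')

text \<open>The two square roots merge into \<open>pi / (sqrt 2 * r)\<close>, which is rational in
  \<open>r\<close>, and \<open>1/4 + 1/8 = 3/8\<close> is the constant of the exponent.\<close>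

lemma theta4_product_inversion_real:
  assumes r: "r > (0::real)"
  shows "theta4 (exp (- r)) * theta4 (exp (- (2 * r))) =
    2 * sqrt 2 * pi / r * exp (- (3 * pi^2 / 8 / r)) * (tri (exp (- (2 * pi^2 / r))) * tri (exp (- (pi^2 / r))))"
proof -
  have "sqrt (pi / r) * sqrt (pi / (2 * r)) = pi / (sqrt 2 * r)"
    using r by (simp add: real_sqrt_divide real_sqrt_mult field_simps)
  moreover have "4 * (pi / (sqrt 2 * r)) = 2 * sqrt 2 * pi / r"
    using r by (simp add: field_simps)
  moreover have "exp (- (pi^2 / (4 * r))) * exp (- (pi^2 / (4 * (2 * r)))) = exp (- (3 * pi^2 / 8 / r))"
    using r by (simp add: field_simps flip: exp_add)
  moreover have "theta4 (exp (- r)) * theta4 (exp (- (2 * r))) =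
    4 * (sqrt (pi / r) * sqrt (pi / (2 * r))) * (exp (- (pi^2 / (4 * r))) * exp (- (pi^2 / (4 * (2 * r))))) *
    (tri (exp (- (2 * pi^2 / r))) * tri (exp (- (pi^2 / r))))"
    using theta4_inversion_real'[of r] theta4_inversion_real'[of "2 * r"] r by (simp add: mult_ac)
  ultimately show ?thesis by (simp only:)
qed

text \<open>Taking the product of the two theta values that occur in the generating function avoids a choice
  of branch for the square root.\<close>

theorem theta4_product_inversion:
  assumes t: "Re t > 0"
  shows "theta4 (exp (- t)) * theta4 (exp (- (2 * t))) =
    of_real (2 * sqrt 2 * pi) / t * exp (- (of_real (3 * pi^2 / 8) / t)) *
      (tri (exp (- (of_real (2 * pi^2) / t))) * tri (exp (- (of_real (pi^2) / t))))"
proof -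
  define S where "S = {z :: complex. Re z > 0}"
  define f where "f t = theta4 (exp (- t)) * theta4 (exp (- (2 * t))) -
    of_real (2 * sqrt 2 * pi) / t * exp (- (of_real (3 * pi^2 / 8) / t)) *
      (tri (exp (- (of_real (2 * pi^2) / t))) * tri (exp (- (of_real (pi^2) / t))))" for t :: complex
  have nz: "z \<noteq> 0" if "z \<in> S" for z using that by (auto simp: S_def)
  have Re_div: "Re (of_real c / z) > 0" if "z \<in> S" "c > 0" for z c
    using that nz[OF that(1)] by (auto simp: S_def Re_divide sum_power2_gt_zero_iff complex_eq_iff intro!: divide_pos_pos)
  have "f holomorphic_on S"
  proof -
    have 1: "(\<lambda>t. theta4 (exp (- t))) holomorphic_on S" "(\<lambda>t. theta4 (exp (- (2 * t)))) holomorphic_on S"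
      by (auto intro!: holomorphic_on_compose_unit_disc[OF holomorphic_theta4] holomorphic_intros simp: S_def)
    have 2: "(\<lambda>t. tri (exp (- (of_real c / t)))) holomorphic_on S" if "c > 0" for c
      using Re_div[OF _ that] nz
      by (auto intro!: holomorphic_on_compose_unit_disc[OF holomorphic_tri] holomorphic_intros)
    show ?thesis unfolding f_def[abs_def]
      by (intro holomorphic_intros 1 2) (use nz in auto)
  qed
  moreover have "open S" unfolding S_def by (rule open_halfspace_Re_gt)
  moreover have "connected S" unfolding S_def by (intro convex_connected convex_halfspace_Re_gt)
  moreover have "complex_of_real ` {0<..} \<subseteq> S" "1 \<in> S" by (auto simp: S_def)
  \<comment> \<open>The identity theorem needs an accumulation point of the set of agreement, the
    positive reals; 1 is taken.\<close>
  moreover have "(1::complex) islimpt complex_of_real ` {0<..}"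
    unfolding islimpt_approachable
  proof (intro allI impI)
    fix e :: real assume e: "e > 0"
    have "complex_of_real (1 + e / 2) \<noteq> 1" using e by (simp only: of_real_eq_1_iff)
    moreover have "dist (complex_of_real (1 + e / 2)) 1 < e"
      using e by (simp add: dist_norm norm_divide)
    moreover have "complex_of_real (1 + e / 2) \<in> complex_of_real ` {0<..}" using e by (intro imageI) auto
    ultimately show "\<exists>x'\<in>complex_of_real ` {0<..}. x' \<noteq> 1 \<and> dist x' 1 < e" by blast
  qed
  moreover have "f z = 0" if z: "z \<in> complex_of_real ` {0<..}" for z
  proof -
    obtain r where r: "r > 0" "z = of_real r" using z by auto
    have th: "theta4 (exp (- z)) = of_real (theta4 (exp (- r)))" "theta4 (exp (- (2 * z))) = of_real (theta4 (exp (- (2 * r))))"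
      using theta4_of_real[of "exp (- r)", where 'a = complex] theta4_of_real[of "exp (- (2 * r))", where 'a = complex] r
      by (simp_all flip: exp_of_real)
    have tr: "tri (exp (- (of_real c / z))) = of_real (tri (exp (- (c / r))))" if "c > 0" for c
      using tri_of_real[of "exp (- (c / r))", where 'a = complex] r that by (simp flip: exp_of_real)
    have "theta4 (exp (- r)) * theta4 (exp (- (2 * r))) =
      2 * sqrt 2 * pi / r * exp (- (3 * pi^2 / 8 / r)) * (tri (exp (- (2 * pi^2 / r))) * tri (exp (- (pi^2 / r))))"
      by (rule theta4_product_inversion_real[OF r(1)])
    then have "complex_of_real (theta4 (exp (- r)) * theta4 (exp (- (2 * r)))) =
      complex_of_real (2 * sqrt 2 * pi / r * exp (- (3 * pi^2 / 8 / r)) * (tri (exp (- (2 * pi^2 / r))) * tri (exp (- (pi^2 / r)))))"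
      by (simp only:)
    also have "\<dots> = of_real (2 * sqrt 2 * pi) / z * exp (- (of_real (3 * pi^2 / 8) / z)) *
      (tri (exp (- (of_real (2 * pi^2) / z))) * tri (exp (- (of_real (pi^2) / z))))"
    proof -
      have "exp (- (of_real (3 * pi^2 / 8) / z)) = complex_of_real (exp (- (3 * pi^2 / 8 / r)))"
        unfolding r(2) exp_of_real[symmetric] by simp
      then show ?thesis using tr[of "2 * pi^2"] tr[of "pi\<^sup>2"] by (simp add: r(2))
    qed
    finally show ?thesis unfolding f_def th by (simp only: of_real_mult[symmetric] diff_self)
  qed
  ultimately have "f t = 0" if "t \<in> S" for t
    using analytic_continuation[of f S "complex_of_real ` {0<..}" 1 t] that by blast
  then show ?thesis using t by (simp add: f_def S_def)
qed

section \<open>Cauchy's formula for the coefficients\<close>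

text \<open>The new factor is \<open>1 + O(X^(N + 1))\<close>: each constituent, the inverses
  included, has the form \<open>1 + x * h\<close>, and this form is stable under products.\<close>

lemma cubic_overpartition_fps_nth_Suc:
  assumes "n \<le> N"
  shows "fps_nth (cubic_overpartition_fps (Suc N)) n = fps_nth (cubic_overpartition_fps N) n"
proof -
  define x :: "rat fps" where "x = fps_X ^ Suc N"
  define u w where "u = inverse (1 - x)" and "w = inverse (1 - x * x)"
  have x2: "fps_X ^ (2 * Suc N) = x * x" by (simp add: x_def mult_2 power_add)
  have "fps_nth x 0 = 0" by (simp add: x_def)
  then have "u * (1 - x) = 1" "w * (1 - x * x) = 1"
    unfolding u_def w_def by (auto intro!: inverse_mult_eq_1)
  then have u: "u = 1 + x * u" and w: "w = 1 + x * (x * w)"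
    by (simp_all add: algebra_simps)
  have "\<exists>h. (1 + x) * (1 + x * x) * u * w = 1 + x * h"
  proof -
    have "(1 + x) * (1 + x * x) * u * w = (1 + x) * (1 + x * x) * (1 + x * u) * (1 + x * (x * w))"
      using u w by (simp only: flip: u w)
    also have "\<exists>h. \<dots> = 1 + x * h"
    proof -
      define e where "e a = (\<exists>h. a = 1 + x * h)" for a
      have "e (a * b)" if "e a" "e b" for a b
      proof -
        obtain h k where "a = 1 + x * h" "b = 1 + x * k" using \<open>e a\<close> \<open>e b\<close> by (auto simp: e_def)
        then have "a * b = 1 + x * (h + k + h * x * k)" by (simp add: algebra_simps)
        then show ?thesis by (auto simp: e_def)
      qed
      moreover have "e (1 + x)" unfolding e_def by (intro exI[of _ 1]) simp
      moreover have "e (1 + x * a)" for a unfolding e_def by blast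
      ultimately have "e ((1 + x) * (1 + x * x) * (1 + x * u) * (1 + x * (x * w)))" by blast
      then show ?thesis by (simp add: e_def)
    qed
    finally show ?thesis .
  qed
  then obtain h where "(1 + x) * (1 + x * x) * u * w = 1 + x * h" by blast
  moreover have "cubic_overpartition_fps (Suc N) = cubic_overpartition_fps N * ((1 + x) * (1 + x * x) * u * w)"
    unfolding cubic_overpartition_fps_def u_def w_def x2[symmetric] unfolding x_def
    by (subst prod.nat_ivl_Suc') (simp, rule mult.commute)
  ultimately have "cubic_overpartition_fps (Suc N) = cubic_overpartition_fps N + x * (cubic_overpartition_fps N * h)"
    by (simp add: algebra_simps)
  then have "cubic_overpartition_fps (Suc N) = cubic_overpartition_fps N + fps_X ^ Suc N * (cubic_overpartition_fps N * h)"
    by (simp only: x_def)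
  then show ?thesis using assms by (simp add: fps_X_power_mult_nth del: power_Suc)
qed

lemma cubic_overpartition_eq:
  assumes "n \<le> N"
  shows "cubic_overpartition n = of_rat (fps_nth (cubic_overpartition_fps N) n)"
proof -
  have "fps_nth (cubic_overpartition_fps N) n = fps_nth (cubic_overpartition_fps n) n"
    using assms by (induction rule: dec_induct) (simp_all add: cubic_overpartition_fps_nth_Suc)
  then show ?thesis by (simp add: cubic_overpartition_def)
qed

definition complex_fps :: "rat fps \<Rightarrow> complex fps" where
  "complex_fps f = Abs_fps (\<lambda>n. of_rat (fps_nth f n))"

lemma complex_fps_nth [simp]: "fps_nth (complex_fps f) n = of_rat (fps_nth f n)"
  by (simp add: complex_fps_def)

lemma complex_fps_1: "complex_fps 1 = 1"
  and complex_fps_X: "complex_fps fps_X = fps_X"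
  and complex_fps_add: "complex_fps (f + g) = complex_fps f + complex_fps g"
  and complex_fps_diff: "complex_fps (f - g) = complex_fps f - complex_fps g"
  and complex_fps_mult: "complex_fps (f * g) = complex_fps f * complex_fps g"
  by (auto simp: fps_eq_iff of_rat_add of_rat_diff fps_mult_nth of_rat_sum of_rat_mult fps_X_def)

lemma complex_fps_power: "complex_fps (f ^ n) = complex_fps f ^ n"
  by (induction n) (simp_all add: complex_fps_1 complex_fps_mult)

lemma complex_fps_prod: "complex_fps (\<Prod>i\<in>A. f i) = (\<Prod>i\<in>A. complex_fps (f i))"
  by (induction A rule: infinite_finite_induct) (simp_all add: complex_fps_1 complex_fps_mult)

lemma complex_fps_inverse:
  assumes "fps_nth f 0 \<noteq> 0"
  shows "complex_fps (inverse f) = inverse (complex_fps f)"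
proof (rule fps_inverse_unique[symmetric])
  have "complex_fps f * complex_fps (inverse f) = complex_fps (inverse f * f)"
    by (simp add: complex_fps_mult mult.commute)
  then show "complex_fps f * complex_fps (inverse f) = 1"
    using assms by (simp add: inverse_mult_eq_1 complex_fps_1)
qed

lemma of_real_of_rat: "of_real (of_rat x) = (of_rat x :: complex)"
  by (cases x rule: Rat_cases) (simp add: of_rat_rat)

text \<open>Holomorphic in the unit disc for every \<open>N\<close>. The infinite product appears
  only as a limit under the integral, so no power series of it has to be identified.\<close>

definition cubic_overp :: "nat \<Rightarrow> complex \<Rightarrow> complex" where
  "cubic_overp N z = inverse (overp z N) * inverse (overp (z^2) N)"

lemma cubic_overp_has_fps_expansion:
  "cubic_overp N has_fps_expansion complex_fps (cubic_overpartition_fps N)"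
proof -
  have eq: "cubic_overp N = (\<lambda>z. \<Prod>j\<in>{1..N}. (1 + z ^ j) * (1 + z ^ (2 * j)) * inverse (1 - z ^ j) * inverse (1 - z ^ (2 * j)))"
  proof
    fix z
    have "overp w N = (\<Prod>j\<in>{1..N}. (1 - w ^ j) / (1 + w ^ j))" for w :: complex
      unfolding overp_def by (rule prod.reindex_bij_witness[of _ "\<lambda>j. j - 1" Suc]) auto
    then show "cubic_overp N z = (\<Prod>j\<in>{1..N}. (1 + z ^ j) * (1 + z ^ (2 * j)) * inverse (1 - z ^ j) * inverse (1 - z ^ (2 * j)))"
      by (simp add: cubic_overp_def prod_inversef[symmetric] prod.distrib[symmetric] power_mult[symmetric]
            divide_inverse mult_ac)
  qed
  have "complex_fps (cubic_overpartition_fps N) =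
    (\<Prod>j\<in>{1..N}. (1 + fps_X ^ j) * (1 + fps_X ^ (2 * j)) * inverse (1 - fps_X ^ j) * inverse (1 - fps_X ^ (2 * j)))"
    unfolding cubic_overpartition_fps_def complex_fps_prod
    by (intro prod.cong refl)
       (simp add: complex_fps_mult complex_fps_add complex_fps_diff complex_fps_power complex_fps_X complex_fps_1 complex_fps_inverse fps_X_power_nth)
  moreover have "(\<lambda>z. \<Prod>j\<in>{1..N}. (1 + z ^ j) * (1 + z ^ (2 * j)) * inverse (1 - z ^ j) * inverse (1 - z ^ (2 * j)))
     has_fps_expansion (\<Prod>j\<in>{1..N}. (1 + fps_X ^ j) * (1 + fps_X ^ (2 * j)) * inverse (1 - fps_X ^ j) * inverse (1 - fps_X ^ (2 * j)) :: complex fps)"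
    by (intro has_fps_expansion_prod has_fps_expansion_mult has_fps_expansion_add has_fps_expansion_diff has_fps_expansion_1
         has_fps_expansion_inverse has_fps_expansion_fps_X_power) (auto simp: fps_X_power_nth)
  ultimately show ?thesis unfolding eq by simp
qed

lemma cubic_overp_holomorphic: "cubic_overp N holomorphic_on ball 0 1"
proof -
  have "norm (z^2) < 1" if "norm z < 1" for z :: complex using that by (simp add: norm_power power_less_one_iff)
  then show ?thesis
    unfolding cubic_overp_def[abs_def] overp_def
    by (intro holomorphic_intros) 
      (auto simp del: power_Suc simp flip: overp_def intro!: overp_nonzero elim!: notE[OF power_neq_1(2), rotated])
qed

lemma cubic_overpartition_contour_integral:
  assumes r: "0 < r" "r < 1" and n: "n \<le> N"
  shows "contour_integral (circlepath 0 r) (\<lambda>z. cubic_overp N z / z ^ Suc n) = 2 * pi * \<i> * of_real (cubic_overpartition n)"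
proof -
  have sub: "cball (0::complex) r \<subseteq> ball 0 1" using r by auto
  have "contour_integral (circlepath 0 r) (\<lambda>z. cubic_overp N z / (z - 0) ^ Suc n) =
      2 * pi * \<i> * (deriv ^^ n) (cubic_overp N) 0 / fact n"
  proof (rule Cauchy_contour_integral_circlepath)
    show "continuous_on (cball 0 r) (cubic_overp N)"
      using cubic_overp_holomorphic sub by (blast intro: holomorphic_on_imp_continuous_on holomorphic_on_subset)
    show "cubic_overp N holomorphic_on ball 0 r"
      using cubic_overp_holomorphic r by (rule_tac holomorphic_on_subset) auto
  qed (use r in auto)
  moreover have "fps_nth (complex_fps (cubic_overpartition_fps N)) n = (deriv ^^ n) (cubic_overp N) 0 / fact n"
    by (rule fps_nth_fps_expansion[OF cubic_overp_has_fps_expansion])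
  moreover have "fps_nth (complex_fps (cubic_overpartition_fps N)) n = of_real (cubic_overpartition n)"
    by (simp add: cubic_overpartition_eq[OF n] of_real_of_rat)
  ultimately show ?thesis by (simp add: times_divide_eq_right[symmetric] del: times_divide_eq_right)
qed

text \<open>Circle paths run over \<open>{0..2 * pi}\<close>, whereas the dominant point has angle 0
  and should be interior to the interval.\<close>

lemma integral_period_shift:
  fixes f :: "real \<Rightarrow> complex"
  assumes "continuous_on UNIV f" "\<And>x. f (x + 2 * pi) = f x"
  shows "integral {0..2 * pi} f = integral {- pi..pi} f"
proof -
  have i: "f integrable_on {a..b}" for a b
    using assms(1) by (intro integrable_continuous_real) (auto intro: continuous_on_subset)
  have "integral {pi..2 * pi} f = integral {- pi + 2 * pi..0 + 2 * pi} f" by simp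
  also have "\<dots> = integral {- pi..0} (f \<circ> (+) (2 * pi))"
    by (rule integral_shift_Icc_real[symmetric])
  also have "f \<circ> (+) (2 * pi) = f" using assms(2) by (auto simp: add.commute)
  finally have "integral {pi..2 * pi} f = integral {- pi..0} f" .
  moreover have "integral {0..pi} f + integral {pi..2 * pi} f = integral {0..2 * pi} f"
    by (rule Henstock_Kurzweil_Integration.integral_combine) (auto intro: i)
  moreover have "integral {- pi..0} f + integral {0..pi} f = integral {- pi..pi} f"
    by (rule Henstock_Kurzweil_Integration.integral_combine) (auto intro: i)
  ultimately show ?thesis by (simp add: add.commute)
qed

definition circle_integrand :: "nat \<Rightarrow> complex \<Rightarrow> complex" where
  "circle_integrand n t = inverse (theta4 (exp (- t)) * theta4 (exp (- (2 * t)))) * exp (of_nat n * t)"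

text \<open>Cauchy's formula for the truncated products, followed by the limit \<open>N \<rightarrow> \<infinity>\<close> under the integral.\<close>

theorem cubic_overpartition_integral:
  fixes \<alpha> :: real
  assumes \<alpha>: "\<alpha> > 0" and pos: "\<And>t. t > 0 \<Longrightarrow> theta4 (exp (- t) :: real) > 0"
  shows "((\<lambda>\<theta>. circle_integrand n (Complex \<alpha> \<theta>)) has_integral 2 * pi * of_real (cubic_overpartition n)) {- pi..pi}"
proof -
  define z where "z \<theta> = exp (- Complex \<alpha> \<theta>)" for \<theta>
  define r where "r = exp (- \<alpha>)"
  have r: "0 < r" "r < 1" using \<alpha> by (simp_all add: r_def)
  have nz: "norm (z \<theta>) = r" for \<theta> by (simp add: z_def r_def)
  have z1: "norm (z \<theta>) < 1" "z \<theta> \<noteq> 0" "norm ((z \<theta>)^2) < 1" "(z \<theta>)^2 \<noteq> 0" for \<theta>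
    using r nz[of \<theta>] by (auto simp: norm_power power_less_one_iff z_def)
  have zpow: "inverse (z \<theta> ^ n) = exp (of_nat n * Complex \<alpha> \<theta>)" for \<theta>
    by (simp add: z_def exp_minus exp_of_nat_mult power_inverse)
  have z2: "exp (- (2 * Complex \<alpha> \<theta>)) = (z \<theta>)^2" for \<theta>
    by (simp add: z_def flip: exp_double)
  have zcont: "continuous_on A z" for A
    unfolding z_def Complex_eq by (intro continuous_intros)
  define F where "F N \<theta> = cubic_overp N (z \<theta>) * inverse (z \<theta> ^ n)" for N \<theta>
  have Fcont: "continuous_on A (F N)" for A N
  proof -
    have "continuous_on A (\<lambda>\<theta>. cubic_overp N (z \<theta>))"
      by (rule continuous_on_compose2[OF holomorphic_on_imp_continuous_on[OF cubic_overp_holomorphic] zcont])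
         (use z1 in auto)
    then show ?thesis unfolding F_def using z1 by (intro continuous_intros zcont) auto
  qed
  have Fint: "(F N has_integral 2 * pi * of_real (cubic_overpartition n)) {- pi..pi}" if N: "n \<le> N" for N
  proof -
    \<comment> \<open>The orientation of the circle is opposite to that of \<open>z\<close>; the
      reflection of \<open>{- pi..pi}\<close> below undoes it.\<close>
    have zcis: "of_real r * cis \<phi> = z (- \<phi>)" for \<phi>
      by (simp add: z_def r_def cis_conv_exp exp_of_real[symmetric] Complex_eq flip: exp_add)
    have "contour_integral (part_circlepath 0 r 0 (2 * pi)) (\<lambda>z. cubic_overp N z / z ^ Suc n)
      = integral {0..2 * pi} (\<lambda>\<phi>. cubic_overp N (0 + r * cis \<phi>) / (0 + r * cis \<phi>) ^ Suc n * r * \<i> * cis \<phi>)"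
      by (rule contour_integral_part_circlepath_eq) auto
    also have "(\<lambda>\<phi>. cubic_overp N (0 + r * cis \<phi>) / (0 + r * cis \<phi>) ^ Suc n * r * \<i> * cis \<phi>) = (\<lambda>\<phi>. \<i> * F N (- \<phi>))"
    proof
      fix \<phi>
      have "cubic_overp N (0 + r * cis \<phi>) / (0 + r * cis \<phi>) ^ Suc n * r * \<i> * cis \<phi>
        = \<i> * (cubic_overp N (r * cis \<phi>) * inverse ((r * cis \<phi>) ^ n))"
        using r by (simp add: divide_simps)
      then show "cubic_overp N (0 + r * cis \<phi>) / (0 + r * cis \<phi>) ^ Suc n * r * \<i> * cis \<phi> = \<i> * F N (- \<phi>)"
        unfolding zcis F_def .
    qed
    also have "integral {0..2 * pi} (\<lambda>\<phi>. \<i> * F N (- \<phi>)) = \<i> * integral {0..2 * pi} (\<lambda>\<phi>. F N (- \<phi>))"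
      by simp
    also have "integral {0..2 * pi} (\<lambda>\<phi>. F N (- \<phi>)) = integral {- pi..pi} (\<lambda>\<phi>. F N (- \<phi>))"
    proof (rule integral_period_shift)
      show "continuous_on UNIV (\<lambda>\<phi>. F N (- \<phi>))"
        by (rule continuous_on_compose2[OF Fcont[of UNIV]]) (auto intro!: continuous_intros)
      have "z (- (\<phi> + 2 * pi)) = z (- \<phi>)" for \<phi>
        unfolding zcis[symmetric] by (simp add: complex_eq_iff)
      then show "F N (- (\<phi> + 2 * pi)) = F N (- \<phi>)" for \<phi> by (simp add: F_def)
    qed
    also have "\<dots> = integral {- pi..pi} (F N)"
      using Henstock_Kurzweil_Integration.integral_reflect_real[of pi "- pi" "F N"] by simp
    finally have "integral {- pi..pi} (F N) = 2 * pi * of_real (cubic_overpartition n)"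
      using cubic_overpartition_contour_integral[OF r N] by (simp add: circlepath_def)
    moreover have "F N integrable_on {- pi..pi}" by (intro integrable_continuous_real Fcont)
    ultimately show ?thesis by (simp add: has_integral_integrable_integral)
  qed
  have r2: "r\<^sup>2 = exp (- (2 * \<alpha>))" by (simp add: r_def flip: exp_double)
  have th: "theta4 r > 0" "theta4 (r^2) > 0"
    using pos[of \<alpha>] pos[of "2 * \<alpha>"] \<alpha> by (simp_all add: r_def flip: r2)
  show ?thesis
  proof (rule has_integral_dominated_convergence)
    \<comment> \<open>The even index matches the limit theorem for \<open>overp\<close>; the summand
      \<open>n\<close> ensures that the truncation already has the right \<open>n\<close>-th
      coefficient.\<close>
    show "(F (2 * (N + n)) has_integral 2 * pi * of_real (cubic_overpartition n)) {- pi..pi}" for N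
      by (rule Fint) simp
    show "(\<lambda>_. inverse (theta4 r) * inverse (theta4 (r^2)) * inverse (r ^ n)) integrable_on {- pi..pi}"
      by (rule integrable_const_ivl)
    show "\<forall>\<theta>\<in>{- pi..pi}. norm (F (2 * (N + n)) \<theta>) \<le> inverse (theta4 r) * inverse (theta4 (r^2)) * inverse (r ^ n)" for N
    proof
      fix \<theta> :: real
      have b: "norm (inverse (overp w M)) \<le> inverse (theta4 (norm w))"
        if "norm w < 1" "theta4 (norm w) > 0" "w \<noteq> 0" for w :: complex and M
      proof -
        have "norm (inverse (overp w M)) \<le> inverse (overp (norm w) M)" by (rule overp_norm_inverse_le'[OF that(1)])
        also have "\<dots> \<le> inverse (theta4 (norm w))"
          using that by (intro le_imp_inverse_le theta4_le_overp) auto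
        finally show ?thesis .
      qed
      show "norm (F (2 * (N + n)) \<theta>) \<le> inverse (theta4 r) * inverse (theta4 (r^2)) * inverse (r ^ n)"
        unfolding F_def cubic_overp_def norm_mult
        using b[OF z1(1), of \<theta>] b[OF z1(3), of \<theta>] z1[of \<theta>] th r
        by (intro mult_mono mult_nonneg_nonneg) (auto simp: nz norm_inverse norm_power)
    qed
    show "\<forall>\<theta>\<in>{- pi..pi}. (\<lambda>N. F (2 * (N + n)) \<theta>) \<longlonglongrightarrow> circle_integrand n (Complex \<alpha> \<theta>)"
    proof
      fix \<theta> :: real
      have nzt: "theta4 (z \<theta>) \<noteq> 0" "theta4 ((z \<theta>)^2) \<noteq> 0"
        using norm_theta4_ge[OF z1(1,2), of \<theta>] norm_theta4_ge[OF z1(3,4), of \<theta>] th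
        by (auto simp: nz norm_power)
      have lim: "(\<lambda>N. overp w (2 * (N + n))) \<longlonglongrightarrow> theta4 w" if "norm w < 1" "w \<noteq> 0" for w :: complex
        by (rule LIMSEQ_ignore_initial_segment[OF overp_even_tendsto_theta4[OF that]])
      have "(\<lambda>N. F (2 * (N + n)) \<theta>) \<longlonglongrightarrow> inverse (theta4 (z \<theta>)) * inverse (theta4 ((z \<theta>)^2)) * inverse (z \<theta> ^ n)"
        unfolding F_def cubic_overp_def by (intro tendsto_intros lim z1 nzt)
      then show "(\<lambda>N. F (2 * (N + n)) \<theta>) \<longlonglongrightarrow> circle_integrand n (Complex \<alpha> \<theta>)"
        by (simp add: circle_integrand_def zpow z2 z_def[symmetric])
    qed
  qed simp
qed

section \<open>The circle method\<close>

definition lead :: real where "lead = 1 / (2 * sqrt 2 * pi)"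

definition bessel_integrand :: "nat \<Rightarrow> complex \<Rightarrow> complex" where
  "bessel_integrand n t = t * exp (of_nat n * t + of_real (3 * pi^2 / 8) / t)"

lemma lead_pos: "lead > 0"
  by (simp add: lead_def)

lemma circle_integrand_eq:
  assumes "Re t > 0"
  shows "circle_integrand n t = of_real lead * bessel_integrand n t *
    inverse (tri (exp (- (of_real (2 * pi^2) / t))) * tri (exp (- (of_real (pi^2) / t))))"
proof -
  have t: "t \<noteq> 0" using assms by auto
  define B where "B = of_real (3 * pi^2 / 8) / t"
  have "inverse (of_real (2 * sqrt 2 * pi) / t) = of_real lead * t"
    by (simp add: lead_def field_simps)
  moreover have "inverse (exp (- B)) = exp B" by (simp add: exp_minus)
  moreover have "inverse (a * e * p) * f = L * (t * (f * g)) * inverse p"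
    if "inverse a = L * t" "inverse e = g" for a e p f L g :: complex
    using that by (simp add: mult_ac)
  ultimately show ?thesis
    unfolding circle_integrand_def theta4_product_inversion[OF assms] bessel_integrand_def B_def[symmetric] exp_add
    by blast
qed

lemma Re_of_real_divide: "Re (of_real c / z) = c * Re z / (norm z)^2"
  by (simp add: Re_divide cmod_power2)

text \<open>Applied with \<open>a = tri x\<close> and \<open>b = tri (x^2)\<close>, whose distances
  from 1 are controlled by \<open>norm x\<close>.\<close>

lemma norm_inverse_minus_1_le:
  fixes a b x :: complex
  assumes "norm (a - 1) \<le> 2 * norm x" "norm (b - 1) \<le> norm x" "norm x \<le> 1 / 20"
  shows "norm (inverse (b * a) - 1) \<le> 10 * norm x"
proof -
  have "b * a - 1 = (b - 1) * (a - 1) + (a - 1) + (b - 1)" by (simp add: algebra_simps)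
  also have "norm \<dots> \<le> norm (b - 1) * norm (a - 1) + norm (a - 1) + norm (b - 1)"
    by (intro order_trans[OF norm_triangle_ineq] add_mono) (auto simp: norm_mult)
  also have "\<dots> \<le> 1 * norm (a - 1) + norm (a - 1) + norm (b - 1)"
    using assms by (intro add_mono mult_right_mono) auto
  also have "\<dots> \<le> 5 * norm x" using assms by linarith
  finally have p: "norm (b * a - 1) \<le> 5 * norm x" .
  have "1 \<le> norm (b * a) + norm (b * a - 1)"
    using norm_triangle_ineq4[of "b * a" "b * a - 1"] by simp
  then have q: "norm (b * a) \<ge> 3 / 4" using p assms(3) by linarith
  then have nz: "b * a \<noteq> 0" by auto
  then have "inverse (b * a) - 1 = - (b * a - 1) / (b * a)" by (simp add: field_simps)
  then have "norm (inverse (b * a) - 1) = norm (b * a - 1) / norm (b * a)"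
    by (simp only: norm_divide norm_minus_cancel)
  also have "\<dots> \<le> 5 * norm x / (3 / 4)"
    using p q by (intro frac_le) auto
  also have "\<dots> \<le> 10 * norm x" by simp
  finally show ?thesis .
qed

lemma exp_minus_le_inverse:
  assumes "x > (0 :: real)"
  shows "exp (- x) \<le> 1 / x"
proof -
  have "x \<le> exp x" using exp_ge_add_one_self[of x] by linarith
  then show ?thesis using assms by (simp add: exp_minus divide_simps)
qed

section \<open>Estimates on the arcs around the saddle point\<close>

text \<open>\<open>\<alpha>\<close> minimises
  \<open>n * \<alpha> + 3 * pi^2 / (8 * \<alpha>)\<close>, the exponent of the main integrand on the
  real axis. At the minimum both summands equal \<open>v / 2\<close>.\<close>

locale saddle =
  fixes n :: nat and \<alpha> v :: real
  assumes \<alpha>: "0 < \<alpha>" "\<alpha> \<le> 1 / 25"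
    and n_\<alpha>: "real n * \<alpha>^2 = 3 * pi^2 / 8"
    and v_def: "v = 3 * pi^2 / (4 * \<alpha>)"
begin

lemma v_ge: "v \<ge> 168"
proof -
  have "3 * pi^2 / (4 * (1/25)) \<le> v" unfolding v_def using \<alpha> by (intro divide_left_mono) auto
  moreover have "3^2 \<le> pi^2" using pi_gt3 by (intro power_mono) auto
  ultimately show ?thesis by simp
qed

lemma n_\<alpha>': "real n * \<alpha> = v / 2" "3 * pi^2 / 8 / \<alpha> = v / 2"
proof -
  have "real n * \<alpha> = real n * \<alpha>^2 / \<alpha>" using \<alpha> by (simp add: power2_eq_square)
  then show "real n * \<alpha> = v / 2" unfolding n_\<alpha> by (simp add: v_def)
  show "3 * pi^2 / 8 / \<alpha> = v / 2" by (simp add: v_def)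
qed

lemma norm_le_major:
  assumes "\<bar>\<theta>\<bar> \<le> 2 * \<alpha>"
  shows "\<alpha>\<^sup>2 \<le> (norm (Complex \<alpha> \<theta>))\<^sup>2" "(norm (Complex \<alpha> \<theta>))\<^sup>2 \<le> 5 * \<alpha>^2" "norm (Complex \<alpha> \<theta>) \<le> 9/4 * \<alpha>"
proof -
  have "\<bar>\<theta>\<bar>\<^sup>2 \<le> (2 * \<alpha>)^2" using assms by (intro power_mono) auto
  then show *: "\<alpha>\<^sup>2 \<le> (norm (Complex \<alpha> \<theta>))\<^sup>2" "(norm (Complex \<alpha> \<theta>))\<^sup>2 \<le> 5 * \<alpha>^2"
    by (simp_all add: cmod_power2 power_mult_distrib)
  have "5 * \<alpha>^2 \<le> (9/4 * \<alpha>)^2" by (simp add: power_mult_distrib power_divide)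
  with *(2) have "(norm (Complex \<alpha> \<theta>))\<^sup>2 \<le> (9/4 * \<alpha>)^2" by linarith
  then show "norm (Complex \<alpha> \<theta>) \<le> 9/4 * \<alpha>" by (rule power2_le_imp_le) (use \<alpha> in simp)
qed

text \<open>Here \<open>norm t ^ 2 \<le> 5 * \<alpha>^2\<close>, so \<open>Re (pi^2 / t)\<close> is
  at least \<open>pi^2 / (5 * \<alpha>) = 4 * v / 15\<close> and the arguments of \<open>tri\<close>
  are exponentially small, while the exponent of the main integrand has real part at most
  \<open>v\<close>, its value at the saddle.\<close>

lemma circle_integrand_major:
  assumes \<theta>: "\<bar>\<theta>\<bar> \<le> 2 * \<alpha>"
  shows "norm (circle_integrand n (Complex \<alpha> \<theta>) - of_real lead * bessel_integrand n (Complex \<alpha> \<theta>))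
    \<le> lead * (9/4 * \<alpha> * exp v * (10 * exp (- (4 * v / 15))))"
proof -
  define t where "t = Complex \<alpha> \<theta>"
  define x where "x = exp (- (of_real (pi^2) / t))"
  note nt = norm_le_major[OF \<theta>, folded t_def]
  have Ret: "Re t = \<alpha>" by (simp add: t_def)
  have tpos: "norm t > 0" using \<alpha> by (auto simp: t_def complex_eq_iff)
  have nx: "norm x \<le> exp (- (4 * v / 15))"
  proof -
    have "pi\<^sup>2 * \<alpha> / (5 * \<alpha>^2) \<le> pi^2 * \<alpha> / (norm t)^2"
      using nt tpos \<alpha> by (intro divide_left_mono) auto
    moreover have "pi\<^sup>2 * \<alpha> / (5 * \<alpha>^2) = 4 * v / 15"
      using \<alpha> by (simp add: v_def power2_eq_square field_simps)
    ultimately show ?thesis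
      by (simp add: x_def norm_exp_eq_Re Re_of_real_divide Ret del: of_real_power)
  qed
  have small: "norm x \<le> 1 / 20"
  proof -
    have "exp (- (4 * v / 15)) \<le> 1 / (4 * v / 15)" using v_ge by (intro exp_minus_le_inverse) auto
    also have "\<dots> \<le> 1 / 20" using v_ge by (simp add: divide_simps)
    finally show ?thesis using nx by linarith
  qed
  have x2: "exp (- (of_real (2 * pi^2) / t)) = x^2"
    by (simp add: x_def add_divide_distrib flip: exp_double)
  have "norm (tri x - 1) \<le> 2 * norm x" using small by (intro tri_minus_1_le) auto
  moreover have "norm (tri (x^2) - 1) \<le> norm x"
  proof -
    have x2_le: "norm (x^2) \<le> norm x * (1/20)"
      unfolding power2_eq_square norm_mult using small by (intro mult_left_mono) auto
    then have "norm (tri (x^2) - 1) \<le> 2 * norm (x^2)" using small by (intro tri_minus_1_le) auto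
    with x2_le show ?thesis using norm_ge_zero[of x] by linarith
  qed
  ultimately have inv: "norm (inverse (tri (x^2) * tri x) - 1) \<le> 10 * norm x"
    using small by (rule norm_inverse_minus_1_le)
  have nb: "norm (bessel_integrand n t) \<le> 9/4 * \<alpha> * exp v"
  proof -
    have "3 * pi^2 / 8 * \<alpha> / (norm t)^2 \<le> 3 * pi^2 / 8 * \<alpha> / \<alpha>^2"
      using nt tpos \<alpha> by (intro divide_left_mono) auto
    also have "\<dots> = v / 2" unfolding n_\<alpha>'(2)[symmetric] using \<alpha> by (simp add: power2_eq_square)
    finally have "real n * \<alpha> + 3 * pi^2 / 8 * \<alpha> / (norm t)^2 \<le> v"
      using n_\<alpha>'(1) by linarith
    then have "exp (real n * \<alpha> + 3 * pi^2 / 8 * \<alpha> / (norm t)^2) \<le> exp v"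
      by (simp only: exp_le_cancel_iff)
    then have "norm t * exp (real n * \<alpha> + 3 * pi^2 / 8 * \<alpha> / (norm t)^2) \<le> 9/4 * \<alpha> * exp v"
      using nt(3) \<alpha> by (intro mult_mono) auto
    then show ?thesis
      unfolding bessel_integrand_def norm_mult norm_exp_eq_Re plus_complex.sel Re_of_real_divide
      by (simp add: Ret)
  qed
  have "circle_integrand n t - of_real lead * bessel_integrand n t =
      of_real lead * bessel_integrand n t * (inverse (tri (x^2) * tri x) - 1)"
  proof -
    have "Re t > 0" using \<alpha> by (simp add: Ret)
    from circle_integrand_eq[OF this, of n, unfolded x2, folded x_def] show ?thesis
      by (simp only: right_diff_distrib mult_1_right)
  qed
  also have "norm \<dots> = lead * (norm (bessel_integrand n t) * norm (inverse (tri (x^2) * tri x) - 1))"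
    using lead_pos by (simp add: norm_mult)
  also have "\<dots> \<le> lead * (9/4 * \<alpha> * exp v * (10 * exp (- (4 * v / 15))))"
    using nb inv nx lead_pos \<alpha> by (intro mult_left_mono mult_mono) auto
  finally show ?thesis by (simp only: t_def)
qed

text \<open>From angle \<open>2 * \<alpha>\<close> on, \<open>norm (1 - q) ^ 2\<close> is at least
  \<open>3 * (1 - r)^2\<close>, which cuts \<open>Re (q / (1 - q))\<close> down to a third of
  \<open>r / (1 - r)\<close>. This saving is taken for the factor at \<open>q\<close>; the factor at
  \<open>q^2\<close> is bounded by its value at \<open>r^2\<close>.\<close>

lemma circle_integrand_minor:
  assumes \<theta>: "2 * \<alpha> \<le> \<bar>\<theta>\<bar>" "\<bar>\<theta>\<bar> \<le> pi"
  shows "norm (circle_integrand n (Complex \<alpha> \<theta>)) \<le> lead * \<alpha> * exp (v - v / 6)"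
proof -
  define r where "r = exp (- \<alpha>)"
  define q where "q = exp (- Complex \<alpha> \<theta>)"
  have r: "0 < r" "r < 1" using \<alpha> by (simp_all add: r_def)
  have q_nz: "q \<noteq> 0" by (simp add: q_def)
  have nq: "norm q = r" by (simp add: q_def r_def)
  have q2: "exp (- (2 * Complex \<alpha> \<theta>)) = q^2" by (simp add: q_def flip: exp_double)
  have r2: "exp (- (2 * \<alpha>)) = r^2" by (simp add: r_def flip: exp_double)
  have th: "theta4 r > 0" "theta4 (r^2) > 0"
    using theta4_exp_pos[of \<alpha>] theta4_exp_pos[of "2 * \<alpha>"] \<alpha> by (simp_all add: r_def flip: r2[unfolded r_def])
  have r1: "1 - \<alpha> \<le> r" unfolding r_def using exp_ge_add_one_self[of "- \<alpha>"] by simp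
  have norm_1q: "(norm (1 - q))\<^sup>2 = (1 - r)^2 + 2 * r * (1 - cos \<theta>)"
  proof -
    have "Re q = r * cos \<theta>" "Im q = - (r * sin \<theta>)" by (simp_all add: q_def r_def Re_exp Im_exp)
    then have "(norm (1 - q))\<^sup>2 = (1 - r * cos \<theta>)^2 + (r * sin \<theta>)^2" by (simp add: cmod_power2)
    also have "\<dots> = 1 - 2 * r * cos \<theta> + r^2 * ((cos \<theta>)^2 + (sin \<theta>)^2)"
    proof -
      have "(1 - r * c)^2 + (r * s)^2 = 1 - 2 * r * c + r^2 * (c^2 + s^2)" for c s
        by (simp add: power2_eq_square algebra_simps)
      then show ?thesis .
    qed
    also have "\<dots> = (1 - r)^2 + 2 * r * (1 - cos \<theta>)"
      unfolding sin_cos_squared_add2 by (simp add: power2_eq_square algebra_simps)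
    finally show ?thesis .
  qed
  have "(1 - r)^2 * 3 \<le> (norm (1 - q))\<^sup>2"
  proof -
    have "cos \<bar>\<theta>\<bar> \<le> cos (2 * \<alpha>)" using \<theta> \<alpha> by (intro cos_monotone_0_pi_le) auto
    then have c: "2 * (sin \<alpha>)^2 \<le> 1 - cos \<theta>" by (simp add: cos_double_sin)
    have "\<alpha> * (9/10) \<le> \<alpha> * cos \<alpha>"
    proof (rule mult_left_mono)
      have "\<alpha>\<^sup>2 \<le> 1/10" using \<alpha> power_mono[OF \<alpha>(2), of 2] by (simp add: power_divide)
      then show "9/10 \<le> cos \<alpha>" using one_minus_cos_le[of \<alpha>] by simp
    qed (use \<alpha> in auto)
    also have "\<dots> \<le> sin \<alpha>" using \<alpha> pi_gt3 by (intro mult_cos_le_sin) auto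
    finally have "(\<alpha> * (9/10))\<^sup>2 \<le> (sin \<alpha>)^2" using \<alpha> by (intro power_mono) auto
    moreover have "\<alpha>\<^sup>2 * (8/10) \<le> (\<alpha> * (9/10))\<^sup>2"
      unfolding power_mult_distrib by (intro mult_left_mono) (simp_all add: power_divide)
    ultimately have s: "\<alpha>\<^sup>2 * (8/10) \<le> (sin \<alpha>)^2" by linarith
    have "(1 - r)^2 * 2 \<le> \<alpha>^2 * 2" using r1 r by (intro mult_right_mono power_mono) auto
    also have "\<dots> \<le> 4 * (9/10) * (\<alpha>^2 * (8/10))" by simp
    also have "\<dots> \<le> 4 * r * (sin \<alpha>)^2" using r1 \<alpha> s by (intro mult_mono) auto
    also have "\<dots> = 2 * r * (2 * (sin \<alpha>)^2)" by simp
    also have "\<dots> \<le> 2 * r * (1 - cos \<theta>)" using c r by (intro mult_left_mono) auto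
    finally show ?thesis unfolding norm_1q by simp
  qed
  moreover have "Re (q / (1 - q)) \<le> r * (1 - r) / (norm (1 - q))\<^sup>2"
  proof -
    have "Re (q / (1 - q)) = (Re q - (norm q)\<^sup>2) / (norm (1 - q))\<^sup>2"
      unfolding Re_divide cmod_power2 by (simp add: power2_eq_square algebra_simps)
    also have "\<dots> \<le> (r - r\<^sup>2) / (norm (1 - q))\<^sup>2"
      using complex_Re_le_cmod[of q] by (intro divide_right_mono) (auto simp: nq)
    finally show ?thesis by (simp add: power2_eq_square algebra_simps)
  qed
  moreover have "r * (1 - r) / (norm (1 - q))\<^sup>2 \<le> r * (1 - r) / ((1 - r)^2 * 3)"
    using calculation(1) r by (intro divide_left_mono mult_pos_pos) (auto intro: less_le_trans[OF _ calculation(1)])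
  moreover have "r * (1 - r) / ((1 - r)^2 * 3) = r / (1 - r) / 3"
    using r by (simp add: power2_eq_square)
  ultimately have Re_q: "Re (q / (1 - q)) \<le> r / (1 - r) / 3" by linarith
  have "1 / \<alpha> - 1 \<le> r / (1 - r)"
  proof -
    have "(1 - \<alpha>) / \<alpha> \<le> r / (1 - r)" using r1 r \<alpha> by (intro frac_le) auto
    then show ?thesis using \<alpha> by (simp add: diff_divide_distrib)
  qed
  moreover have "1 / \<alpha> = 4 * v / (3 * pi^2)" using \<alpha> by (simp add: v_def)
  moreover have "4 * v / (3 * pi^2) \<ge> 2 / 15 * v"
  proof -
    have "pi\<^sup>2 \<le> 10" using power_mono[OF pi_approx(2), of 2] by (simp add: power_divide)
    then show ?thesis using v_ge by (simp add: divide_simps)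
  qed
  ultimately have "2 / 15 * v - 1 \<le> r / (1 - r)" by simp
  moreover have "2 * (x - R) \<le> - (v / 6)" if "2 / 15 * v - 1 \<le> R" "x \<le> R / 3" for x R
    using that v_ge by (simp add: field_simps)
  \<comment> \<open>Two thirds of \<open>r / (1 - r)\<close> are gained, twice;
    \<open>4/3 * (2/15 * v - 1)\<close> is at least \<open>v / 6\<close> once \<open>v\<close>
    reaches 120.\<close>
  ultimately have gain: "2 * (Re (q / (1 - q)) - r / (1 - r)) \<le> - (v / 6)"
    using Re_q by blast
  have "norm (inverse (theta4 q)) \<le> inverse (theta4 r) * exp (2 * (Re (q / (1 - q)) - r / (1 - r)))"
    using norm_inverse_theta4_le[of q] r th q_nz by (simp add: nq)
  also have "\<dots> \<le> inverse (theta4 r) * exp (- (v / 6))"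
    using th gain by (intro mult_left_mono) auto
  finally have 1: "norm (inverse (theta4 q)) \<le> inverse (theta4 r) * exp (- (v / 6))" .
  have 2: "norm (inverse (theta4 (q^2))) \<le> inverse (theta4 (r^2))"
    unfolding norm_inverse using norm_theta4_ge[of "q\<^sup>2"] r th
    by (intro le_imp_inverse_le) (auto simp: nq norm_power power_less_one_iff q_nz)
  \<comment> \<open>On the positive axis \<open>tri\<close> is at least 1, so it may be dropped from
    the denominator.\<close>
  have 3: "inverse (theta4 r) * inverse (theta4 (r^2)) \<le> lead * \<alpha> * exp (v / 2)"
  proof -
    have e: "theta4 r * theta4 (r^2) = 2 * sqrt 2 * pi / \<alpha> * exp (- (3 * pi^2 / 8 / \<alpha>)) *
        (tri (exp (- (2 * pi^2 / \<alpha>))) * tri (exp (- (pi^2 / \<alpha>))))"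
      unfolding r2[symmetric] unfolding r_def by (rule theta4_product_inversion_real[OF \<alpha>(1)])
    have "tri (exp (- (2 * pi^2 / \<alpha>))) * tri (exp (- (pi^2 / \<alpha>))) \<ge> 1 * 1"
      using \<alpha> by (intro mult_mono tri_ge_1) (auto intro: order_trans[OF _ tri_ge_1])
    then have "2 * sqrt 2 * pi / \<alpha> * exp (- (3 * pi^2 / 8 / \<alpha>)) * 1 \<le> theta4 r * theta4 (r^2)"
      unfolding e using \<alpha> by (intro mult_left_mono) auto
    then have "inverse (theta4 r * theta4 (r^2)) \<le> inverse (2 * sqrt 2 * pi / \<alpha> * exp (- (3 * pi^2 / 8 / \<alpha>)) * 1)"
      using \<alpha> by (intro le_imp_inverse_le) auto
    also have "\<dots> = lead * \<alpha> * exp (v / 2)"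
      unfolding n_\<alpha>'(2) by (simp add: lead_def exp_minus field_simps)
    finally show ?thesis by simp
  qed
  have "norm (circle_integrand n (Complex \<alpha> \<theta>)) = norm (inverse (theta4 q)) * norm (inverse (theta4 (q^2))) * exp (v / 2)"
    by (simp add: circle_integrand_def q2 q_def[symmetric] norm_mult norm_inverse n_\<alpha>')
  also have "\<dots> \<le> (inverse (theta4 r) * exp (- (v / 6))) * inverse (theta4 (r^2)) * exp (v / 2)"
    using 1 2 th by (intro mult_mono mult_nonneg_nonneg) auto
  also have "\<dots> = (inverse (theta4 r) * inverse (theta4 (r^2))) * (exp (- (v / 6)) * exp (v / 2))"
    by simp
  also have "\<dots> \<le> (lead * \<alpha> * exp (v / 2)) * (exp (- (v / 6)) * exp (v / 2))"
    using 3 by (intro mult_right_mono) auto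
  also have "\<dots> = lead * \<alpha> * exp (v - v / 6)"
    by (simp add: mult.assoc flip: exp_add)
  finally show ?thesis .
qed

end

text \<open>Expanding the exponential of the \<open>1 / t\<close> term leaves Cauchy integrals of
  \<open>t^2 * exp (n * t)\<close> over \<open>t ^ (j + 1)\<close>. The double zero at 0 kills
  \<open>j = 0\<close> and \<open>j = 1\<close>, and the shift by two is the origin of the Bessel
  index 2.\<close>

lemma contour_integral_bessel_integrand:
  assumes R: "R > 0"
  shows "contour_integral (circlepath 0 R) (bessel_integrand n) =
    2 * pi * \<i> * of_real ((3 * pi^2 / 8)^2 * bessel_clifford 2 (3 * pi^2 / 8 * real n))"
proof -
  define \<beta> where "\<beta> = 3 * pi^2 / 8"
  have \<beta>: "\<beta> > 0" by (simp add: \<beta>_def)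
  define h where "h t = t^2 * exp (of_nat n * t)" for t :: complex
  define c where "c j = \<beta> ^ j / fact j * (if j < 2 then 0 else real n ^ (j - 2) / fact (j - 2))" for j
  define f where "f j t = of_real (\<beta> ^ j / fact j) * (h t / (t - 0) ^ Suc j)" for j and t :: complex
  have hcont: "continuous_on A h" and hhol: "h holomorphic_on A" for A
    unfolding h_def by (intro continuous_intros holomorphic_intros)+
  have h_int: "((\<lambda>t. h t / (t - 0) ^ Suc j) has_contour_integral
      (2 * pi * \<i> * of_real (if j < 2 then 0 else real n ^ (j - 2) / fact (j - 2)))) (circlepath 0 R)" for j
  proof -
    have "h has_fps_expansion (fps_X ^ 2 * fps_exp (of_nat n))"
      unfolding h_def by (intro fps_expansion_intros)
    from fps_nth_fps_expansion[OF this, of j, symmetric]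
    have "(deriv ^^ j) h 0 / fact j = fps_nth (fps_X ^ 2 * fps_exp (of_nat n)) j" .
    also have "\<dots> = of_real (if j < 2 then 0 else real n ^ (j - 2) / fact (j - 2))"
      by (simp add: fps_X_power_mult_nth)
    finally have A: "(deriv ^^ j) h 0 / fact j = of_real (if j < 2 then 0 else real n ^ (j - 2) / fact (j - 2))" .
    have B: "contour_integral (circlepath 0 R) (\<lambda>t. h t / (t - 0) ^ Suc j) = 2 * pi * \<i> * (deriv ^^ j) h 0 / fact j"
      using R by (intro Cauchy_contour_integral_circlepath hcont hhol) auto
    have C: "(\<lambda>t. h t / (t - 0) ^ Suc j) contour_integrable_on (circlepath 0 R)"
      using R by (intro Cauchy_higher_derivative_integral_circlepath(1) hcont hhol) auto
    show ?thesis
      using has_contour_integral_integral[OF C] by (simp only: B times_divide_eq_right[symmetric] A)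
  qed
  have f_int: "(f j has_contour_integral (2 * pi * \<i> * of_real (c j))) (circlepath 0 R)" for j
    using has_contour_integral_lmul[OF h_int[of j], of "of_real (\<beta> ^ j / fact j)"]
    by (simp add: f_def[abs_def] c_def mult_ac)
  have sum_int: "((\<lambda>t. \<Sum>j<N. f j t) has_contour_integral (\<Sum>j<N. 2 * pi * \<i> * of_real (c j))) (circlepath 0 R)" for N
    by (intro has_contour_integral_sum f_int) auto
  have f_eq: "f j t = t * exp (of_nat n * t) * ((of_real \<beta> / t) ^ j /\<^sub>R fact j)" if "t \<noteq> 0" for j t
    using that by (simp add: f_def h_def power2_eq_square power_divide scaleR_conv_of_real field_simps)
  have f_sums: "(\<lambda>j. f j t) sums bessel_integrand n t" if "t \<noteq> 0" for t
    using sums_mult[OF exp_converges[of "of_real \<beta> / t"], of "t * exp (of_nat n * t)"] that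
    by (simp add: f_eq bessel_integrand_def exp_add \<beta>_def mult_ac)
  have "uniform_limit (sphere 0 R) (\<lambda>N t. \<Sum>j<N. f j t) (\<lambda>t. \<Sum>j. f j t) sequentially"
  proof (rule Weierstrass_m_test)
    show "summable (\<lambda>j. R * exp (real n * R) * ((\<beta> / R) ^ j /\<^sub>R fact j))"
      by (intro summable_mult summable_exp_generic)
    fix j and t :: complex assume t: "t \<in> sphere 0 R"
    then have nt: "norm t = R" by simp
    have "norm (exp (of_nat n * t)) \<le> exp (real n * R)"
      using complex_Re_le_cmod[of t] nt by (simp add: mult_left_mono)
    then show "norm (f j t) \<le> R * exp (real n * R) * ((\<beta> / R) ^ j /\<^sub>R fact j)"
      using R nt \<beta> by (subst f_eq) (auto simp: norm_mult norm_power norm_divide intro!: mult_right_mono mult_left_mono divide_right_mono)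
  qed
  then have ul: "uniform_limit (sphere 0 R) (\<lambda>N t. \<Sum>j<N. f j t) (bessel_integrand n) sequentially"
    by (rule uniform_limit_cong'[THEN iffD1, rotated -1]) (use R f_sums in \<open>auto simp: sums_iff\<close>)
  have ci: "(\<lambda>t. \<Sum>j<N. f j t) contour_integrable_on (circlepath 0 R)" for N
    using sum_int contour_integrable_on_def by blast
  have "(\<lambda>N. contour_integral (circlepath 0 R) (\<lambda>t. \<Sum>j<N. f j t)) \<longlonglongrightarrow> contour_integral (circlepath 0 R) (bessel_integrand n)"
    by (rule contour_integral_uniform_limit_circlepath(2)[OF _ ul _ R])
       (use ci in auto)
  then have "(\<lambda>N. \<Sum>j<N. 2 * pi * \<i> * of_real (c j)) \<longlonglongrightarrow> contour_integral (circlepath 0 R) (bessel_integrand n)"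
    by (simp only: contour_integral_unique[OF sum_int])
  moreover have "(\<lambda>j. 2 * pi * \<i> * complex_of_real (c j)) sums (2 * pi * \<i> * of_real (\<beta>^2 * bessel_clifford 2 (\<beta> * real n)))"
  proof (intro sums_mult sums_of_real)
    have "(\<lambda>j. \<beta>\<^sup>2 * ((\<beta> * real n) ^ j / (fact j * fact (j + 2)))) sums (\<beta>^2 * bessel_clifford 2 (\<beta> * real n))"
      unfolding bessel_clifford_def by (intro sums_mult summable_sums summable_bessel_clifford)
    moreover have "\<beta>\<^sup>2 * ((\<beta> * real n) ^ j / (fact j * fact (j + 2))) = c (j + 2)" for j
      by (simp add: c_def power_mult_distrib power2_eq_square mult_ac)
    ultimately have "(\<lambda>j. c (j + 2)) sums (\<beta>^2 * bessel_clifford 2 (\<beta> * real n))" by simp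
    then show "c sums (\<beta>^2 * bessel_clifford 2 (\<beta> * real n))"
      by (subst (asm) sums_iff_shift) (simp add: c_def numeral_2_eq_2)
  qed
  ultimately show ?thesis
    unfolding \<beta>_def[symmetric] sums_def by (rule LIMSEQ_unique)
qed

lemma bessel_integrand_holomorphic: "bessel_integrand n holomorphic_on {t. Re t > 0}"
  unfolding bessel_integrand_def[abs_def] by (intro holomorphic_intros) auto

context saddle
begin

text \<open>The segment from \<open>\<alpha> - 2 i \<alpha>\<close> to \<open>\<alpha> + 2 i \<alpha>\<close> is replaced by the right-hand arc of the circle of
  radius \<open>sqrt 5 \<alpha>\<close>; on the remaining arc both \<open>Re t\<close> and \<open>Re (1 / t)\<close> are small.\<close>

lemma integral_major_bessel:
  "norm (integral {- (2 * \<alpha>)..2 * \<alpha>} (\<lambda>\<theta>. bessel_integrand n (Complex \<alpha> \<theta>)) -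
      2 * pi * of_real ((3 * pi^2 / 8)^2 * bessel_clifford 2 (3 * pi^2 / 8 * real n)))
    \<le> 5 * \<alpha>^2 * exp (3 * v / 5) * (2 * pi)"
proof -
  define R where "R = sqrt 5 * \<alpha>"
  define \<phi> where "\<phi> = arctan 2"
  define J where "J = bessel_integrand n"
  define B where "B = (3 * pi^2 / 8)^2 * bessel_clifford 2 (3 * pi^2 / 8 * real n)"
  have R: "R > 0" "R\<^sup>2 = 5 * \<alpha>^2" using \<alpha> by (simp_all add: R_def power_mult_distrib)
  have \<phi>: "0 < \<phi>" "\<phi> < pi / 2" unfolding \<phi>_def using arctan_ubound[of 2] by (simp_all add: zero_less_arctan_iff)
  have cs: "R * cos \<phi> = \<alpha>" "R * sin \<phi> = 2 * \<alpha>"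
    by (simp_all add: R_def \<phi>_def cos_arctan sin_arctan)
  have ends: "of_real R * cis \<phi> = Complex \<alpha> (2 * \<alpha>)" "of_real R * cis (- \<phi>) = Complex \<alpha> (- (2 * \<alpha>))"
    using cs by (simp_all add: complex_eq_iff)
  define g where "g \<theta> = J (0 + R * cis \<theta>) * R * \<i> * cis \<theta>" for \<theta>
  have gcont: "continuous_on A g" for A
    unfolding g_def J_def bessel_integrand_def using R by (intro continuous_intros) (auto simp: cis_conv_exp)
  have gint: "g integrable_on {a..b}" for a b
    by (intro integrable_continuous_real gcont)
  have "contour_integral (circlepath 0 R) J = integral {0..2 * pi} g"
    unfolding circlepath_def g_def by (rule contour_integral_part_circlepath_eq) simp
  also have "\<dots> = integral {- pi..pi} g"
  proof (rule integral_period_shift[OF gcont])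
    fix \<theta>
    have "cis (\<theta> + 2 * pi) = cis \<theta>" by (simp add: complex_eq_iff)
    then show "g (\<theta> + 2 * pi) = g \<theta>" by (simp add: g_def)
  qed
  also have "\<dots> = integral {- pi..- \<phi>} g + integral {- \<phi>..\<phi>} g + integral {\<phi>..pi} g"
    using \<phi> by (simp add: Henstock_Kurzweil_Integration.integral_combine[OF _ _ gint])
  also have "integral {- \<phi>..\<phi>} g = \<i> * integral {- (2 * \<alpha>)..2 * \<alpha>} (\<lambda>\<theta>. J (Complex \<alpha> \<theta>))"
  proof -
    \<comment> \<open>In the right half-plane the integrand has a primitive, so the arc and the
      segment with the same endpoints give equal integrals.\<close>
    define S where "S = {t :: complex. Re t > 0}"
    have "convex S" "open S" unfolding S_def by (rule convex_halfspace_Re_gt open_halfspace_Re_gt)+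
    then obtain G where G: "\<And>t. t \<in> S \<Longrightarrow> (G has_field_derivative J t) (at t within S)"
      using holomorphic_convex_primitive'[OF \<open>convex S\<close> \<open>open S\<close> bessel_integrand_holomorphic[of n, folded S_def J_def]]
      using at_within_open by metis
    have "integral {- \<phi>..\<phi>} g = contour_integral (part_circlepath 0 R (- \<phi>) \<phi>) J"
      unfolding g_def by (rule contour_integral_part_circlepath_eq[symmetric]) (use \<phi> in simp)
    also have "\<dots> = G (Complex \<alpha> (2 * \<alpha>)) - G (Complex \<alpha> (- (2 * \<alpha>)))"
    proof -
      have "path_image (part_circlepath 0 R (- \<phi>) \<phi>) \<subseteq> S"
      proof
        fix t assume "t \<in> path_image (part_circlepath 0 R (- \<phi>) \<phi>)"
        then obtain \<theta> where \<theta>: "\<theta> \<in> {- \<phi>..\<phi>}" "t = of_real R * cis \<theta>"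
          using \<phi> by (auto simp: path_image_part_circlepath cis_conv_exp)
        then have "cos \<theta> > 0" using \<phi> by (intro cos_gt_zero_pi) auto
        then show "t \<in> S" using R \<theta> by (simp add: S_def)
      qed
      from contour_integral_primitive[OF G valid_path_part_circlepath this]
      have "(J has_contour_integral (G (pathfinish (part_circlepath 0 R (- \<phi>) \<phi>)) - G (pathstart (part_circlepath 0 R (- \<phi>) \<phi>)))) (part_circlepath 0 R (- \<phi>) \<phi>)"
        by blast
      then show ?thesis
        using ends by (simp add: contour_integral_unique cis_conv_exp)
    qed
    also have "\<dots> = contour_integral (linepath (Complex \<alpha> (- (2 * \<alpha>))) (Complex \<alpha> (2 * \<alpha>))) J"
    proof -
      have "path_image (linepath (Complex \<alpha> (- (2 * \<alpha>))) (Complex \<alpha> (2 * \<alpha>))) \<subseteq> S"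
        unfolding path_image_linepath using \<alpha> \<open>convex S\<close>
        by (intro closed_segment_subset) (auto simp: S_def)
      from contour_integral_primitive[OF G valid_path_linepath this]
      show ?thesis by (simp add: contour_integral_unique)
    qed
    also have "\<dots> = \<i> * integral {- (2 * \<alpha>)..2 * \<alpha>} (\<lambda>\<theta>. J (Complex \<alpha> \<theta>))"
      by (rule contour_integral_linepath_same_Re) (use \<alpha> in simp_all)
    finally show ?thesis .
  qed
  finally have eq: "\<i> * (integral {- (2 * \<alpha>)..2 * \<alpha>} (\<lambda>\<theta>. J (Complex \<alpha> \<theta>)) - 2 * pi * of_real B)
     = - (integral {- pi..- \<phi>} g + integral {\<phi>..pi} g)"
    using contour_integral_bessel_integrand[OF R(1), of n] unfolding J_def[symmetric] B_def[symmetric]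
    by (simp add: algebra_simps)
  \<comment> \<open>Where \<open>Re t \<le> \<alpha>\<close> on this circle, also
    \<open>Re (1 / t) \<le> 1 / (5 * \<alpha>)\<close>: the exponent is at most
    \<open>v / 2 + v / 10\<close>.\<close>
  have gb: "norm (g \<theta>) \<le> 5 * \<alpha>^2 * exp (3 * v / 5)" if "cos \<theta> \<le> cos \<phi>" for \<theta>
  proof -
    have c: "R * cos \<theta> \<le> \<alpha>" using mult_left_mono[OF that, of R] R cs by simp
    have nR: "norm (of_real R * cis \<theta>) = R" using R by (simp add: norm_mult)
    have "real n * (R * cos \<theta>) + 3 * pi^2 / 8 * (R * cos \<theta>) / R^2 \<le> real n * \<alpha> + 3 * pi^2 / 8 * \<alpha> / R^2"
      using c by (intro add_mono mult_left_mono divide_right_mono) auto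
    also have "3 * pi^2 / 8 * \<alpha> / R^2 = 3 * pi^2 / 8 / \<alpha> / 5"
      unfolding R(2) using \<alpha> by (simp add: power2_eq_square)
    also have "real n * \<alpha> + 3 * pi^2 / 8 / \<alpha> / 5 = 3 * v / 5" unfolding n_\<alpha>' by simp
    finally have "exp (real n * (R * cos \<theta>) + 3 * pi^2 / 8 * (R * cos \<theta>) / R^2) \<le> exp (3 * v / 5)"
      by (simp only: exp_le_cancel_iff)
    then have "R\<^sup>2 * exp (real n * (R * cos \<theta>) + 3 * pi^2 / 8 * (R * cos \<theta>) / R^2) \<le> R^2 * exp (3 * v / 5)"
      by (intro mult_left_mono) auto
    moreover have "norm (g \<theta>) = R^2 * exp (real n * (R * cos \<theta>) + 3 * pi^2 / 8 * (R * cos \<theta>) / R^2)"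
      unfolding g_def J_def bessel_integrand_def add_0 norm_mult norm_exp_eq_Re plus_complex.sel Re_of_real_divide nR[unfolded norm_mult]
      using R by (simp add: nR power2_eq_square norm_mult)
    ultimately show ?thesis unfolding R(2) by simp
  qed
  have "norm (integral {- pi..- \<phi>} g) \<le> 5 * \<alpha>^2 * exp (3 * v / 5) * (- \<phi> - (- pi))"
    by (rule integral_bound[OF _ gcont gb]) (use \<phi> in \<open>auto intro!: cos_monotone_0_pi_le[of \<phi> "- _", simplified]\<close>)
  moreover have "norm (integral {\<phi>..pi} g) \<le> 5 * \<alpha>^2 * exp (3 * v / 5) * (pi - \<phi>)"
    by (rule integral_bound[OF _ gcont gb]) (use \<phi> in \<open>auto intro!: cos_monotone_0_pi_le\<close>)
  moreover have "5 * \<alpha>^2 * exp (3 * v / 5) * (- \<phi> - (- pi)) + 5 * \<alpha>^2 * exp (3 * v / 5) * (pi - \<phi>)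
      \<le> 5 * \<alpha>^2 * exp (3 * v / 5) * (2 * pi)"
    unfolding distrib_left[symmetric] using \<phi> by (intro mult_left_mono) auto
  ultimately have "norm (- (integral {- pi..- \<phi>} g + integral {\<phi>..pi} g)) \<le> 5 * \<alpha>^2 * exp (3 * v / 5) * (2 * pi)"
    using norm_triangle_ineq[of "integral {- pi..- \<phi>} g" "integral {\<phi>..pi} g"]
    unfolding norm_minus_cancel by linarith
  then show ?thesis
    unfolding eq[symmetric] by (simp add: norm_mult J_def B_def)
qed

lemma circle_integrand_continuous: "continuous_on A (\<lambda>\<theta>. circle_integrand n (Complex \<alpha> \<theta>))"
proof -
  have "continuous_on {t. Re t > 0} (circle_integrand n)"
  proof -
    have th: "theta4 q \<noteq> 0" if "norm q < 1" "q \<noteq> 0" for q :: complex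
    proof -
      have "theta4 (norm q) > 0" using theta4_exp_pos[of "- ln (norm q)"] that by simp
      with norm_theta4_ge[OF that] show ?thesis by auto
    qed
    show ?thesis
      unfolding circle_integrand_def[abs_def]
      by (intro holomorphic_on_imp_continuous_on holomorphic_intros holomorphic_on_compose_unit_disc[OF holomorphic_theta4])
         (auto simp: th)
  qed
  then show ?thesis
    by (rule continuous_on_compose2) (use \<alpha> in \<open>auto simp: Complex_eq intro!: continuous_intros\<close>)
qed

text \<open>Three errors add up: the minor arcs, the \<open>tri\<close> factors on the major arc,
  and the completion of the segment to a circle. The first dominates, as the exponents
  \<open>11/15 * v\<close> and \<open>3/5 * v\<close> of the others are below
  \<open>5/6 * v\<close>. The constant 12 covers
  \<open>2 * pi + (86 + 10 * pi) / 25\<close>.\<close>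

theorem cubic_overpartition_approx:
  "\<bar>2 * pi * cubic_overpartition n - lead * (2 * pi * ((3 * pi^2 / 8)^2 * bessel_clifford 2 (3 * pi^2 / 8 * real n)))\<bar>
    \<le> lead * (12 * \<alpha> * exp (5 * v / 6))"
proof -
  let ?F = "\<lambda>\<theta>. circle_integrand n (Complex \<alpha> \<theta>)"
  let ?J = "\<lambda>\<theta>. bessel_integrand n (Complex \<alpha> \<theta>)"
  define B where "B = (3 * pi^2 / 8)^2 * bessel_clifford 2 (3 * pi^2 / 8 * real n)"
  have Fi: "?F integrable_on {a..b}" for a b
    by (intro integrable_continuous_real circle_integrand_continuous)
  have Jcont: "continuous_on A ?J" for A
    unfolding bessel_integrand_def Complex_eq using \<alpha> by (intro continuous_intros) (auto simp: complex_eq_iff)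
  have Ji: "?J integrable_on {a..b}" for a b
    by (intro integrable_continuous_real Jcont)
  have "of_real (2 * pi * cubic_overpartition n) = integral {- pi..pi} ?F"
    using cubic_overpartition_integral[OF \<alpha>(1) theta4_exp_pos, of n] by (simp add: integral_unique)
  also have "\<dots> = integral {- pi..- (2 * \<alpha>)} ?F + integral {- (2 * \<alpha>)..2 * \<alpha>} ?F + integral {2 * \<alpha>..pi} ?F"
    using \<alpha> pi_gt3 by (simp add: Henstock_Kurzweil_Integration.integral_combine[OF _ _ Fi])
  finally have eq: "of_real (2 * pi * cubic_overpartition n) - of_real lead * (2 * pi * of_real B) =
     integral {- pi..- (2 * \<alpha>)} ?F + integral {2 * \<alpha>..pi} ?F +
     integral {- (2 * \<alpha>)..2 * \<alpha>} (\<lambda>\<theta>. ?F \<theta> - of_real lead * ?J \<theta>) +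
     of_real lead * (integral {- (2 * \<alpha>)..2 * \<alpha>} ?J - 2 * pi * of_real B)"
    by (simp add: Henstock_Kurzweil_Integration.integral_diff[OF Fi integrable_on_mult_right[OF Ji]] algebra_simps)
  have e: "v - v / 6 = 5 * v / 6" by simp
  have 1: "norm (integral {- pi..- (2 * \<alpha>)} ?F) \<le> lead * \<alpha> * exp (5 * v / 6) * (- (2 * \<alpha>) - (- pi))"
    by (rule integral_bound[OF _ circle_integrand_continuous circle_integrand_minor[unfolded e]])
       (use \<alpha> pi_gt3 in auto)
  have 2: "norm (integral {2 * \<alpha>..pi} ?F) \<le> lead * \<alpha> * exp (5 * v / 6) * (pi - 2 * \<alpha>)"
    by (rule integral_bound[OF _ circle_integrand_continuous circle_integrand_minor[unfolded e]])
       (use \<alpha> pi_gt3 in auto)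
  have 3: "norm (integral {- (2 * \<alpha>)..2 * \<alpha>} (\<lambda>\<theta>. ?F \<theta> - of_real lead * ?J \<theta>))
      \<le> lead * (9/4 * \<alpha> * exp v * (10 * exp (- (4 * v / 15)))) * (2 * \<alpha> - (- (2 * \<alpha>)))"
    by (rule integral_bound[OF _ _ circle_integrand_major])
       (use \<alpha> in \<open>auto intro!: continuous_intros circle_integrand_continuous Jcont\<close>)
  have 3: "norm (integral {- (2 * \<alpha>)..2 * \<alpha>} (\<lambda>\<theta>. ?F \<theta> - of_real lead * ?J \<theta>)) \<le> lead * (90 * \<alpha>^2 * exp (5 * v / 6))"
  proof -
    have "exp v * exp (- (4 * v / 15)) \<le> exp (5 * v / 6)"
      using v_ge by (simp flip: exp_add)
    then have "lead * (90 * \<alpha>^2 * (exp v * exp (- (4 * v / 15)))) \<le> lead * (90 * \<alpha>^2 * exp (5 * v / 6))"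
      using lead_pos by (intro mult_left_mono) auto
    moreover have "lead * (9/4 * \<alpha> * exp v * (10 * exp (- (4 * v / 15)))) * (2 * \<alpha> - (- (2 * \<alpha>)))
      = lead * (90 * \<alpha>^2 * (exp v * exp (- (4 * v / 15))))" by (simp add: power2_eq_square)
    ultimately show ?thesis using 3 by linarith
  qed
  have 4: "norm (of_real lead * (integral {- (2 * \<alpha>)..2 * \<alpha>} ?J - 2 * pi * of_real B)) \<le> lead * (5 * \<alpha>^2 * exp (5 * v / 6) * (2 * pi))"
  proof -
    have "5 * \<alpha>^2 * exp (3 * v / 5) * (2 * pi) \<le> 5 * \<alpha>^2 * exp (5 * v / 6) * (2 * pi)"
      using v_ge by (intro mult_left_mono mult_right_mono) auto
    then show ?thesis
      using integral_major_bessel lead_pos unfolding B_def[symmetric] norm_mult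
      by (simp add: mult_left_mono)
  qed
  have "norm (of_real (2 * pi * cubic_overpartition n) - of_real lead * (2 * pi * of_real B) :: complex)
    \<le> lead * \<alpha> * exp (5 * v / 6) * (- (2 * \<alpha>) - (- pi)) + lead * \<alpha> * exp (5 * v / 6) * (pi - 2 * \<alpha>)
      + lead * (90 * \<alpha>^2 * exp (5 * v / 6)) + lead * (5 * \<alpha>^2 * exp (5 * v / 6) * (2 * pi))"
    unfolding eq by (intro norm_triangle_le add_mono 1 2 3 4)
  also have "\<dots> = lead * (\<alpha> * exp (5 * v / 6) * (2 * pi + (86 + 10 * pi) * \<alpha>))"
    by (simp add: algebra_simps power2_eq_square)
  also have "\<dots> \<le> lead * (\<alpha> * exp (5 * v / 6) * 12)"
  proof -
    have "(86 + 10 * pi) * \<alpha> \<le> (86 + 10 * pi) * (1/25)" using \<alpha> by (intro mult_left_mono) auto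
    moreover have "(86 + 10 * pi) * (1/25) \<le> 12 - 2 * pi" using pi_approx by simp
    ultimately have "2 * pi + (86 + 10 * pi) * \<alpha> \<le> 12" by linarith
    then show ?thesis using \<alpha> lead_pos by (intro mult_left_mono) auto
  qed
  finally have "norm (complex_of_real (2 * pi * cubic_overpartition n - lead * (2 * pi * B))) \<le> lead * (\<alpha> * exp (5 * v / 6) * 12)"
    by simp
  then show ?thesis unfolding norm_of_real B_def by (simp add: mult_ac)
qed

end

section \<open>The ratio of consecutive values\<close>

definition main_term :: "nat \<Rightarrow> real" where
  "main_term m = lead * ((3 * pi^2 / 8)^2 * bess (cubv (real m)))"

lemma main_term_pos: "main_term m > 0"
  using lead_pos bess_pos by (simp add: main_term_def)

text \<open>Taking eighth roots, the claim is \<open>v / 5 \<le> exp (v / 48)\<close>. At 186 the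
  exponent is 31/8 and 38 exceeds 37.2; beyond that a tangent bound suffices. The power 8 pays for
  the \<open>v^2\<close> in the relative error and the desired \<open>v^-6\<close>.\<close>

lemma exp_ge_power_8:
  fixes v :: real
  assumes v: "v \<ge> 186"
  shows "(v / 5) ^ 8 \<le> exp (v / 6)"
proof -
  have "38 \<le> (1 + 31/64 + (31/64)^2 / 2 :: real) ^ 8" by (simp add: field_simps)
  also have "\<dots> \<le> exp (31/64) ^ 8"
    by (intro power_mono exp_lower_Taylor_quadratic) auto
  also have "\<dots> = exp (31/8 :: real)" by (simp flip: exp_of_nat_mult)
  finally have 1: "38 \<le> exp (31/8 :: real)" .
  have 2: "1 + (v - 186) / 48 \<le> exp ((v - 186) / 48)" by (rule exp_ge_add_one_self)
  have "v / 5 \<le> 38 * (1 + (v - 186) / 48)" using v by (simp add: field_simps)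
  also have "\<dots> \<le> exp (31/8) * exp ((v - 186) / 48)" using 1 2 v by (intro mult_mono) auto
  also have "\<dots> = exp (v / 48)" by (simp add: field_simps flip: exp_add)
  finally have "(v / 5) ^ 8 \<le> exp (v / 48) ^ 8" using v by (intro power_mono) auto
  also have "\<dots> = exp (v / 6)" by (simp flip: exp_of_nat_mult)
  finally show ?thesis .
qed

lemma cubic_overpartition_relative_error:
  assumes m: "m \<ge> 2362"
  shows "\<bar>cubic_overpartition m / main_term m - 1\<bar> \<le> 1600000 / cubv (real m) ^ 6"
proof -
  define v where "v = cubv (real m)"
  define \<alpha> where "\<alpha> = 3 * pi^2 / (4 * v)"
  have v: "v \<ge> 186" unfolding v_def using m by (intro cubv_ge) simp
  have v2: "v\<^sup>2 = 3 * pi^2 / 2 * real m" unfolding v_def by (rule cubv_square) simp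
  have saddle: "saddle m \<alpha> v"
  proof
    show "0 < \<alpha>" using v by (simp add: \<alpha>_def)
    \<comment> \<open>Almost tight: with \<open>v = 186\<close> this gives about 0.0399 for
      \<open>\<alpha>\<close>.\<close>
    have "pi\<^sup>2 \<le> 99/10" using power_mono[OF pi_approx(2), of 2] by (simp add: power_divide)
    then show "\<alpha> \<le> 1 / 25" using v by (simp add: \<alpha>_def divide_simps)
    have "real m = 2 * v^2 / (3 * pi^2)" using v2 by (simp add: field_simps)
    then show "real m * \<alpha>^2 = 3 * pi^2 / 8"
      using v by (simp add: \<alpha>_def power_divide power_mult_distrib) (simp add: eval_nat_numeral)
    show "v = 3 * pi^2 / (4 * \<alpha>)" using v by (simp add: \<alpha>_def)
  qed
  have y: "3 * pi^2 / 8 * real m = v^2 / 4" using v2 by simp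
  define M where "M = main_term m"
  have M: "M > 0" unfolding M_def by (rule main_term_pos)
  have Meq: "M = lead * ((3 * pi^2 / 8)^2 * bess v)" by (simp add: M_def main_term_def v_def)
  have "\<bar>2 * pi * cubic_overpartition m - 2 * pi * M\<bar> \<le> lead * (12 * \<alpha> * exp (5 * v / 6))"
    using saddle.cubic_overpartition_approx[OF saddle] unfolding y Meq bess_def by (simp add: mult_ac)
  also have "\<dots> \<le> 2 * pi * M * (4 * v^2 * exp (- (v / 6)))"
  proof -
    \<comment> \<open>The half-integral power is weakened to an integral one; the lost
      \<open>sqrt v\<close> is negligible against the exponential saving.\<close>
    have "exp v * (1 / v ^ 3) / 3 \<le> bess v"
    proof -
      have "v powr (- 3) \<le> v powr (-5/2)" using v by (intro powr_mono) auto
      then have "1 / v ^ 3 \<le> v powr (-5/2)" using v by (simp add: powr_minus_divide)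
      then have "1/3 * exp v * (1 / v ^ 3) \<le> 1/3 * exp v * v powr (-5/2)" by (intro mult_left_mono) auto
      with bess_lower[of v] v show ?thesis by simp
    qed
    then have "lead * ((3 * pi^2 / 8)^2 * (exp v * (1 / v ^ 3) / 3)) \<le> M"
      unfolding Meq using lead_pos by (intro mult_left_mono) auto
    then have "2 * pi * (lead * ((3 * pi^2 / 8)^2 * (exp v * (1 / v ^ 3) / 3))) * (4 * v^2 * exp (- (v / 6)))
        \<le> 2 * pi * M * (4 * v^2 * exp (- (v / 6)))"
      by (intro mult_right_mono mult_left_mono) auto
    moreover have "lead * (12 * \<alpha> * exp (5 * v / 6)) \<le>
       2 * pi * (lead * ((3 * pi^2 / 8)^2 * (exp v * (1 / v ^ 3) / 3))) * (4 * v^2 * exp (- (v / 6)))"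
    proof -
      have e: "exp v * exp (- (v / 6)) = exp (5 * v / 6)" by (simp flip: exp_add)
      have "9 \<le> 3/8 * pi ^ 3"
        using power_mono[of 3 pi 3] pi_gt3 by simp
      then have "9 * pi^2 / v \<le> 3/8 * pi ^ 3 * pi^2 / v"
        using v by (intro divide_right_mono mult_right_mono) auto
      also have "\<dots> = 2 * pi * ((3 * pi^2 / 8)^2 * (1 / v ^ 3 / 3)) * (4 * v^2)"
        using v by (simp add: power_divide power_mult_distrib field_simps eval_nat_numeral)
      finally have "12 * \<alpha> \<le> 2 * pi * ((3 * pi^2 / 8)^2 * (1 / v ^ 3 / 3)) * (4 * v^2)"
        using v by (simp add: \<alpha>_def)
      then have "lead * exp (5 * v / 6) * (12 * \<alpha>) \<le> lead * exp (5 * v / 6) * (2 * pi * ((3 * pi^2 / 8)^2 * (1 / v ^ 3 / 3)) * (4 * v^2))"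
        using lead_pos by (intro mult_left_mono) auto
      also have "\<dots> = 2 * pi * (lead * ((3 * pi^2 / 8)^2 * (exp v * (1 / v ^ 3) / 3))) * (4 * v^2 * exp (- (v / 6)))"
        unfolding e[symmetric] by simp
      finally show ?thesis by (simp add: mult_ac)
    qed
    ultimately show ?thesis by linarith
  qed
  finally have "\<bar>2 * pi * cubic_overpartition m - 2 * pi * M\<bar> / (2 * pi * M) \<le> 4 * v^2 * exp (- (v / 6))"
    using M by (simp add: divide_simps mult_ac)
  moreover have "\<bar>2 * pi * cubic_overpartition m - 2 * pi * M\<bar> / (2 * pi * M) = \<bar>cubic_overpartition m / M - 1\<bar>"
  proof -
    have "2 * pi * cubic_overpartition m - 2 * pi * M = 2 * pi * M * (cubic_overpartition m / M - 1)"
      using M by (simp add: field_simps)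
    then show ?thesis using M by (simp add: abs_mult)
  qed
  moreover have "4 * v^2 * exp (- (v / 6)) \<le> 1600000 / v ^ 6"
  proof -
    have "(v / 5) ^ 8 > 0" using v by (intro zero_less_power) auto
    from le_imp_inverse_le[OF exp_ge_power_8[OF v] this]
    have "exp (- (v / 6)) \<le> 1 / (v / 5) ^ 8"
      unfolding exp_minus inverse_eq_divide .
    then have "4 * v^2 * exp (- (v / 6)) \<le> 4 * v^2 * (1 / (v / 5) ^ 8)" by (intro mult_left_mono) auto
    \<comment> \<open>The constant is \<open>4 * 5^8\<close>.\<close>
    also have "\<dots> = 1562500 / v ^ 6" using v by (simp add: power_divide field_simps flip: power_add)
    also have "\<dots> \<le> 1600000 / v ^ 6" using v by (intro divide_right_mono) auto
    finally show ?thesis .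
  qed
  ultimately show ?thesis by (simp add: M_def v_def)
qed

text \<open>The first-order change is \<open>4 * \<delta>\<close>. Below, the second-order remainder
  \<open>8 * \<delta>^2 + 4 * \<delta>^3\<close> has the favourable sign; above, a fifth
  \<open>\<delta>\<close> absorbs it when \<open>\<delta> \<le> 1/100\<close>.\<close>

lemma perturbed_ratio_bounds:
  fixes a b c \<delta> :: real
  assumes "\<bar>a - 1\<bar> \<le> \<delta>" "\<bar>b - 1\<bar> \<le> \<delta>" "\<bar>c - 1\<bar> \<le> \<delta>" "\<delta> \<le> 1/100"
  shows "1 - 4 * \<delta> \<le> a * b / c^2" "a * b / c^2 \<le> 1 + 5 * \<delta>"
proof -
  have \<delta>: "0 \<le> \<delta>" using assms(1) by linarith
  have a: "1 - \<delta> \<le> a" "a \<le> 1 + \<delta>" and b: "1 - \<delta> \<le> b" "b \<le> 1 + \<delta>" and c: "1 - \<delta> \<le> c" "c \<le> 1 + \<delta>"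
    using assms by linarith+
  have c2: "(1 - \<delta>)^2 \<le> c^2" "c\<^sup>2 \<le> (1 + \<delta>)^2" "c\<^sup>2 > 0"
    using c assms(4) by (auto intro!: power_mono)
  have ab: "(1 - \<delta>)^2 \<le> a * b" "a * b \<le> (1 + \<delta>)^2"
    unfolding power2_eq_square using a b assms(4) \<delta> by (auto intro!: mult_mono)
  have "(1 - 4 * \<delta>) * c^2 \<le> (1 - 4 * \<delta>) * (1 + \<delta>)^2"
    using c2 assms(4) by (intro mult_left_mono) auto
  also have "\<dots> \<le> (1 - \<delta>)^2"
  proof -
    have "(1 - \<delta>)^2 - (1 - 4 * \<delta>) * (1 + \<delta>)^2 = 8 * \<delta>^2 + 4 * \<delta> ^ 3" by (simp add: power2_eq_square power3_eq_cube algebra_simps)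
    moreover have "0 \<le> 8 * \<delta>^2 + 4 * \<delta> ^ 3" using \<delta> by simp
    ultimately show ?thesis by linarith
  qed
  finally show "1 - 4 * \<delta> \<le> a * b / c^2" using ab c2 by (simp add: pos_le_divide_eq)
  have "(1 + \<delta>)^2 \<le> (1 + 5 * \<delta>) * (1 - \<delta>)^2"
  proof -
    have "(1 + 5 * \<delta>) * (1 - \<delta>)^2 - (1 + \<delta>)\<^sup>2 = \<delta> * (1 - 10 * \<delta> + 5 * \<delta>^2)" by (simp add: power2_eq_square algebra_simps)
    moreover have "0 \<le> \<delta> * (1 - 10 * \<delta> + 5 * \<delta>^2)"
      using \<delta> assms(4) by (intro mult_nonneg_nonneg add_nonneg_nonneg) auto
    ultimately show ?thesis by linarith
  qed
  also have "\<dots> \<le> (1 + 5 * \<delta>) * c^2" using c2 \<delta> by (intro mult_left_mono) auto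
  finally show "a * b / c^2 \<le> 1 + 5 * \<delta>" using ab c2 by (simp add: pos_divide_le_eq)
qed

text \<open>The ratio is \<open>exp X\<close> times the effect of the relative errors, with
  \<open>X\<close> the second difference. As \<open>X\<close> is \<open>O(w^3)\<close>, replacing
  \<open>exp X\<close> by \<open>1 + X\<close> costs \<open>O(w^6)\<close>. Below, the costs are
  \<open>4.04 * 1700000 + 16500\<close>; above,
  \<open>5.05 * 1700000 + 7200 + 16500\<close>.\<close>

lemma cubic_overpartition_ratio:
  assumes n: "n \<ge> 2363"
  defines "w \<equiv> 1 / cubv (real n)"
  defines "P \<equiv> 1 + 9 * pi^4 / 16 * main_poly w"
  shows "P - 7000000 * w^6 \<le> cubic_overpartition (n + 1) * cubic_overpartition (n - 1) / (cubic_overpartition n)^2"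
    and "cubic_overpartition (n + 1) * cubic_overpartition (n - 1) / (cubic_overpartition n)^2 \<le> P + 8700000 * w^6"
proof -
  define v where "v = cubv (real n)"
  define r where "r m = cubic_overpartition m / main_term m" for m
  define X where "X = ln (bess (cubv (real n + 1))) + ln (bess (cubv (real n - 1))) - 2 * ln (bess (cubv (real n)))"
  define \<delta> where "\<delta> = 1700000 * w ^ 6"
  have v: "v \<ge> 186" unfolding v_def using n by (intro cubv_ge) simp
  have w: "0 < w" "w \<le> 1/186" using v by (simp_all add: w_def v_def[symmetric] divide_simps)
  have w6: "w ^ 6 \<le> (1/186) ^ 6" using w by (intro power_mono) auto
  have err: "\<bar>r m - 1\<bar> \<le> \<delta>" if m: "m \<ge> n - 1" for m
  proof -
    have m': "m \<ge> 2362" "real n - 1 \<le> real m" using m n by linarith+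
    \<comment> \<open>Moving the error bound from \<open>m\<close> to \<open>n\<close> costs at most
      \<open>(100/99)^3\<close>, which is less than 17/16.\<close>
    have "1600000 * v ^ 6 \<le> 1700000 * cubv (real m) ^ 6"
    proof -
      have "99/100 * real n \<le> real m" using m'(2) n by simp
      then have "3 * pi^2 / 2 * (99/100 * real n) \<le> 3 * pi^2 / 2 * real m"
        by (intro mult_left_mono) auto
      then have "99/100 * v^2 \<le> (cubv (real m))\<^sup>2" unfolding v_def by (simp add: cubv_square)
      then have "(99/100 * v^2) ^ 3 \<le> ((cubv (real m))\<^sup>2) ^ 3" by (intro power_mono) auto
      then have "(99/100) ^ 3 * v ^ 6 \<le> cubv (real m) ^ 6"
        unfolding power_mult_distrib power_mult[symmetric] by simp
      moreover have "1600000 * v ^ 6 \<le> 1700000 * (99/100) ^ 3 * v ^ 6"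
        using v by (intro mult_right_mono) (simp_all add: power_divide)
      ultimately show ?thesis by linarith
    qed
    then have "1600000 / cubv (real m) ^ 6 \<le> 1700000 / v ^ 6"
      using v cubv_pos[of "real m"] m'(1) by (simp add: divide_simps)
    also have "\<dots> = \<delta>" by (simp add: \<delta>_def w_def v_def power_divide)
    finally show ?thesis using cubic_overpartition_relative_error[OF m'(1)] unfolding r_def by linarith
  qed
  have \<delta>: "\<delta> \<le> 1/100" "0 \<le> \<delta>" using w6 w by (simp_all add: \<delta>_def power_divide)
  note rb = perturbed_ratio_bounds[OF err[of "n + 1"] err[of "n - 1"] err[of n] \<delta>(1), simplified]
  have expX: "main_term (n + 1) * main_term (n - 1) / (main_term n)^2 = exp X"
  proof -
    have "exp X = bess (cubv (real n + 1)) * bess (cubv (real n - 1)) / (bess (cubv (real n)))\<^sup>2"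
    proof -
      have "exp (ln a + ln b - 2 * ln c) = a * b / c^2" if "a > 0" "b > 0" "c > 0" for a b c :: real
        using that by (simp add: exp_diff exp_add exp_double)
      then show ?thesis unfolding X_def using bess_pos by blast
    qed
    moreover have "real (n + 1) = real n + 1" "real (n - 1) = real n - 1" using n by simp_all
    moreover have "l * (k * a) * (l * (k * b)) / (l * (k * c))\<^sup>2 = a * b / c^2"
      if "l > 0" "k > 0" for a b c k l :: real
      using that by (simp add: power2_eq_square)
    ultimately show ?thesis unfolding main_term_def using lead_pos by (simp add: add.commute)
  qed
  have ratio: "cubic_overpartition (n + 1) * cubic_overpartition (n - 1) / (cubic_overpartition n)^2
     = exp X * (r (n + 1) * r (n - 1) / (r n)^2)"
    unfolding expX[symmetric] r_def using main_term_pos[of n] main_term_pos[of "n + 1"] main_term_pos[of "n - 1"]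
    by (simp add: power_divide)
  define K where "K = 9 * pi^4 / 16"
  have K: "0 \<le> K" "K \<le> 55"
  proof -
    have "pi ^ 4 \<le> (3142/1000) ^ 4" using pi_approx by (intro power_mono) auto
    then show "0 \<le> K" "K \<le> 55" by (simp_all add: K_def power_divide)
  qed
  have X: "\<bar>X - K * main_poly w\<bar> \<le> K * (300 * w^6)"
    using log_main_second_difference_approx[of "real n"] n unfolding X_def K_def w_def by simp
  have "K * (300 * w ^ 6) \<le> 55 * (300 * w ^ 6)" using K w by (intro mult_right_mono) auto
  then have X1: "\<bar>X - K * main_poly w\<bar> \<le> 16500 * w ^ 6" using X by simp
  have X_bounds: "X \<le> K * main_poly w + 16500 * w ^ 6" "K * main_poly w - 16500 * w ^ 6 \<le> X"
    using X1 by (simp_all add: abs_le_iff)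
  have w60: "0 \<le> w ^ 6" using w by simp
  have mp: "main_poly w \<le> 0" "- (102/100 * w ^ 3) \<le> main_poly w"
  proof -
    have "5 * w ^ 4 \<le> 5 * (1/186 * w ^ 3)"
      using mult_right_mono[OF w(2), of "w ^ 3"] w by (simp add: eval_nat_numeral)
    moreover have "0 \<le> 45/8 * w ^ 5" "0 \<le> w ^ 3" "0 \<le> w ^ 4" using w by simp_all
    moreover have "45/8 * w ^ 5 \<le> 5 * w ^ 4 * 1"
      using mult_right_mono[OF w(2), of "w ^ 4"] w by (simp add: eval_nat_numeral)
    ultimately show "main_poly w \<le> 0" "- (102/100 * w ^ 3) \<le> main_poly w"
      unfolding main_poly_def by linarith+
  qed
  have w63: "16500 * w ^ 6 \<le> w ^ 3 / 10"
  proof -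
    have "w ^ 3 \<le> (1/186) ^ 3" using w by (intro power_mono) auto
    then have "w ^ 3 * w ^ 3 \<le> (1/186) ^ 3 * w ^ 3" using w by (intro mult_right_mono) auto
    then have "6434856 * w ^ 6 \<le> w ^ 3" by (simp add: power_divide flip: power_add)
    moreover have "0 \<le> w ^ 6" using w by simp
    ultimately show ?thesis by linarith
  qed
  have KP: "K * main_poly w \<le> 0" "- (57 * w ^ 3) \<le> K * main_poly w"
  proof -
    show "K * main_poly w \<le> 0" using K mp by (intro mult_nonneg_nonpos) auto
    have "K * (- main_poly w) \<le> 55 * (102/100 * w ^ 3)" using K mp by (intro mult_mono) auto
    then have "- (K * main_poly w) \<le> 561/10 * w ^ 3" by simp
    moreover have "0 \<le> w ^ 3" using w by simp
    ultimately show "- (57 * w ^ 3) \<le> K * main_poly w" by linarith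
  qed
  have Xabs: "\<bar>X\<bar> \<le> 60 * w ^ 3" using X1 KP w63 w by (simp add: abs_le_iff)
  have w3: "60 * w ^ 3 \<le> 1/2" using power_mono[OF w(2), of 3] w by (simp add: power_divide)
  have X2: "X\<^sup>2 \<le> 3600 * w ^ 6"
    using power_mono[OF Xabs, of 2] by (simp add: power_mult_distrib flip: power_mult)
  show "P - 7000000 * w^6 \<le> cubic_overpartition (n + 1) * cubic_overpartition (n - 1) / (cubic_overpartition n)^2"
  proof -
    have "1 + X - 4 * \<delta> - 4 * \<delta> * X = (1 + X) * (1 - 4 * \<delta>)" by (simp add: algebra_simps)
    also have "\<dots> \<le> exp X * (r (n + 1) * r (n - 1) / (r n)^2)"
      using rb(1) \<delta> Xabs w3 by (intro mult_mono exp_ge_add_one_self) auto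
    finally have "1 + X - 4 * \<delta> - 4 * \<delta> * X \<le> exp X * (r (n + 1) * r (n - 1) / (r n)^2)" .
    moreover have "4 * \<delta> * X \<le> 4 * \<delta> * (1/100)"
    proof -
      have "X \<le> 1/100" using Xabs power_mono[OF w(2), of 3] w by (simp add: power_divide)
      then show ?thesis using \<delta> by (intro mult_left_mono) auto
    qed
    ultimately show ?thesis
      using X_bounds w60 \<delta>_def unfolding ratio P_def K_def[symmetric] by linarith
  qed
  show "cubic_overpartition (n + 1) * cubic_overpartition (n - 1) / (cubic_overpartition n)^2 \<le> P + 8700000 * w^6"
  proof -
    have "exp X \<le> 1 / (1 - X)"
      using exp_ge_add_one_self[of "- X"] Xabs w3 by (simp add: exp_minus divide_simps abs_le_iff mult.commute)
    also have "\<dots> \<le> 1 + X + 2 * X^2"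
    proof -
      have "0 \<le> X^2 * (1 - 2 * X)" using Xabs w3 by (intro mult_nonneg_nonneg) auto
      then have "1 \<le> (1 + X + 2 * X^2) * (1 - X)" by (simp add: algebra_simps power2_eq_square)
      then show ?thesis using Xabs w3 by (simp add: pos_divide_le_eq)
    qed
    finally have e: "exp X \<le> 1 + X + 7200 * w ^ 6" using X2 by linarith
    have "0 \<le> \<delta>" by (rule \<delta>)
    have eX: "exp X \<le> 101/100"
    proof -
      have "X \<le> 1/200" using Xabs power_mono[OF w(2), of 3] w by (simp add: power_divide)
      moreover have "7200 * w ^ 6 \<le> 1/200" using w6 by (simp add: power_divide)
      ultimately show ?thesis using e by linarith
    qed
    have "exp X * (r (n + 1) * r (n - 1) / (r n)^2) \<le> exp X * (1 + 5 * \<delta>)"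
      using rb(2) by (intro mult_left_mono) auto
    also have "\<dots> = exp X + exp X * (5 * \<delta>)" by (simp add: algebra_simps)
    also have "\<dots> \<le> (1 + X + 7200 * w ^ 6) + 101/100 * (5 * \<delta>)"
      using e eX \<delta> by (intro add_mono mult_right_mono) auto
    finally show ?thesis
      using X_bounds w60 \<delta>_def unfolding ratio P_def K_def[symmetric] by linarith
  qed
qed

theorem theorem2p3:
  fixes n :: nat
  assumes "n \<ge> 2363"
  shows "Upsilon1 n \<le> (cubic_overpartition (n+1) * cubic_overpartition (n-1))
                          / (cubic_overpartition n ^ 2)
       \<and> (cubic_overpartition (n+1) * cubic_overpartition (n-1))
                          / (cubic_overpartition n ^ 2) \<le> Upsilon2 n"
proof -
  define w where "w = 1 / cubv (real n)"
  define P where "P = 1 + 9 * pi^4 / 16 * main_poly w"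
  have w: "w > 0" using cubv_pos[of "real n"] assms by (simp add: w_def)
  have v: "pi * sqrt (3 * real n / 2) = 1 / w" by (simp add: w_def cubv_def)
  \<comment> \<open>The delicate numerical point: \<open>405/128 * pi^4\<close> is about 308.21,
    just inside the unit interval that the theorem allows.\<close>
  have p4: "308 \<le> 405/128 * pi^4" "405/128 * pi^4 \<le> 309"
    using power_mono[OF pi_approx(1), of 4] power_mono[OF pi_approx(2), of 4] by (simp_all add: power_divide)
  \<comment> \<open>Here \<open>pi > 3\<close> is ample: \<open>729 * 3^12\<close> exceeds 7000000,
    and \<open>729/16 * 3^12\<close>, about 24 million, exceeds 8700000.\<close>
  have p12: "531441 \<le> pi^12" using power_mono[of 3 pi 12] pi_gt3 by simp
  have p8: "0 \<le> pi^8" by simp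
  have "Upsilon1 n = 1 - 9/16 * pi^4 * w^3 + 45/16 * pi^4 * w^4 - 309 * w^5 - (535 + 405/2048 * pi^8 + 729 * pi^12) * w^6"
    unfolding Upsilon1_def Let_def v by (simp add: power_divide algebra_simps)
  also have "\<dots> = P - 7000000 * w^6 - (309 - 405/128 * pi^4) * w^5 - (535 + 405/2048 * pi^8 + 729 * pi^12 - 7000000) * w^6"
    by (simp add: P_def main_poly_def algebra_simps)
  also have "\<dots> \<le> P - 7000000 * w^6"
  proof -
    have "0 \<le> (309 - 405/128 * pi^4) * w^5" using p4 w by (intro mult_nonneg_nonneg) auto
    moreover have "0 \<le> 535 + 405/2048 * pi^8 + 729 * pi^12 - 7000000"
      using p12 p8 by linarith
    then have "0 \<le> (535 + 405/2048 * pi^8 + 729 * pi^12 - 7000000) * w^6"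
      using w by (intro mult_nonneg_nonneg) auto
    ultimately show ?thesis by linarith
  qed
  finally have 1: "Upsilon1 n \<le> P - 7000000 * w^6" .
  have "P + 8700000 * w^6 \<le> P + 8700000 * w^6 + (405/128 * pi^4 - 308) * w^5 + (81/256 * pi^8 + 729/16 * pi^12 - 286 - 8700000) * w^6"
  proof -
    have "0 \<le> (405/128 * pi^4 - 308) * w^5" using p4 w by (intro mult_nonneg_nonneg) auto
    moreover have "0 \<le> 81/256 * pi^8 + 729/16 * pi^12 - 286 - 8700000"
      using p12 p8 by linarith
    then have "0 \<le> (81/256 * pi^8 + 729/16 * pi^12 - 286 - 8700000) * w^6"
      using w by (intro mult_nonneg_nonneg) auto
    ultimately show ?thesis by linarith
  qed
  also have "\<dots> = 1 - 9/16 * pi^4 * w^3 + 45/16 * pi^4 * w^4 - 308 * w^5 - 286 * w^6 + 81/256 * pi^8 * w^6 + 729/16 * pi^12 * w^6"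
    by (simp add: P_def main_poly_def algebra_simps)
  also have "\<dots> = Upsilon2 n"
    unfolding Upsilon2_def Let_def v by (simp add: power_divide algebra_simps)
  finally have 2: "P + 8700000 * w^6 \<le> Upsilon2 n" .
  show ?thesis
    using cubic_overpartition_ratio[OF assms, folded w_def, folded P_def] 1 2 by linarith
qed

end
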